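(* Let $\pi^b$ be the invariant probability measure of the broken system and $h=I_1\sin\theta_1+I_3\sin\theta_3$. For every $T_3>0$, if $\gamma>0$ and $T_1>0$ are sufficiently small, then $\mathrm{Var}_{\pi^b}[h]<\frac1{10}T_3^{2/3}$.
   Context: Broken system on $(0,\infty)^2\times\mathbb T^2$ ($\mathbb T=\mathbb R/2\pi\mathbb Z$), $\mathbf x^b=(I_1,I_3,\theta_1,\theta_3)$, parameters $\gamma,T_1,T_3>0$, independent Brownian motions: $dI_1=\gamma(T_1-I_1^3)dt+\sqrt{\gamma T_1I_1/2}dB^{(1)}_t$, $dI_3=\gamma(T_3-I_3^3)dt+\sqrt{\gamma T_3I_3/2}dB^{(2)}_t$, $d\theta_1=-[I_1(1+2\cos\theta_1)+2I_3\cos\theta_3]dt+\sqrt\gamma dB^{(3)}_t$, $d\theta_3=-[I_3(1+2\cos\theta_3)+2I_1\cos\theta_1]dt+\sqrt\gamma dB^{(4)}_t$. *)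

theory Defs
  imports "HOL-Probability.Probability"
begin

text \<open>State space points x = (I1, I3, theta1, theta3); angles represented in [0, 2 pi).\<close>
type_synonym st = "real \<times> real \<times> real \<times> real"

definition coord :: "nat \<Rightarrow> st \<Rightarrow> real" where
  "coord i x = (case x of (a, b, c, d) \<Rightarrow>
     (if i = 1 then a else if i = 2 then b else if i = 3 then c else d))"

definition upd :: "nat \<Rightarrow> st \<Rightarrow> real \<Rightarrow> st" where
  "upd i x t = (case x of (a, b, c, d) \<Rightarrow>
     (if i = 1 then (t, b, c, d) else if i = 2 then (a, t, c, d)
      else if i = 3 then (a, b, t, d) else (a, b, c, t)))"

definition pd :: "nat \<Rightarrow> (st \<Rightarrow> real) \<Rightarrow> st \<Rightarrow> real" where
  "pd i f x = deriv (\<lambda>t. f (upd i x t)) (coord i x)"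

definition C2 :: "(st \<Rightarrow> real) \<Rightarrow> bool" where
  "C2 f \<longleftrightarrow> continuous_on UNIV f \<and>
     (\<forall>i\<in>{1..4}. (\<forall>x. (\<lambda>t. f (upd i x t)) differentiable (at (coord i x))) \<and>
        continuous_on UNIV (pd i f) \<and>
        (\<forall>j\<in>{1..4}. (\<forall>x. (\<lambda>t. pd i f (upd j x t)) differentiable (at (coord j x))) \<and>
           continuous_on UNIV (pd j (pd i f))))"

definition test_fn :: "(st \<Rightarrow> real) \<Rightarrow> bool" where
  "test_fn f \<longleftrightarrow> C2 f \<and>
     (\<forall>x. f (upd 3 x (coord 3 x + 2 * pi)) = f x) \<and>
     (\<forall>x. f (upd 4 x (coord 4 x + 2 * pi)) = f x) \<and>
     (\<exists>K. compact K \<and> K \<subseteq> {(a, b). 0 < a \<and> 0 < b} \<and>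
        (\<forall>a b c d. (a, b) \<notin> K \<longrightarrow> f (a, b, c, d) = 0))"

definition gen_b :: "real \<Rightarrow> real \<Rightarrow> real \<Rightarrow> (st \<Rightarrow> real) \<Rightarrow> st \<Rightarrow> real" where
  "gen_b \<gamma> T1 T3 f x = (case x of (I1, I3, th1, th3) \<Rightarrow>
       \<gamma> * (T1 - I1 ^ 3) * pd 1 f x
     + \<gamma> * (T3 - I3 ^ 3) * pd 2 f x
     - (I1 * (1 + 2 * cos th1) + 2 * I3 * cos th3) * pd 3 f x
     - (I3 * (1 + 2 * cos th3) + 2 * I1 * cos th1) * pd 4 f x
     + (1/2) * (\<gamma> * T1 * I1 / 2) * pd 1 (pd 1 f) x
     + (1/2) * (\<gamma> * T3 * I3 / 2) * pd 2 (pd 2 f) x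
     + (1/2) * \<gamma> * pd 3 (pd 3 f) x
     + (1/2) * \<gamma> * pd 4 (pd 4 f) x)"

definition state_space :: "st set" where
  "state_space = {(I1, I3, th1, th3). 0 < I1 \<and> 0 < I3 \<and>
      0 \<le> th1 \<and> th1 < 2 * pi \<and> 0 \<le> th3 \<and> th3 < 2 * pi}"

text \<open>Invariant probability measure (stationary Fokker--Planck equation in weak form).\<close>
definition invariant_b :: "real \<Rightarrow> real \<Rightarrow> real \<Rightarrow> st measure \<Rightarrow> bool" where
  "invariant_b \<gamma> T1 T3 \<pi> \<longleftrightarrow> prob_space \<pi> \<and> sets \<pi> = sets borel \<and>
     emeasure \<pi> state_space = 1 \<and>
     (\<forall>f. test_fn f \<longrightarrow> (\<integral>x. gen_b \<gamma> T1 T3 f x \<partial>\<pi>) = 0)"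

definition h_obs :: "st \<Rightarrow> real" where
  "h_obs x = (case x of (I1, I3, th1, th3) \<Rightarrow> I1 * sin th1 + I3 * sin th3)"

end

theory Submission
  imports Defs
begin

text \<open>
  If \<open>G + L f \<le> C\<close> with \<open>f\<close> coercive, then the stationary mean of \<open>G\<close> is at most \<open>C\<close>: apply the
  weak stationarity identity to concave truncations of \<open>f\<close>. Here \<open>f\<close> is a multiple of \<open>1/\<gamma>\<close> times a
  combination of \<open>I\<^sub>1\<close>, \<open>I\<^sub>3\<close>, \<open>- ln I\<^sub>1\<close>, \<open>- ln I\<^sub>3\<close>, plus a localised angular function.

  The angular part is needed since \<open>h \<approx> I\<^sub>3 sin \<theta>\<^sub>3\<close> for small \<open>I\<^sub>1\<close>, and \<open>\<theta>\<^sub>3\<close> has to be located. For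
  small \<open>I\<^sub>1\<close> and \<open>\<gamma>\<close> the flow of \<open>\<theta>\<^sub>3\<close> is a Riccati equation in \<open>tan (\<theta>\<^sub>3/2)\<close>, forced by the rotating phase
  \<open>\<phi> = \<theta>\<^sub>1 - \<theta>\<^sub>3\<close>, with an attracting and a repelling periodic orbit. The repelling one is
  \<open>tan (\<theta>\<^sub>3/2) = sqrt 3 + w \<phi> \<rho>\<close> with \<open>\<rho> = I\<^sub>1 / (I\<^sub>3 - I\<^sub>1)\<close>; Picard iterates, which are trigonometric polynomials
  with bounds uniform in the iteration, approximate \<open>w\<close> to accuracy below \<open>\<gamma>\<close>. With \<open>u\<close> a half-angle distance
  to this orbit, \<open>- ln (u\<^sup>2 + K \<gamma>) + 2/3 cos \<theta>\<^sub>3\<close> decreases along the dynamics except near the attracting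
  angle, where \<open>sin \<theta>\<^sub>3 = - sqrt 3 / 2\<close>. So \<open>h\<close> is close to \<open>- (sqrt 3 / 2) I\<^sub>3\<close> in mean square, and its variance is
  controlled by that of \<open>I\<^sub>3\<close>, which an explicit quartic inequality bounds by \<open>0.095 T\<^sub>3\<close> to the power \<open>2/3\<close>.
\<close>

section \<open>Partial derivatives and the generator\<close>

text \<open>The phase \<theta>1 - \<theta>3 rotates with speed exactly I3 - I1, because the cosine
  terms of the two drifts cancel. This turns the repelling orbit into a periodic solution of a
  scalar equation, with the actions entering only through \<rho>, which changes at rate \<gamma>.
  The obstacle is that on this orbit only the noise, of variance \<gamma>, expels the angle. The
  logarithm is therefore smoothed at the width sqrt \<gamma> of the diffusive layer, and drift
  errors of order \<gamma> are affordable. An approximate orbit in closed form thus suffices and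
  spares the regularity theory of the exact one. The scale \<sigma> with \<sigma>^4 = \<gamma> lies
  between this width and 1, and all losses turn out to be O(\<sigma>) or O(I1). The numerical margin
  is genuine: the I3 equation alone has stationary density proportional to I3^3 exp (- 4 I3^3 / (3
  T3)), for which 3/4 of the variance is about 0.061 T3^(2/3). This law is never identified; the
  quartic replaces it by a bound read off from the weak identity.\<close>

definition C1_on :: "st set \<Rightarrow> (st \<Rightarrow> real) \<Rightarrow> bool" where
  "C1_on S f \<longleftrightarrow> continuous_on S f \<and>
     (\<forall>i. (\<forall>x\<in>S. (\<lambda>t. f (upd i x t)) differentiable (at (coord i x))) \<and> continuous_on S (pd i f))"

definition C2_on :: "st set \<Rightarrow> (st \<Rightarrow> real) \<Rightarrow> bool" where
  "C2_on S f \<longleftrightarrow> C1_on S f \<and> (\<forall>i. C1_on S (pd i f))"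

lemma upd_coord [simp]: "upd i x (coord i x) = x"
  by (cases x) (auto simp: upd_def coord_def)

text \<open>Every index other than 1, 2, 3 is treated by the coordinate functions as the fourth one.\<close>

lemma coord_upd: "coord j (upd i x t) =
    (if i = j \<or> i \<notin> {1,2,3} \<and> j \<notin> {1,2,3} then t else coord j x)"
  by (cases x) (auto simp: upd_def coord_def)

lemma coord_simps: "coord 1 (a,b,c,d) = a" "coord (Suc 0) (a,b,c,d) = a" "coord 2 (a,b,c,d) = b"
  "coord 3 (a,b,c,d) = c" "coord 4 (a,b,c,d) = d"
  by (auto simp: coord_def)

lemma continuous_upd: "continuous_on UNIV (\<lambda>t. upd i x t)"
  by (cases x; cases "i = 1"; cases "i = 2"; cases "i = 3")
     (simp_all add: upd_def continuous_intros)

lemma continuous_on_coord [continuous_intros]: "continuous_on S (coord i)"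
  unfolding coord_def
  by (cases "i = 1"; cases "i = 2"; cases "i = 3") (simp_all add: case_prod_beta continuous_intros)

lemma eventually_upd:
  assumes "open S" "x \<in> S"
  shows "\<forall>\<^sub>F t in nhds (coord i x). upd i x t \<in> S"
proof -
  have "open ((\<lambda>t. upd i x t) -` S)"
    using continuous_upd assms(1) by (metis open_vimage)
  then show ?thesis
    unfolding eventually_nhds using assms(2) by (intro exI[of _ "(\<lambda>t. upd i x t) -` S"]) auto
qed

lemma pd_DERIV:
  assumes "C1_on S f" "x \<in> S"
  shows "((\<lambda>t. f (upd i x t)) has_real_derivative pd i f x) (at (coord i x))"
  using assms unfolding C1_on_def pd_def by (metis DERIV_deriv_iff_real_differentiable)

lemma pd_eqI:
  "((\<lambda>t. f (upd i x t)) has_real_derivative D) (at (coord i x)) \<Longrightarrow> pd i f x = D"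
  unfolding pd_def by (rule DERIV_imp_deriv)

lemma C1_onI:
  assumes "continuous_on S f"
    and "\<And>i x. x \<in> S \<Longrightarrow> ((\<lambda>t. f (upd i x t)) has_real_derivative g i x) (at (coord i x))"
    and "\<And>i. continuous_on S (g i)"
  shows "C1_on S f"
proof -
  have *: "pd i f x = g i x" if "x \<in> S" for i x
    using assms(2)[OF that] by (rule pd_eqI)
  have "continuous_on S (pd i f)" for i
    using assms(3)[of i] * by (simp cong: continuous_on_cong)
  with assms(1,2) show ?thesis
    unfolding C1_on_def using real_differentiable_def by blast
qed

lemma C1_on_continuous: "C1_on S f \<Longrightarrow> continuous_on S f"
  and C1_on_continuous_pd: "C1_on S f \<Longrightarrow> continuous_on S (pd i f)"
  by (auto simp: C1_on_def)

lemma C2_on_C1: "C2_on S f \<Longrightarrow> C1_on S f"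
  and C2_on_pd: "C2_on S f \<Longrightarrow> C1_on S (pd i f)"
  by (auto simp: C2_on_def)

lemma pd_cong:
  assumes "open S" "x \<in> S" "\<And>y. y \<in> S \<Longrightarrow> f y = g y"
  shows "pd i f x = pd i g x"
  unfolding pd_def
  by (rule deriv_cong_ev)
     (rule eventually_mono[OF eventually_upd[OF assms(1,2)]], auto simp only: assms(3))

lemma C1_on_cong:
  assumes "open S" "\<And>y. y \<in> S \<Longrightarrow> f y = g y" "C1_on S g"
  shows "C1_on S f"
proof (rule C1_onI[where g="\<lambda>i. pd i g"])
  show "continuous_on S f"
    using C1_on_continuous[OF assms(3)] assms(2) by (simp cong: continuous_on_cong)
  fix i x assume x: "x \<in> S"
  have "((\<lambda>t. f (upd i x t)) has_real_derivative pd i g x) (at (coord i x)) \<longleftrightarrow>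
        ((\<lambda>t. g (upd i x t)) has_real_derivative pd i g x) (at (coord i x))"
    by (rule DERIV_cong_ev[OF refl _ refl])
       (rule eventually_mono[OF eventually_upd[OF assms(1) x]], auto simp only: assms(2))
  then show "((\<lambda>t. f (upd i x t)) has_real_derivative pd i g x) (at (coord i x))"
    using pd_DERIV[OF assms(3) x] by simp
qed (use assms in \<open>auto intro: C1_on_continuous_pd\<close>)

lemma C2_on_cong:
  assumes "open S" "\<And>y. y \<in> S \<Longrightarrow> f y = g y" "C2_on S g"
  shows "C2_on S f"
  using assms unfolding C2_on_def by (metis C1_on_cong pd_cong)

lemma C1_on_subset: "C1_on S f \<Longrightarrow> T \<subseteq> S \<Longrightarrow> C1_on T f"
  unfolding C1_on_def by (meson continuous_on_subset subsetD)

lemma C2_on_subset: "C2_on S f \<Longrightarrow> T \<subseteq> S \<Longrightarrow> C2_on T f"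
  unfolding C2_on_def by (meson C1_on_subset)

text \<open>The conditions are local, so regularity can be checked on an open cover. Functions
  vanishing near the edge of their natural domain are extended by zero in this way.\<close>

lemma C1_on_Un:
  assumes "open S" "open T" "C1_on S f" "C1_on T f"
  shows "C1_on (S \<union> T) f"
  using assms unfolding C1_on_def by (auto intro: continuous_on_open_Un)

lemma C2_on_Un:
  assumes "open S" "open T" "C2_on S f" "C2_on T f"
  shows "C2_on (S \<union> T) f"
  using assms unfolding C2_on_def by (auto intro: C1_on_Un)

section \<open>Sum, product and chain rules for partial derivatives and the generator\<close>

lemma pd_const [simp]: "pd i (\<lambda>x. c) = (\<lambda>x. 0)"
  by (rule ext) (rule pd_eqI, auto intro!: derivative_eq_intros)

lemma C1_on_const [simp, intro]: "C1_on S (\<lambda>x. c)"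
  by (rule C1_onI[where g="\<lambda>i x. 0"]) (auto intro!: derivative_eq_intros continuous_intros)

lemma C2_on_const [simp, intro]: "C2_on S (\<lambda>x. c)"
  by (simp add: C2_on_def)

lemma coord_DERIV: "((\<lambda>t. coord j (upd i x t)) has_real_derivative
    (if i = j \<or> i \<notin> {1,2,3} \<and> j \<notin> {1,2,3} then 1 else 0)) (at s)"
  by (auto simp: coord_upd intro!: derivative_eq_intros)

lemma pd_coord: "pd i (coord j) = (\<lambda>x. if i = j \<or> i \<notin> {1,2,3} \<and> j \<notin> {1,2,3} then 1 else 0)"
  by (rule ext, rule pd_eqI, rule coord_DERIV)

lemma C1_on_coord: "C1_on S (coord j)"
  by (rule C1_onI[OF continuous_on_coord coord_DERIV]) auto

lemma C2_on_coord [simp, intro]: "C2_on S (coord j)"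
  unfolding C2_on_def pd_coord by (auto intro: C1_on_coord)

lemma add_DERIV:
  assumes "C1_on S f" "C1_on S g" "x \<in> S"
  shows "((\<lambda>t. f (upd i x t) + g (upd i x t)) has_real_derivative pd i f x + pd i g x) (at (coord i x))"
  by (rule DERIV_add; rule pd_DERIV; fact)

lemma mult_DERIV:
  assumes "C1_on S f" "C1_on S g" "x \<in> S"
  shows "((\<lambda>t. f (upd i x t) * g (upd i x t)) has_real_derivative
           pd i f x * g x + f x * pd i g x) (at (coord i x))"
  using DERIV_mult[OF pd_DERIV[OF assms(1,3)] pd_DERIV[OF assms(2,3)], of i]
  by (simp add: algebra_simps)

lemma comp_DERIV:
  assumes "C1_on S f" "x \<in> S" "(v has_real_derivative D) (at (f x))"
  shows "((\<lambda>t. v (f (upd i x t))) has_real_derivative D * pd i f x) (at (coord i x))"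
  using DERIV_chain2[where f=v and g="\<lambda>t. f (upd i x t)", OF _ pd_DERIV[OF assms(1,2)]] assms(3)
  by simp

lemma pd_add: "C1_on S f \<Longrightarrow> C1_on S g \<Longrightarrow> x \<in> S \<Longrightarrow> pd i (\<lambda>x. f x + g x) x = pd i f x + pd i g x"
  by (rule pd_eqI, rule add_DERIV)

lemma pd_mult: "C1_on S f \<Longrightarrow> C1_on S g \<Longrightarrow> x \<in> S \<Longrightarrow>
    pd i (\<lambda>x. f x * g x) x = pd i f x * g x + f x * pd i g x"
  by (rule pd_eqI, rule mult_DERIV)

lemma pd_comp: "C1_on S f \<Longrightarrow> x \<in> S \<Longrightarrow> (v has_real_derivative D) (at (f x)) \<Longrightarrow>
    pd i (\<lambda>x. v (f x)) x = D * pd i f x"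
  by (rule pd_eqI, rule comp_DERIV)

lemma C1_on_add:
  assumes "C1_on S f" "C1_on S g"
  shows "C1_on S (\<lambda>x. f x + g x)"
  by (rule C1_onI[OF _ add_DERIV[OF assms]])
     (intro continuous_intros C1_on_continuous[OF assms(1)] C1_on_continuous[OF assms(2)]
        C1_on_continuous_pd[OF assms(1)] C1_on_continuous_pd[OF assms(2)], assumption?)+

lemma C1_on_mult:
  assumes "C1_on S f" "C1_on S g"
  shows "C1_on S (\<lambda>x. f x * g x)"
  by (rule C1_onI[OF _ mult_DERIV[OF assms]])
     (intro continuous_intros C1_on_continuous[OF assms(1)] C1_on_continuous[OF assms(2)]
        C1_on_continuous_pd[OF assms(1)] C1_on_continuous_pd[OF assms(2)], assumption?)+

lemma C1_on_comp:
  assumes "C1_on S f" "\<And>x. x \<in> S \<Longrightarrow> f x \<in> J"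
    and "\<And>s. s \<in> J \<Longrightarrow> (v has_real_derivative v' s) (at s)" "continuous_on J v'"
  shows "C1_on S (\<lambda>x. v (f x))"
proof (rule C1_onI[OF _ comp_DERIV[OF assms(1) _ assms(3)[OF assms(2)]]])
  have "continuous_on J v"
    using assms(3) by (meson DERIV_isCont continuous_at_imp_continuous_on)
  then show "continuous_on S (\<lambda>x. v (f x))"
    by (rule continuous_on_compose2) (use assms in \<open>auto intro: C1_on_continuous\<close>)
  show "continuous_on S (\<lambda>x. v' (f x) * pd i f x)" for i
    by (intro continuous_on_mult C1_on_continuous_pd[OF assms(1)] continuous_on_compose2[OF assms(4)])
       (use assms in \<open>auto intro: C1_on_continuous\<close>)
qed auto

lemma C2_on_add:
  assumes "open S" "C2_on S f" "C2_on S g"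
  shows "C2_on S (\<lambda>x. f x + g x)"
proof -
  note f = C2_on_C1[OF assms(2)] C2_on_pd[OF assms(2)] and g = C2_on_C1[OF assms(3)] C2_on_pd[OF assms(3)]
  have "C1_on S (pd i (\<lambda>x. f x + g x))" for i
    by (rule C1_on_cong[OF assms(1) pd_add[OF f(1) g(1)]]) (auto intro!: C1_on_add f g)
  then show ?thesis
    unfolding C2_on_def using f g C1_on_add by blast
qed

lemma C2_on_mult:
  assumes "open S" "C2_on S f" "C2_on S g"
  shows "C2_on S (\<lambda>x. f x * g x)"
proof -
  note f = C2_on_C1[OF assms(2)] C2_on_pd[OF assms(2)] and g = C2_on_C1[OF assms(3)] C2_on_pd[OF assms(3)]
  have "C1_on S (pd i (\<lambda>x. f x * g x))" for i
    by (rule C1_on_cong[OF assms(1) pd_mult[OF f(1) g(1)]]) (auto intro!: C1_on_add C1_on_mult f g)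
  then show ?thesis
    unfolding C2_on_def using f g C1_on_mult by blast
qed

lemma C2_on_comp:
  assumes "open S" "C2_on S f" "\<And>x. x \<in> S \<Longrightarrow> f x \<in> J"
    and v': "\<And>s. s \<in> J \<Longrightarrow> (v has_real_derivative v' s) (at s)"
    and v'': "\<And>s. s \<in> J \<Longrightarrow> (v' has_real_derivative v'' s) (at s)" and c: "continuous_on J v''"
  shows "C2_on S (\<lambda>x. v (f x))"
proof -
  note f = C2_on_C1[OF assms(2)] C2_on_pd[OF assms(2)]
  have cv': "continuous_on J v'"
    using v'' by (meson DERIV_isCont continuous_at_imp_continuous_on)
  have "C1_on S (pd i (\<lambda>x. v (f x)))" for i
    by (rule C1_on_cong[OF assms(1) pd_comp[OF f(1) _ v'[OF assms(3)]]])
       (auto intro!: C1_on_mult f C1_on_comp[OF f(1) assms(3) v'' c])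
  then show ?thesis
    unfolding C2_on_def using C1_on_comp[OF f(1) assms(3) v' cv'] by blast
qed

lemma pd_pd_add:
  assumes "open S" "C2_on S f" "C2_on S g" "x \<in> S"
  shows "pd j (pd i (\<lambda>x. f x + g x)) x = pd j (pd i f) x + pd j (pd i g) x"
proof -
  note f = C2_on_C1[OF assms(2)] C2_on_pd[OF assms(2)] and g = C2_on_C1[OF assms(3)] C2_on_pd[OF assms(3)]
  have "pd j (pd i (\<lambda>x. f x + g x)) x = pd j (\<lambda>x. pd i f x + pd i g x) x"
    by (rule pd_cong[OF assms(1,4) pd_add[OF f(1) g(1)]])
  then show ?thesis
    using pd_add[OF f(2) g(2) assms(4)] by simp
qed

lemma pd_pd_mult:
  assumes "open S" "C2_on S f" "C2_on S g" "x \<in> S"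
  shows "pd j (pd i (\<lambda>x. f x * g x)) x =
    pd j (pd i f) x * g x + pd i f x * pd j g x + pd j f x * pd i g x + f x * pd j (pd i g) x"
proof -
  note f = C2_on_C1[OF assms(2)] C2_on_pd[OF assms(2)] and g = C2_on_C1[OF assms(3)] C2_on_pd[OF assms(3)]
  have "pd j (pd i (\<lambda>x. f x * g x)) x = pd j (\<lambda>x. pd i f x * g x + f x * pd i g x) x"
    by (rule pd_cong[OF assms(1,4) pd_mult[OF f(1) g(1)]])
  also have "\<dots> = pd j (\<lambda>x. pd i f x * g x) x + pd j (\<lambda>x. f x * pd i g x) x"
    by (rule pd_add[OF _ _ assms(4)]) (auto intro!: C1_on_mult f g)
  finally show ?thesis
    using pd_mult[OF f(2) g(1) assms(4), of j i] pd_mult[OF f(1) g(2) assms(4), of j i] by simp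
qed

lemma pd_pd_comp:
  assumes "open S" "C2_on S f" "\<And>x. x \<in> S \<Longrightarrow> f x \<in> J"
    and v': "\<And>s. s \<in> J \<Longrightarrow> (v has_real_derivative v' s) (at s)"
    and v'': "\<And>s. s \<in> J \<Longrightarrow> (v' has_real_derivative v'' s) (at s)" and c: "continuous_on J v''"
    and x: "x \<in> S"
  shows "pd j (pd i (\<lambda>x. v (f x))) x = v'' (f x) * pd j f x * pd i f x + v' (f x) * pd j (pd i f) x"
proof -
  note f = C2_on_C1[OF assms(2)] C2_on_pd[OF assms(2)]
  have "pd j (pd i (\<lambda>x. v (f x))) x = pd j (\<lambda>x. v' (f x) * pd i f x) x"
    by (rule pd_cong[OF assms(1) x pd_comp[OF f(1) _ v'[OF assms(3)]]])
  also have "\<dots> = pd j (\<lambda>x. v' (f x)) x * pd i f x + v' (f x) * pd j (pd i f) x"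
    by (rule pd_mult[OF C1_on_comp[OF f(1) assms(3) v'' c] f(2) x])
  also have "pd j (\<lambda>x. v' (f x)) x = v'' (f x) * pd j f x"
    by (rule pd_comp[OF f(1) x v''[OF assms(3)[OF x]]])
  finally show ?thesis .
qed

text \<open>The carre du champ of the generator, normalised so that it enters the product rule whole
  and the second-order chain rule with factor 1/2.\<close>

definition diff_b :: "real \<Rightarrow> real \<Rightarrow> real \<Rightarrow> (st \<Rightarrow> real) \<Rightarrow> (st \<Rightarrow> real) \<Rightarrow> st \<Rightarrow> real" where
  "diff_b \<gamma> T1 T3 f g x =
     \<gamma> * T1 * coord 1 x / 2 * pd 1 f x * pd 1 g x + \<gamma> * T3 * coord 2 x / 2 * pd 2 f x * pd 2 g x
     + \<gamma> * pd 3 f x * pd 3 g x + \<gamma> * pd 4 f x * pd 4 g x"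

lemma gen_b_alt: "gen_b \<gamma> T1 T3 f x =
       \<gamma> * (T1 - coord 1 x ^ 3) * pd 1 f x
     + \<gamma> * (T3 - coord 2 x ^ 3) * pd 2 f x
     - (coord 1 x * (1 + 2 * cos (coord 3 x)) + 2 * coord 2 x * cos (coord 4 x)) * pd 3 f x
     - (coord 2 x * (1 + 2 * cos (coord 4 x)) + 2 * coord 1 x * cos (coord 3 x)) * pd 4 f x
     + (1/2) * (\<gamma> * T1 * coord 1 x / 2) * pd 1 (pd 1 f) x
     + (1/2) * (\<gamma> * T3 * coord 2 x / 2) * pd 2 (pd 2 f) x
     + (1/2) * \<gamma> * pd 3 (pd 3 f) x
     + (1/2) * \<gamma> * pd 4 (pd 4 f) x"
  by (cases x) (simp add: gen_b_def coord_simps)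

lemma gen_b_cong:
  assumes "open S" "x \<in> S" "\<And>y. y \<in> S \<Longrightarrow> f y = g y"
  shows "gen_b \<gamma> T1 T3 f x = gen_b \<gamma> T1 T3 g x"
proof -
  have "pd i f y = pd i g y" if "y \<in> S" for i y
    using pd_cong[OF assms(1) that assms(3)] .
  then show ?thesis
    unfolding gen_b_alt using pd_cong[OF assms(1,2), of "pd i f" "pd i g" for i] assms(2) by simp
qed

lemma gen_b_const [simp]: "gen_b \<gamma> T1 T3 (\<lambda>x. c) x = 0"
  by (simp add: gen_b_alt)

lemma gen_b_add:
  assumes "open S" "C2_on S f" "C2_on S g" "x \<in> S"
  shows "gen_b \<gamma> T1 T3 (\<lambda>x. f x + g x) x = gen_b \<gamma> T1 T3 f x + gen_b \<gamma> T1 T3 g x"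
  unfolding gen_b_alt pd_pd_add[OF assms] pd_add[OF C2_on_C1[OF assms(2)] C2_on_C1[OF assms(3)] assms(4)]
  by (simp add: algebra_simps)

lemma gen_b_mult:
  assumes "open S" "C2_on S f" "C2_on S g" "x \<in> S"
  shows "gen_b \<gamma> T1 T3 (\<lambda>x. f x * g x) x =
    g x * gen_b \<gamma> T1 T3 f x + f x * gen_b \<gamma> T1 T3 g x + diff_b \<gamma> T1 T3 f g x"
  unfolding gen_b_alt diff_b_def pd_pd_mult[OF assms] pd_mult[OF C2_on_C1[OF assms(2)] C2_on_C1[OF assms(3)] assms(4)]
  by (simp add: algebra_simps)

lemma gen_b_cmult:
  assumes "open S" "C2_on S f" "x \<in> S"
  shows "gen_b \<gamma> T1 T3 (\<lambda>x. c * f x) x = c * gen_b \<gamma> T1 T3 f x"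
  using gen_b_mult[OF assms(1) C2_on_const assms(2,3), of \<gamma> T1 T3 c] by (simp add: diff_b_def)

lemma gen_b_comp:
  assumes "open S" "C2_on S f" "\<And>x. x \<in> S \<Longrightarrow> f x \<in> J"
    and v': "\<And>s. s \<in> J \<Longrightarrow> (v has_real_derivative v' s) (at s)"
    and v'': "\<And>s. s \<in> J \<Longrightarrow> (v' has_real_derivative v'' s) (at s)" and c: "continuous_on J v''"
    and x: "x \<in> S"
  shows "gen_b \<gamma> T1 T3 (\<lambda>x. v (f x)) x =
    v' (f x) * gen_b \<gamma> T1 T3 f x + (1/2) * v'' (f x) * diff_b \<gamma> T1 T3 f f x"
proof -
  have 1: "pd i (\<lambda>x. v (f x)) x = v' (f x) * pd i f x" for i
    by (rule pd_comp[OF C2_on_C1[OF assms(2)] x v'[OF assms(3)[OF x]]])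
  have 2: "pd i (pd i (\<lambda>x. v (f x))) x = v'' (f x) * pd i f x * pd i f x + v' (f x) * pd i (pd i f) x" for i
    by (rule pd_pd_comp[OF assms(1,2,3) v' v'' c x])
  show ?thesis
    unfolding gen_b_alt diff_b_def 1 2 by (simp add: algebra_simps)
qed

lemma C2_on_UNIV: "C2_on UNIV f \<Longrightarrow> C2 f"
  unfolding C2_on_def C1_on_def C2_def by auto

definition act_pos :: "st set" where
  "act_pos = {x. 0 < coord 1 x \<and> 0 < coord 2 x}"

lemma open_act_pos [simp]: "open act_pos"
  unfolding act_pos_def by (intro open_Collect_conj open_Collect_less continuous_intros)

section \<open>Lyapunov functions\<close>

lemma power_pos_DERIV:
  "((\<lambda>s::real. (max 0 s) ^ (n + 2)) has_real_derivative real (n + 2) * (max 0 s) ^ (n + 1)) (at s)"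
proof (cases s "0::real" rule: linorder_cases)
  case less
  have "((\<lambda>s::real. 0) has_real_derivative 0) (at s)" by simp
  then show ?thesis
    using has_field_derivative_transform_within_open[of "\<lambda>s::real. 0" 0 s "{..<0}" "\<lambda>s. (max 0 s) ^ (n + 2)"] less
    by (auto simp: max_def)
next
  case greater
  have "((\<lambda>s. s ^ (n + 2)) has_real_derivative real (n + 2) * s ^ (n + 1)) (at s)"
    using DERIV_pow[of "n + 2" s] by simp
  then show ?thesis
    using has_field_derivative_transform_within_open[of "\<lambda>s. s ^ (n + 2)" "real (n + 2) * s ^ (n + 1)" s "{0<..}"
        "\<lambda>s. (max 0 s) ^ (n + 2)"] greater
    by (auto simp: max_def)
next
  case equal
  have "(\<lambda>h::real. (max 0 h) ^ (n + 2) / h) \<midarrow>0\<rightarrow> 0"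
  proof (rule tendsto_sandwich[of "\<lambda>h. - (\<bar>h\<bar> ^ (n + 1))" _ _ "\<lambda>h. \<bar>h\<bar> ^ (n + 1)"])
    show "((\<lambda>h::real. - (\<bar>h\<bar> ^ (n + 1))) \<longlongrightarrow> 0) (at 0)" "((\<lambda>h::real. \<bar>h\<bar> ^ (n + 1)) \<longlongrightarrow> 0) (at 0)"
      by (auto intro!: tendsto_eq_intros)
  qed (auto simp: max_def mult_nonpos_nonneg intro!: always_eventually)
  then show ?thesis
    using equal by (simp add: DERIV_def)
qed

lemma cube_pos_DERIV: "((\<lambda>s::real. (max 0 s) ^ 3) has_real_derivative 3 * (max 0 s)^2) (at s)"
  and square_pos_DERIV: "((\<lambda>s::real. (max 0 s)^2) has_real_derivative 2 * max 0 s) (at s)"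
  using power_pos_DERIV[of 1 s] power_pos_DERIV[of 0 s] by (simp_all add: numeral_eq_Suc)

text \<open>A concave function of class \<open>C\<^sup>2\<close>, the identity on the negative half-line and constant beyond 2.\<close>

definition trunc :: "real \<Rightarrow> real" where
  "trunc y = y - ((max 0 y) ^ 3 - 2 * (max 0 (y - 1)) ^ 3 + (max 0 (y - 2)) ^ 3) / 6"

definition trunc' :: "real \<Rightarrow> real" where
  "trunc' y = 1 - ((max 0 y)^2 - 2 * (max 0 (y - 1))^2 + (max 0 (y - 2))^2) / 2"

text \<open>Minus the hat function on [0, 2] with peak 1 at 1. Its mass is 1, so the slope
  \<open>trunc'\<close> falls from 1 to exactly 0.\<close>

definition trunc'' :: "real \<Rightarrow> real" where
  "trunc'' y = - (max 0 y - 2 * max 0 (y - 1) + max 0 (y - 2))"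

text \<open>The subtracted 1 is the terminal value of \<open>trunc\<close>: the composed function
  then vanishes far out, as a test function must.\<close>

lemma trunc_DERIV: "((\<lambda>s. trunc (s - N) - 1) has_real_derivative trunc' (s - N)) (at s)"
proof -
  have d: "((\<lambda>s. s - a) has_real_derivative 1) (at s)" for a
    by (auto intro!: derivative_eq_intros)
  have c: "((\<lambda>s. (max 0 (s - a)) ^ 3) has_real_derivative 3 * (max 0 (s - a))^2) (at s)" for a
    using DERIV_chain2[OF cube_pos_DERIV d] by simp
  have "((\<lambda>s. (s - N) - ((max 0 (s - N)) ^ 3 - 2 * (max 0 (s - (N + 1))) ^ 3 + (max 0 (s - (N + 2))) ^ 3) / 6 - 1)
      has_real_derivative (1 - (3 * (max 0 (s - N))^2 - 2 * (3 * (max 0 (s - (N + 1)))^2) + 3 * (max 0 (s - (N + 2)))^2) / 6 - 0)) (at s)"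
    by (intro DERIV_diff DERIV_add DERIV_cdivide DERIV_cmult c d DERIV_const)
  then show ?thesis
    by (simp add: trunc_def trunc'_def algebra_simps diff_divide_distrib add_divide_distrib)
qed

lemma trunc'_DERIV: "((\<lambda>s. trunc' (s - N)) has_real_derivative trunc'' (s - N)) (at s)"
proof -
  have d: "((\<lambda>s. s - a) has_real_derivative 1) (at s)" for a
    by (auto intro!: derivative_eq_intros)
  have c: "((\<lambda>s. (max 0 (s - a))^2) has_real_derivative 2 * max 0 (s - a)) (at s)" for a
    using DERIV_chain2[OF square_pos_DERIV d] by simp
  have "((\<lambda>s. 1 - ((max 0 (s - N))^2 - 2 * (max 0 (s - (N + 1)))^2 + (max 0 (s - (N + 2)))^2) / 2)
      has_real_derivative (0 - (2 * max 0 (s - N) - 2 * (2 * max 0 (s - (N + 1))) + 2 * max 0 (s - (N + 2))) / 2)) (at s)"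
    by (intro DERIV_diff DERIV_add DERIV_cdivide DERIV_cmult c DERIV_const)
  then show ?thesis
    by (simp add: trunc'_def trunc''_def algebra_simps diff_divide_distrib add_divide_distrib)
qed

lemma trunc''_le: "trunc'' y \<le> 0"
  by (auto simp: trunc''_def max_def)

lemma trunc'_eq_1: "y \<le> 0 \<Longrightarrow> trunc' y = 1"
  by (auto simp: trunc'_def max_def)

lemma trunc_eq_1: "y \<ge> 2 \<Longrightarrow> trunc y = 1"
  by (auto simp: trunc_def max_def power3_eq_cube field_simps)

lemma trunc'_bounds: "0 \<le> trunc' y" "trunc' y \<le> 1"
proof -
  consider "y \<le> 0" | "0 < y" "y \<le> 1" | "1 < y" "y \<le> 2" | "2 < y" by linarith
  then have "0 \<le> trunc' y \<and> trunc' y \<le> 1"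
  proof cases
    case 2
    then have "trunc' y = 1 - y^2 / 2" by (simp add: trunc'_def)
    moreover have "y^2 \<le> 1" using 2 by (simp add: power_le_one)
    ultimately show ?thesis by simp
  next
    case 3
    then have "trunc' y = (2 - y)^2 / 2"
      by (simp add: trunc'_def power2_eq_square field_simps)
    moreover have "(2 - y)^2 \<le> 1" using 3 by (simp add: power_le_one)
    moreover have "0 \<le> (2 - y)^2" by simp
    ultimately show ?thesis by linarith
  next
    case 4
    then have "trunc' y = 0" by (simp add: trunc'_def power2_eq_square field_simps)
    then show ?thesis by simp
  qed (simp add: trunc'_eq_1)
  then show "0 \<le> trunc' y" "trunc' y \<le> 1" by auto
qed

section \<open>From a pointwise drift inequality to a stationary mean\<close>

lemma diff_b_self_nonneg:
  assumes "0 \<le> \<gamma>" "0 \<le> T1" "0 \<le> T3" "x \<in> act_pos"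
  shows "0 \<le> diff_b \<gamma> T1 T3 f f x"
proof -
  have *: "0 \<le> k * p * p" if "0 \<le> k" for k p :: real
    using that by (metis mult.assoc mult_nonneg_nonneg zero_le_square)
  have "0 \<le> coord 1 x" "0 \<le> coord 2 x"
    using assms(4) by (simp_all add: act_pos_def)
  then show ?thesis
    unfolding diff_b_def by (intro add_nonneg_nonneg * divide_nonneg_nonneg mult_nonneg_nonneg assms) simp_all
qed

lemma gen_b_continuous:
  assumes "C2_on S f"
  shows "continuous_on S (gen_b \<gamma> T1 T3 f)"
proof -
  have p: "continuous_on S (pd i f)" "continuous_on S (pd i (pd i f))" for i
    using C1_on_continuous_pd C2_on_C1[OF assms] C2_on_pd[OF assms] by blast+
  show ?thesis
    unfolding gen_b_alt[abs_def]
    by (intro continuous_on_add continuous_on_diff continuous_on_mult continuous_on_power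
        continuous_on_const continuous_on_cos p continuous_on_coord continuous_on_divide) simp_all
qed

text \<open>Coercivity makes the truncation of \<open>f\<close> constant outside a compact set of
  actions, hence a test function after the shift. Concavity gives the Ito term a favourable sign, so
  truncating loses nothing in an upper bound.\<close>

lemma truncated_lyapunov:
  assumes pos: "0 < \<gamma>" "0 < T1" "0 < T3"
    and f: "C2_on act_pos f"
    and per: "\<And>x. x \<in> act_pos \<Longrightarrow> f (upd 3 x (coord 3 x + 2 * pi)) = f x"
      "\<And>x. x \<in> act_pos \<Longrightarrow> f (upd 4 x (coord 4 x + 2 * pi)) = f x"
    and K: "compact K" "K \<subseteq> {(a, b). 0 < a \<and> 0 < b}"
      "\<And>x. x \<in> act_pos \<Longrightarrow> (coord 1 x, coord 2 x) \<notin> K \<Longrightarrow> N + 2 \<le> f x"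
    and g: "g = (\<lambda>x. if x \<in> act_pos then trunc (f x - N) - 1 else 0)"
  shows "test_fn g"
    and "\<And>x. x \<in> act_pos \<Longrightarrow> gen_b \<gamma> T1 T3 g x \<le> trunc' (f x - N) * gen_b \<gamma> T1 T3 f x"
    and "\<exists>M. \<forall>x\<in>state_space. \<bar>gen_b \<gamma> T1 T3 g x\<bar> \<le> M" (is ?P1)
    and "continuous_on UNIV (gen_b \<gamma> T1 T3 g)" (is ?P2)
proof -
  define V where "V = {x. (coord 1 x, coord 2 x) \<notin> K}"
  have "closed ((\<lambda>x. (coord 1 x, coord 2 x)) -` K)"
    by (intro closed_vimage compact_imp_closed K continuous_intros)
  moreover have "V = - ((\<lambda>x. (coord 1 x, coord 2 x)) -` K)"
    by (auto simp: V_def)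
  ultimately have oV: "open V" by (simp add: open_Compl)
  have gV: "g x = 0" if "x \<in> V" for x
    using that K(3)[of x] by (auto simp: g V_def trunc_eq_1)
  have UV: "act_pos \<union> V = UNIV"
    using K(2) by (auto simp: V_def act_pos_def)
  have c'': "continuous_on UNIV (\<lambda>s. trunc'' (s - N))"
    unfolding trunc''_def by (intro continuous_intros)
  have "C2_on act_pos (\<lambda>x. trunc (f x - N) - 1)"
    by (rule C2_on_comp[OF open_act_pos f _ trunc_DERIV trunc'_DERIV c'']) auto
  then have gU2: "C2_on act_pos g"
    by (rule C2_on_cong[rotated 2]) (auto simp: g)
  have gV2: "C2_on V g"
    by (rule C2_on_cong[OF oV _ C2_on_const[of _ 0]]) (auto simp: gV)
  have g2: "C2_on UNIV g"
    using C2_on_Un[OF open_act_pos oV gU2 gV2] UV by simp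
  have upd_pos: "upd i x t \<in> act_pos \<longleftrightarrow> x \<in> act_pos" if "i = 3 \<or> i = 4" for i x t
    using that by (auto simp: act_pos_def coord_upd)
  show "test_fn g"
    unfolding test_fn_def
  proof (intro conjI exI[of _ K] allI impI C2_on_UNIV g2 K)
    show "g (upd 3 x (coord 3 x + 2 * pi)) = g x" "g (upd 4 x (coord 4 x + 2 * pi)) = g x" for x
      using per[of x] by (auto simp: g upd_pos)
    show "g (a, b, c, d) = 0" if "(a, b) \<notin> K" for a b c d
      using that by (intro gV) (simp add: V_def coord_def)
  qed
  show cg: ?P2
    by (rule gen_b_continuous[OF g2])
  show "gen_b \<gamma> T1 T3 g x \<le> trunc' (f x - N) * gen_b \<gamma> T1 T3 f x" if x: "x \<in> act_pos" for x
  proof -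
    have "gen_b \<gamma> T1 T3 g x = gen_b \<gamma> T1 T3 (\<lambda>x. trunc (f x - N) - 1) x"
      by (rule gen_b_cong[OF open_act_pos x]) (simp add: g)
    also have "\<dots> = trunc' (f x - N) * gen_b \<gamma> T1 T3 f x + (1/2) * trunc'' (f x - N) * diff_b \<gamma> T1 T3 f f x"
      by (rule gen_b_comp[OF open_act_pos f _ trunc_DERIV trunc'_DERIV c'' x]) auto
    also have "\<dots> \<le> trunc' (f x - N) * gen_b \<gamma> T1 T3 f x"
      using diff_b_self_nonneg[of \<gamma> T1 T3 x f] trunc''_le[of "f x - N"] pos x
      by (simp add: mult_nonpos_nonneg)
    finally show ?thesis .
  qed
  \<comment> \<open>The half-open angles are put into closed intervals, so that continuity on a
    compact set bounds the generator.\<close>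
  define D where "D = (\<lambda>((a,b),(c,d)). (a,b,c,d)) ` (K \<times> ({0..2*pi} \<times> {0..2*pi} :: (real \<times> real) set))"
  have "compact D"
    unfolding D_def
    by (intro compact_continuous_image compact_Times K compact_Icc) (auto simp: case_prod_beta intro!: continuous_intros)
  then have "compact (gen_b \<gamma> T1 T3 g ` D)"
    using cg by (intro compact_continuous_image) (auto intro: continuous_on_subset)
  then obtain M where M: "\<And>x. x \<in> D \<Longrightarrow> \<bar>gen_b \<gamma> T1 T3 g x\<bar> \<le> M"
    using compact_imp_bounded bounded_iff by (metis imageI real_norm_def)
  have "\<bar>gen_b \<gamma> T1 T3 g x\<bar> \<le> max M 0" if x: "x \<in> state_space" for x
  proof (cases "x \<in> V")
    case True
    have "gen_b \<gamma> T1 T3 g x = gen_b \<gamma> T1 T3 (\<lambda>x. 0) x"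
      by (rule gen_b_cong[OF oV True]) (simp add: gV)
    then show ?thesis by simp
  next
    case False
    obtain a b c d where [simp]: "x = (a,b,c,d)" by (cases x) auto
    have "x \<in> D"
      unfolding D_def using False x
      by (intro image_eqI[of _ _ "((a,b),(c,d))"]) (auto simp: V_def state_space_def coord_def)
    then show ?thesis using M[of x] by auto
  qed
  then show ?P1 by blast
qed

text \<open>The slope of the truncation at level n is 1 where f <= n and lies in [0, 1] elsewhere.
  Hence the integral of \<open>G\<close> over that sublevel set is at most \<open>C\<close>, and
  monotone convergence lets n grow. Integrability of \<open>G\<close> comes out as a
  conclusion.\<close>

theorem lyapunov_integral_bound:
  assumes inv: "invariant_b \<gamma> T1 T3 \<pi>"
    and pos: "0 < \<gamma>" "0 < T1" "0 < T3"
    and f: "C2_on act_pos f"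
    and per: "\<And>x. x \<in> act_pos \<Longrightarrow> f (upd 3 x (coord 3 x + 2 * pi)) = f x"
      "\<And>x. x \<in> act_pos \<Longrightarrow> f (upd 4 x (coord 4 x + 2 * pi)) = f x"
    and coercive: "\<And>N. \<exists>K. compact K \<and> K \<subseteq> {(a, b). 0 < a \<and> 0 < b} \<and>
      (\<forall>x\<in>act_pos. (coord 1 x, coord 2 x) \<notin> K \<longrightarrow> N \<le> f x)"
    and G: "continuous_on UNIV G" "\<And>x. 0 \<le> G x"
    and C: "0 \<le> C" "\<And>x. x \<in> act_pos \<Longrightarrow> G x + gen_b \<gamma> T1 T3 f x \<le> C"
  shows "integrable \<pi> G \<and> (\<integral>x. G x \<partial>\<pi>) \<le> C"
proof -
  interpret prob_space \<pi> using inv by (simp add: invariant_b_def)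
  have sets: "sets \<pi> = sets borel" and ss1: "emeasure \<pi> state_space = 1"
    and test: "\<And>f. test_fn f \<Longrightarrow> (\<integral>x. gen_b \<gamma> T1 T3 f x \<partial>\<pi>) = 0"
    using inv by (auto simp: invariant_b_def)
  note [measurable_cong] = sets
  have "AE x in \<pi>. x \<in> state_space"
    using ss1 by (intro AE_prob_1) (simp add: emeasure_eq_measure)
  moreover have "state_space \<subseteq> act_pos"
    by (auto simp: state_space_def act_pos_def coord_def)
  ultimately have AEss: "AE x in \<pi>. x \<in> state_space \<and> x \<in> act_pos" by (auto elim!: eventually_mono)
  have [measurable]: "G \<in> borel_measurable \<pi>"
    using borel_measurable_continuous_onI[OF G(1)] by measurable
  \<comment> \<open>\<open>f\<close> is controlled only on \<open>act_pos\<close>, so measurability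
    of its sublevel sets goes through the product with the indicator.\<close>
  have mU: "act_pos \<in> sets borel" by (simp add: borel_open)
  have "(\<lambda>x. indicat_real act_pos x *\<^sub>R f x) \<in> borel_measurable borel"
    by (rule borel_measurable_continuous_on_indicator[OF mU C1_on_continuous[OF C2_on_C1[OF f]]])
  then have "act_pos \<inter> {x. indicat_real act_pos x *\<^sub>R f x \<le> real n} \<in> sets borel" for n
    using mU by measurable
  moreover have "{x\<in>act_pos. f x \<le> real n} = act_pos \<inter> {x. indicat_real act_pos x *\<^sub>R f x \<le> real n}" for n
    by (auto simp: indicator_def)
  ultimately have mS [measurable]: "{x\<in>act_pos. f x \<le> real n} \<in> sets borel" for n by simp
  define H where "H n x = indicator {x\<in>act_pos. f x \<le> real n} x * ennreal (G x)" for n x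
  have [measurable]: "H n \<in> borel_measurable \<pi>" for n
    unfolding H_def by measurable
  have Hn: "(\<integral>\<^sup>+x. H n x \<partial>\<pi>) \<le> ennreal C" for n
  proof -
    obtain K where K: "compact K" "K \<subseteq> {(a, b). 0 < a \<and> 0 < b}"
      "\<And>x. x \<in> act_pos \<Longrightarrow> (coord 1 x, coord 2 x) \<notin> K \<Longrightarrow> real n + 2 \<le> f x"
      using coercive[of "real n + 2"] by blast
    define g where "g = (\<lambda>x. if x \<in> act_pos then trunc (f x - real n) - 1 else 0)"
    have g: "test_fn g"
      "\<And>x. x \<in> act_pos \<Longrightarrow> gen_b \<gamma> T1 T3 g x \<le> trunc' (f x - real n) * gen_b \<gamma> T1 T3 f x"
      "\<exists>M. \<forall>x\<in>state_space. \<bar>gen_b \<gamma> T1 T3 g x\<bar> \<le> M"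
      "continuous_on UNIV (gen_b \<gamma> T1 T3 g)"
      subgoal by (rule truncated_lyapunov(1)[where K=K and N="real n" and f=f and g=g];
          ((rule pos f per K g_def refl; assumption?) | assumption))
      subgoal by (rule truncated_lyapunov(2)[where K=K and N="real n" and f=f and g=g];
          ((rule pos f per K g_def refl; assumption?) | assumption))
      subgoal by (rule truncated_lyapunov(3)[where K=K and N="real n" and f=f and g=g];
          ((rule pos f per K g_def refl; assumption?) | assumption))
      subgoal by (rule truncated_lyapunov(4)[where K=K and N="real n" and f=f and g=g];
          ((rule pos f per K g_def refl; assumption?) | assumption))
      done
    obtain M where M: "\<And>x. x \<in> state_space \<Longrightarrow> \<bar>gen_b \<gamma> T1 T3 g x\<bar> \<le> M" using g(3) by blast
    have [measurable]: "gen_b \<gamma> T1 T3 g \<in> borel_measurable \<pi>"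
      using borel_measurable_continuous_onI[OF g(4)] by measurable
    \<comment> \<open>Boundedness gives integrability. Without it the Bochner integral would be 0 by
      convention, and the stationarity identity would carry no information.\<close>
    have int: "integrable \<pi> (gen_b \<gamma> T1 T3 g)"
      by (rule integrable_const_bound[of _ M]) (use AEss M in \<open>auto elim!: eventually_mono\<close>)
    have le: "trunc' (f x - real n) * G x \<le> C - gen_b \<gamma> T1 T3 g x" if x: "x \<in> act_pos" for x
    proof -
      have "trunc' (f x - real n) * (G x + gen_b \<gamma> T1 T3 f x) \<le> trunc' (f x - real n) * C"
        by (intro mult_left_mono C x trunc'_bounds)
      also have "\<dots> \<le> C" using trunc'_bounds(2)[of "f x - real n"] C(1) by (simp add: mult_left_le_one_le trunc'_bounds)
      finally show ?thesis using g(2)[OF x] by (simp add: algebra_simps)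
    qed
    have "(\<integral>\<^sup>+x. H n x \<partial>\<pi>) \<le> (\<integral>\<^sup>+x. ennreal (C - gen_b \<gamma> T1 T3 g x) \<partial>\<pi>)"
    proof (rule nn_integral_mono_AE, use AEss in eventually_elim)
      case (elim x)
      then have "G x \<le> C - gen_b \<gamma> T1 T3 g x" if "f x \<le> real n"
        using le[of x] trunc'_eq_1[of "f x - real n"] that by simp
      then show ?case using elim by (auto simp: H_def indicator_def intro!: ennreal_leI)
    qed
    also have "\<dots> = ennreal (\<integral>x. C - gen_b \<gamma> T1 T3 g x \<partial>\<pi>)"
    proof (rule nn_integral_eq_integral)
      show "AE x in \<pi>. 0 \<le> C - gen_b \<gamma> T1 T3 g x"
        using AEss
      proof eventually_elim
        case (elim x)
        have "0 \<le> trunc' (f x - real n) * G x" by (simp add: G trunc'_bounds)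
        then show ?case using le[of x] elim by simp
      qed
    qed (use int in auto)
    also have "(\<integral>x. C - gen_b \<gamma> T1 T3 g x \<partial>\<pi>) = C"
      using int test[OF g(1)] by (simp add: prob_space)
    finally show ?thesis .
  qed
  have "(\<integral>\<^sup>+x. ennreal (G x) \<partial>\<pi>) \<le> (\<integral>\<^sup>+x. (SUP n. H n x) \<partial>\<pi>)"
  proof (rule nn_integral_mono_AE, use AEss in eventually_elim)
    case (elim x)
    obtain n where "f x \<le> real n" using real_arch_simple by blast
    then have "ennreal (G x) = H n x" using elim by (simp add: H_def)
    then show ?case by (auto intro: SUP_upper)
  qed
  also have "\<dots> = (SUP n. \<integral>\<^sup>+x. H n x \<partial>\<pi>)"
    by (rule nn_integral_monotone_convergence_SUP)
       (auto simp: incseq_def le_fun_def H_def intro!: mult_right_mono split: split_indicator)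
  also have "\<dots> \<le> ennreal C" by (intro SUP_least Hn)
  finally have fin: "(\<integral>\<^sup>+x. ennreal (G x) \<partial>\<pi>) \<le> ennreal C" .
  then have int: "integrable \<pi> G"
    by (intro integrableI_nonneg) (auto simp: G intro: le_less_trans)
  have "ennreal (\<integral>x. G x \<partial>\<pi>) \<le> ennreal C"
    using fin nn_integral_eq_integral[OF int] G by simp
  then show ?thesis using int C(1) by (simp add: ennreal_le_iff)
qed

section \<open>Trigonometric polynomials\<close>

text \<open>The free shift \<open>b\<close> covers sines and turns differentiation in the phase into
  a shift by pi/2; the integer frequencies give periodicity, and the coefficients stay polynomial in
  \<rho>.\<close>

inductive TP :: "(real \<Rightarrow> real \<Rightarrow> real) \<Rightarrow> bool" where
  TP_zero: "TP (\<lambda>\<phi> \<rho>. 0)"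
| TP_step: "TP H \<Longrightarrow> TP (\<lambda>\<phi> \<rho>. H \<phi> \<rho> + c * \<rho> ^ a * cos (real_of_int k * \<phi> + b))"

lemma TP_term: "TP (\<lambda>\<phi> \<rho>. c * \<rho> ^ a * cos (real_of_int k * \<phi> + b))"
  using TP_step[OF TP_zero, of c a k b] by simp

lemma TP_add: "TP G \<Longrightarrow> TP H \<Longrightarrow> TP (\<lambda>\<phi> \<rho>. H \<phi> \<rho> + G \<phi> \<rho>)"
proof (induction rule: TP.induct)
  case (TP_step G c a k b)
  then show ?case
    using TP.TP_step[of "\<lambda>\<phi> \<rho>. H \<phi> \<rho> + G \<phi> \<rho>" c a k b] by (simp add: add.assoc)
qed simp

text \<open>The product-to-sum formula replaces a product of two terms by terms of frequencies k' -
  k and k' + k.\<close>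

lemma TP_mult_term:
  "TP H \<Longrightarrow> TP (\<lambda>\<phi> \<rho>. H \<phi> \<rho> * (c * \<rho> ^ a * cos (real_of_int k * \<phi> + b)))"
proof (induction rule: TP.induct)
  case TP_zero
  then show ?case using TP.TP_zero by simp
next
  case (TP_step H c' a' k' b')
  have "c' * \<rho> ^ a' * cos (real_of_int k' * \<phi> + b') * (c * \<rho> ^ a * cos (real_of_int k * \<phi> + b))
     = c' * c / 2 * \<rho> ^ (a' + a) * cos (real_of_int (k' - k) * \<phi> + (b' - b))
     + c' * c / 2 * \<rho> ^ (a' + a) * cos (real_of_int (k' + k) * \<phi> + (b' + b))" for \<phi> \<rho>
  proof -
    have e: "real_of_int (k' - k) * \<phi> + (b' - b) = (real_of_int k' * \<phi> + b') - (real_of_int k * \<phi> + b)"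
      "real_of_int (k' + k) * \<phi> + (b' + b) = (real_of_int k' * \<phi> + b') + (real_of_int k * \<phi> + b)"
      by (simp_all add: algebra_simps)
    have *: "c' * r' * X * (c * r * Y) = c' * c / 2 * (r' * r) * P + c' * c / 2 * (r' * r) * Q"
      if "X * Y = (P + Q) / 2" for r r' X Y P Q :: real
    proof -
      have "c' * r' * X * (c * r * Y) = c' * c * (r' * r) * (X * Y)" by simp
      then show ?thesis unfolding that by (simp add: field_simps)
    qed
    show ?thesis
      unfolding e power_add by (rule *, rule cos_times_cos)
  qed
  then have "(\<lambda>\<phi> \<rho>. (H \<phi> \<rho> + c' * \<rho> ^ a' * cos (real_of_int k' * \<phi> + b')) * (c * \<rho> ^ a * cos (real_of_int k * \<phi> + b)))
    = (\<lambda>\<phi> \<rho>. H \<phi> \<rho> * (c * \<rho> ^ a * cos (real_of_int k * \<phi> + b))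
       + c' * c / 2 * \<rho> ^ (a' + a) * cos (real_of_int (k' - k) * \<phi> + (b' - b))
       + c' * c / 2 * \<rho> ^ (a' + a) * cos (real_of_int (k' + k) * \<phi> + (b' + b)))"
    by (intro ext) (simp only: distrib_right add.assoc)
  then show ?case
    using TP.TP_step[OF TP.TP_step[OF TP_step.IH, of "c' * c / 2" "a' + a" "k' - k" "b' - b"],
        of "c' * c / 2" "a' + a" "k' + k" "b' + b"] by simp
qed

lemma TP_mult: "TP G \<Longrightarrow> TP H \<Longrightarrow> TP (\<lambda>\<phi> \<rho>. H \<phi> \<rho> * G \<phi> \<rho>)"
proof (induction rule: TP.induct)
  case TP_zero
  then show ?case using TP.TP_zero by simp
next
  case (TP_step G c a k b)
  then show ?case
    using TP_add[OF TP_mult_term[OF TP_step.prems, of c a k b] TP_step.IH[OF TP_step.prems]]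
    by (simp add: distrib_left)
qed

lemma TP_const: "TP (\<lambda>\<phi> \<rho>. c)"
  and TP_rho: "TP (\<lambda>\<phi> \<rho>. \<rho>)"
  and TP_cos: "TP (\<lambda>\<phi> \<rho>. cos \<phi>)"
  and TP_sin: "TP (\<lambda>\<phi> \<rho>. sin \<phi>)"
  using TP_term[of c 0 0 0] TP_term[of 1 1 0 0] TP_term[of 1 0 1 0] TP_term[of "-1" 0 1 "pi/2"]
  by (simp_all add: cos_add)

section \<open>Partial derivatives of trigonometric polynomials\<close>

definition d1 :: "(real \<Rightarrow> real \<Rightarrow> real) \<Rightarrow> real \<Rightarrow> real \<Rightarrow> real" where
  "d1 H \<phi> \<rho> = deriv (\<lambda>s. H s \<rho>) \<phi>"

definition d2 :: "(real \<Rightarrow> real \<Rightarrow> real) \<Rightarrow> real \<Rightarrow> real \<Rightarrow> real" where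
  "d2 H \<phi> \<rho> = deriv (\<lambda>s. H \<phi> s) \<rho>"

lemma has_derivative_partials:
  assumes "((\<lambda>p. H (fst p) (snd p)) has_derivative (\<lambda>h. A * fst h + B * snd h)) (at (\<phi>, \<rho>))"
  shows "((\<lambda>s. H s \<rho>) has_real_derivative A) (at \<phi>)" (is ?P1)
    and "((\<lambda>s. H \<phi> s) has_real_derivative B) (at \<rho>)" (is ?P2)
proof -
  have "((\<lambda>s. (s, \<rho>)) has_derivative (\<lambda>h. (h, 0))) (at \<phi>)" "((\<lambda>s. (\<phi>, s)) has_derivative (\<lambda>h. (0, h))) (at \<rho>)"
    by (auto intro!: derivative_eq_intros)
  from this[THEN has_derivative_compose, of "\<lambda>p. H (fst p) (snd p)" "\<lambda>h. A * fst h + B * snd h"] assms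
  show ?P1 ?P2
    by (simp_all add: has_field_derivative_def)
qed

lemma TP_term_deriv:
  "((\<lambda>p. c * snd p ^ a * cos (real_of_int k * fst p + b)) has_derivative
     (\<lambda>h. c * real_of_int k * \<rho> ^ a * cos (real_of_int k * \<phi> + (b + pi/2)) * fst h
       + c * real a * \<rho> ^ (a - 1) * cos (real_of_int k * \<phi> + b) * snd h)) (at (\<phi>, \<rho>))"
proof -
  have "cos (real_of_int k * \<phi> + (b + pi/2)) = - sin (real_of_int k * \<phi> + b)"
    using cos_add[of "real_of_int k * \<phi> + b" "pi/2"] by (simp add: add.assoc)
  then show ?thesis
    by (auto intro!: derivative_eq_intros simp: algebra_simps)
qed

lemma TP_term_D1: "((\<lambda>s. c * \<rho> ^ a * cos (real_of_int k * s + b)) has_real_derivative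
    c * real_of_int k * \<rho> ^ a * cos (real_of_int k * \<phi> + (b + pi/2))) (at \<phi>)"
  and TP_term_D2: "((\<lambda>s. c * s ^ a * cos (real_of_int k * \<phi> + b)) has_real_derivative
    c * real a * \<rho> ^ (a - 1) * cos (real_of_int k * \<phi> + b)) (at \<rho>)"
  using has_derivative_partials[OF TP_term_deriv[of c a k b \<rho> \<phi>]] by auto

lemma TP_differentiable:
  assumes "TP H"
  shows "(\<lambda>s. H s \<rho>) differentiable (at \<phi>)" (is ?P1) "(\<lambda>s. H \<phi> s) differentiable (at \<rho>)" (is ?P2)
proof -
  have "(\<lambda>s. H s \<rho>) differentiable (at \<phi>) \<and> (\<lambda>s. H \<phi> s) differentiable (at \<rho>)"
    using assms
  proof (induction rule: TP.induct)
    case (TP_step G c a k b)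
    have "(\<lambda>s. c * \<rho> ^ a * cos (real_of_int k * s + b)) differentiable (at \<phi>)"
      "(\<lambda>s. c * s ^ a * cos (real_of_int k * \<phi> + b)) differentiable (at \<rho>)"
      using TP_term_D1 TP_term_D2 real_differentiable_def by blast+
    then show ?case using TP_step.IH by (auto intro: differentiable_add)
  qed auto
  then show ?P1 ?P2 by auto
qed

text \<open>One induction carries all claims, because the step for the mixed partials needs the
  derivatives of the tail to be in the class already. Equality of the mixed partials later allows
  the orbit equation to be differentiated in \<rho>.\<close>

lemma TP_deriv:
  assumes "TP H"
  shows "TP (d1 H) \<and> TP (d2 H) \<and> d2 (d1 H) = d1 (d2 H) \<and>
    (\<forall>\<phi> \<rho>. ((\<lambda>p. H (fst p) (snd p)) has_derivative (\<lambda>h. d1 H \<phi> \<rho> * fst h + d2 H \<phi> \<rho> * snd h)) (at (\<phi>, \<rho>)))"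
  using assms
proof (induction rule: TP.induct)
  case TP_zero
  have "d1 (\<lambda>\<phi> \<rho>. 0) = (\<lambda>\<phi> \<rho>. 0)" "d2 (\<lambda>\<phi> \<rho>. 0) = (\<lambda>\<phi> \<rho>. 0)"
    by (auto simp: d1_def d2_def fun_eq_iff)
  then show ?case using TP.TP_zero by auto
next
  case (TP_step H c a k b)
  have gen: "((\<lambda>p. F (fst p) (snd p) + c * snd p ^ a * cos (real_of_int k * fst p + b)) has_derivative
      (\<lambda>h. (d1 F \<phi> \<rho> + c * real_of_int k * \<rho> ^ a * cos (real_of_int k * \<phi> + (b + pi/2))) * fst h
        + (d2 F \<phi> \<rho> + c * real a * \<rho> ^ (a - 1) * cos (real_of_int k * \<phi> + b)) * snd h)) (at (\<phi>, \<rho>))"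
    if "TP F" "\<forall>\<phi> \<rho>. ((\<lambda>p. F (fst p) (snd p)) has_derivative (\<lambda>h. d1 F \<phi> \<rho> * fst h + d2 F \<phi> \<rho> * snd h)) (at (\<phi>, \<rho>))"
    for F c a k b \<phi> \<rho>
    by (rule has_derivative_eq_rhs[OF has_derivative_add[OF that(2)[rule_format] TP_term_deriv]])
       (auto simp: algebra_simps)
  let ?H = "\<lambda>\<phi> \<rho>. H \<phi> \<rho> + c * \<rho> ^ a * cos (real_of_int k * \<phi> + b)"
  have H: "TP (d1 H)" "TP (d2 H)" "d2 (d1 H) = d1 (d2 H)"
    "\<forall>\<phi> \<rho>. ((\<lambda>p. H (fst p) (snd p)) has_derivative (\<lambda>h. d1 H \<phi> \<rho> * fst h + d2 H \<phi> \<rho> * snd h)) (at (\<phi>, \<rho>))"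
    using TP_step.IH by blast+
  note D = has_derivative_partials[OF gen[OF TP_step.hyps H(4)]]
  have e1: "d1 ?H = (\<lambda>\<phi> \<rho>. d1 H \<phi> \<rho> + c * real_of_int k * \<rho> ^ a * cos (real_of_int k * \<phi> + (b + pi/2)))"
    unfolding d1_def[of ?H, abs_def] by (intro ext DERIV_imp_deriv D(1))
  have e2: "d2 ?H = (\<lambda>\<phi> \<rho>. d2 H \<phi> \<rho> + c * real a * \<rho> ^ (a - 1) * cos (real_of_int k * \<phi> + b))"
    unfolding d2_def[of ?H, abs_def] by (intro ext DERIV_imp_deriv D(2))
  have T1: "TP (d1 ?H)" and T2: "TP (d2 ?H)"
    unfolding e1 e2 by (intro TP.TP_step H)+
  have D1: "((\<lambda>s. d2 H s \<rho>) has_real_derivative d1 (d2 H) \<phi> \<rho>) (at \<phi>)"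
    and D2: "((\<lambda>s. d1 H \<phi> s) has_real_derivative d2 (d1 H) \<phi> \<rho>) (at \<rho>)" for \<phi> \<rho>
    using TP_differentiable[OF H(2)] TP_differentiable[OF H(1)]
    unfolding d1_def[of "d2 H"] d2_def[of "d1 H"] by (simp_all add: DERIV_deriv_iff_real_differentiable)
  have "d2 (d1 ?H) = (\<lambda>\<phi> \<rho>. d2 (d1 H) \<phi> \<rho> + c * real_of_int k * real a * \<rho> ^ (a - 1) * cos (real_of_int k * \<phi> + (b + pi/2)))"
    unfolding d2_def[of "d1 ?H", abs_def] unfolding e1
    by (intro ext DERIV_imp_deriv DERIV_add D2 TP_term_D2)
  moreover have "d1 (d2 ?H) = (\<lambda>\<phi> \<rho>. d1 (d2 H) \<phi> \<rho> + c * real a * real_of_int k * \<rho> ^ (a - 1) * cos (real_of_int k * \<phi> + (b + pi/2)))"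
    unfolding d1_def[of "d2 ?H", abs_def] unfolding e2
    by (intro ext DERIV_imp_deriv DERIV_add D1 TP_term_D1)
  ultimately have "d2 (d1 ?H) = d1 (d2 ?H)"
    using H(3) by (simp add: algebra_simps)
  then show ?case
    using T1 T2 gen[OF TP_step.hyps H(4)] unfolding e1 e2 by blast
qed

lemma TP_d1: "TP H \<Longrightarrow> TP (d1 H)"
  and TP_d2: "TP H \<Longrightarrow> TP (d2 H)"
  and TP_commute: "TP H \<Longrightarrow> d1 (d2 H) = d2 (d1 H)"
  and TP_has_derivative: "TP H \<Longrightarrow>
    ((\<lambda>p. H (fst p) (snd p)) has_derivative (\<lambda>h. d1 H \<phi> \<rho> * fst h + d2 H \<phi> \<rho> * snd h)) (at (\<phi>, \<rho>))"
  using TP_deriv by auto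

lemma TP_D1: "((\<lambda>s. H s \<rho>) has_real_derivative d1 H \<phi> \<rho>) (at \<phi>)"
  and TP_D2: "((\<lambda>s. H \<phi> s) has_real_derivative d2 H \<phi> \<rho>) (at \<rho>)"
  if "TP H"
  using has_derivative_partials[OF TP_has_derivative[OF that]] .

section \<open>Periodic solutions of linear equations with coefficient sqrt 3\<close>

lemma TP_periodic:
  assumes "TP H" shows "H (\<phi> + of_int m * (2 * pi)) \<rho> = H \<phi> \<rho>"
  using assms
proof (induction rule: TP.induct)
  case (TP_step H c a k b)
  have "cos (real_of_int k * (\<phi> + of_int m * (2 * pi)) + b) = cos (real_of_int k * \<phi> + b + of_int (k * m) * (2 * pi))"
    by (simp add: algebra_simps)
  also have "\<dots> = cos (real_of_int k * \<phi> + b)"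
    using cos.plus_of_int[of "real_of_int k * \<phi> + b" "k * m"] by simp
  finally show ?case using TP_step.IH by simp
qed simp

text \<open>There are no small divisors: at frequency k the operator d/d\<phi> - sqrt 3 has squared
  modulus k^2 + 3, so every term, including k = 0, is inverted within the class.\<close>

lemma TP_solve:
  assumes "TP H"
  shows "\<exists>g. TP g \<and> (\<forall>\<phi> \<rho>. d1 g \<phi> \<rho> = sqrt 3 * g \<phi> \<rho> + H \<phi> \<rho>)"
  using assms
proof (induction rule: TP.induct)
  case TP_zero
  show ?case using TP.TP_zero by (intro exI[of _ "\<lambda>\<phi> \<rho>. 0"]) (simp add: d1_def)
next
  case (TP_step H c a k b)
  then obtain g where g: "TP g" "\<And>\<phi> \<rho>. d1 g \<phi> \<rho> = sqrt 3 * g \<phi> \<rho> + H \<phi> \<rho>" by blast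
  \<comment> \<open>The particular solution for one term is A cos + B sin; comparing the
    coefficients of cos and sin gives \<open>kB\<close> and \<open>kA\<close>.\<close>
  define A B where "A = - sqrt 3 / ((real_of_int k)^2 + 3)" and "B = real_of_int k / ((real_of_int k)^2 + 3)"
  have pos: "(real_of_int k)^2 + 3 \<noteq> 0" by (smt (verit) zero_le_power2)
  have kB: "real_of_int k * B = sqrt 3 * A + 1"
    using pos by (simp add: A_def B_def field_simps power2_eq_square)
  have kA: "- (real_of_int k * A) = sqrt 3 * B"
    using pos by (simp add: A_def B_def)
  let ?x = "\<lambda>\<phi>. real_of_int k * \<phi> + b"
  define g' where "g' = (\<lambda>\<phi> \<rho>. g \<phi> \<rho> + c * A * \<rho> ^ a * cos (?x \<phi>) + - c * B * \<rho> ^ a * cos (real_of_int k * \<phi> + (b + pi/2)))"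
  have "TP g'" unfolding g'_def by (intro TP.TP_step g)
  have sin: "cos (real_of_int k * \<phi> + (b + pi/2)) = - sin (?x \<phi>)" for \<phi>
    using cos_add[of "real_of_int k * \<phi> + b" "pi/2"] by (simp add: add.assoc)
  have "d1 g' \<phi> \<rho> = d1 g \<phi> \<rho> + c * A * \<rho> ^ a * (- sin (?x \<phi>) * real_of_int k) + c * B * \<rho> ^ a * (cos (?x \<phi>) * real_of_int k)" for \<phi> \<rho>
    unfolding d1_def[of g'] unfolding g'_def sin
    by (rule DERIV_imp_deriv) (auto intro!: derivative_eq_intros TP_D1 g)
  also have "\<dots> \<phi> \<rho> = sqrt 3 * g' \<phi> \<rho> + (H \<phi> \<rho> + c * \<rho> ^ a * cos (?x \<phi>))" for \<phi> \<rho>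
  proof -
    have "c * A * \<rho> ^ a * (- sin (?x \<phi>) * real_of_int k) + c * B * \<rho> ^ a * (cos (?x \<phi>) * real_of_int k)
       = c * \<rho> ^ a * sin (?x \<phi>) * (- (real_of_int k * A)) + c * \<rho> ^ a * cos (?x \<phi>) * (real_of_int k * B)"
      by (simp add: algebra_simps)
    then show ?thesis
      unfolding kA kB g g'_def sin by (simp add: algebra_simps)
  qed
  finally show ?case using \<open>TP g'\<close> by blast
qed

text \<open>Maximum principle: at a maximum of the periodic g its derivative vanishes, so sqrt 3 g =
  - f there. Neither the number of terms nor their frequencies enter, which is why all bounds are
  uniform along the iteration.\<close>

lemma periodic_ode_upper:
  fixes g f :: "real \<Rightarrow> real"
  assumes D: "\<And>x. (g has_real_derivative sqrt 3 * g x + f x) (at x)"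
    and per: "\<And>x m. g (x + of_int m * (2 * pi)) = g x" and B: "\<And>x. \<bar>f x\<bar> \<le> B"
  shows "g x \<le> B / sqrt 3"
proof -
  have "continuous_on {0..2*pi} g"
    using D by (meson DERIV_isCont continuous_at_imp_continuous_on)
  then obtain m where m: "m \<in> {0..2*pi}" "\<And>y. y \<in> {0..2*pi} \<Longrightarrow> g y \<le> g m"
    using continuous_attains_sup[of "{0..2*pi}" g] by (auto simp: less_imp_le)
  have glob: "g y \<le> g m" for y
  proof -
    define k where "k = \<lfloor>y / (2*pi)\<rfloor>"
    define z where "z = y / (2*pi) - of_int k"
    have z: "0 \<le> z" "z \<le> 1" unfolding k_def z_def by linarith+
    have "y + of_int (- k) * (2 * pi) = z * (2 * pi)"
      by (simp add: z_def field_simps)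
    then have "y + of_int (- k) * (2 * pi) \<in> {0..2*pi}"
      using z mult_right_mono[OF z(2), of "2*pi"] by simp
    then show ?thesis using m(2)[of "y + of_int (- k) * (2 * pi)"] per[of y "-k"] by (simp only:)
  qed
  have "sqrt 3 * g m + f m = 0"
    by (rule DERIV_local_max[OF D, of 1]) (use glob in auto)
  then have "sqrt 3 * g m \<le> B" using B[of m] by linarith
  then have "g m \<le> B / sqrt 3" by (simp add: field_simps)
  then show ?thesis using glob[of x] by simp
qed

lemma periodic_ode_bound:
  fixes g f :: "real \<Rightarrow> real"
  assumes D: "\<And>x. (g has_real_derivative sqrt 3 * g x + f x) (at x)"
    and per: "\<And>x m. g (x + of_int m * (2 * pi)) = g x" and B: "\<And>x. \<bar>f x\<bar> \<le> B"
  shows "sqrt 3 * \<bar>g x\<bar> \<le> B"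
proof -
  have "g x \<le> B / sqrt 3"
    using periodic_ode_upper[OF assms] .
  moreover have "- g x \<le> B / sqrt 3"
  proof (rule periodic_ode_upper[of "\<lambda>x. - g x" "\<lambda>x. - f x"])
    show "((\<lambda>x. - g x) has_real_derivative sqrt 3 * - g x + - f x) (at x)" for x
      using DERIV_minus[OF D[of x]] by simp
  qed (use per B in auto)
  ultimately have "\<bar>g x\<bar> \<le> B / sqrt 3" by linarith
  then show ?thesis by (simp add: field_simps)
qed

lemma TP_ode_bound:
  assumes "TP g" "\<And>\<phi>. d1 g \<phi> \<rho> = sqrt 3 * g \<phi> \<rho> + f \<phi>" "\<And>\<phi>. \<bar>f \<phi>\<bar> \<le> B"
  shows "sqrt 3 * \<bar>g \<phi> \<rho>\<bar> \<le> B"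
proof (rule periodic_ode_bound[of "\<lambda>s. g s \<rho>" f])
  show "((\<lambda>s. g s \<rho>) has_real_derivative sqrt 3 * g x \<rho> + f x) (at x)" for x
    using TP_D1[OF assms(1), of \<rho> x] assms(2)[of x] by simp
qed (use TP_periodic[OF assms(1)] assms in auto)

section \<open>The repelling periodic orbit\<close>

text \<open>The repelling orbit solves \<open>w' = sqrt 3 w + rhs \<phi> \<rho> w\<close> in the phase \<open>\<phi>\<close>, with \<open>rhs = O(\<rho> + w\<^sup>2)\<close>; the functions
  \<open>rhs_w\<close>, \<open>rhs_p\<close>, \<open>rhs_r\<close>, ... are its partial derivatives.\<close>

definition rhs :: "real \<Rightarrow> real \<Rightarrow> real \<Rightarrow> real" where
  "rhs \<phi> \<rho> w = w^2 / 2 + \<rho> * (sqrt 3 * w + w^2 / 2 + cos \<phi> * (2 + 2 * sqrt 3 * w + w^2) + 2 * (sqrt 3 + w) * sin \<phi>)"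

definition rhs_w :: "real \<Rightarrow> real \<Rightarrow> real \<Rightarrow> real" where
  "rhs_w \<phi> \<rho> w = w + \<rho> * (sqrt 3 + w + cos \<phi> * (2 * sqrt 3 + 2 * w) + 2 * sin \<phi>)"

definition rhs_p :: "real \<Rightarrow> real \<Rightarrow> real \<Rightarrow> real" where
  "rhs_p \<phi> \<rho> w = \<rho> * (- sin \<phi> * (2 + 2 * sqrt 3 * w + w^2) + 2 * (sqrt 3 + w) * cos \<phi>)"

definition rhs_r :: "real \<Rightarrow> real \<Rightarrow> real" where
  "rhs_r \<phi> w = sqrt 3 * w + w^2 / 2 + cos \<phi> * (2 + 2 * sqrt 3 * w + w^2) + 2 * (sqrt 3 + w) * sin \<phi>"

definition rhs_rw :: "real \<Rightarrow> real \<Rightarrow> real" where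
  "rhs_rw \<phi> w = sqrt 3 + w + cos \<phi> * (2 * sqrt 3 + 2 * w) + 2 * sin \<phi>"

definition rhs_ww :: "real \<Rightarrow> real \<Rightarrow> real" where
  "rhs_ww \<phi> \<rho> = 1 + \<rho> * (1 + 2 * cos \<phi>)"

lemma TP_rhs: "TP w \<Longrightarrow> TP (\<lambda>\<phi> \<rho>. rhs \<phi> \<rho> (w \<phi> \<rho>))"
  unfolding rhs_def power2_eq_square divide_inverse
  by (intro TP_add TP_mult TP_const TP_rho TP_cos TP_sin)

text \<open>The nonlinearity is evaluated at the previous iterate, so each step is a linear equation
  that stays within trigonometric polynomials. \<open>SOME\<close> selects a solution provided by
  \<open>TP_solve\<close>; membership in the class and the equation are all that is used of
  it.\<close>

primrec wseq :: "nat \<Rightarrow> real \<Rightarrow> real \<Rightarrow> real" where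
  "wseq 0 = (\<lambda>\<phi> \<rho>. 0)"
| "wseq (Suc n) = (SOME g. TP g \<and> (\<forall>\<phi> \<rho>. d1 g \<phi> \<rho> = sqrt 3 * g \<phi> \<rho> + rhs \<phi> \<rho> (wseq n \<phi> \<rho>)))"

lemma TP_wseq: "TP (wseq n)"
proof (induction n)
  case 0
  then show ?case by (simp add: TP_zero)
next
  case (Suc n)
  from someI_ex[OF TP_solve[OF TP_rhs[OF Suc]]] show ?case by simp
qed

lemma d1_wseq: "d1 (wseq (Suc n)) \<phi> \<rho> = sqrt 3 * wseq (Suc n) \<phi> \<rho> + rhs \<phi> \<rho> (wseq n \<phi> \<rho>)"
  using someI_ex[OF TP_solve[OF TP_rhs[OF TP_wseq[of n]]]] by simp

lemma sqrt3_bounds: "17 / 10 \<le> sqrt 3" "sqrt 3 \<le> 7 / 4"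
  by (rule real_le_rsqrt real_le_lsqrt; simp add: power2_eq_square)+

lemma abs_mult_mono: "\<bar>x * y\<bar> \<le> a * b" if "\<bar>x\<bar> \<le> a" "\<bar>y\<bar> \<le> b" for x y a b :: real
  unfolding abs_mult using that by (intro mult_mono) auto

lemma abs_add_mono: "\<bar>x + y\<bar> \<le> a + b" if "\<bar>x\<bar> \<le> a" "\<bar>y\<bar> \<le> b" for x y a b :: real
  using that by linarith

context
  fixes \<rho> :: real
  assumes rho: "0 \<le> \<rho>" "\<rho> \<le> 1 / 100"
begin

lemma coeff_bounds:
  assumes "\<bar>w\<bar> \<le> 1 / 20"
  shows "\<bar>rhs_r \<phi> w\<bar> \<le> 6" (is ?P1) "\<bar>rhs_rw \<phi> w\<bar> \<le> 15 / 2" (is ?P2) "\<bar>rhs_w \<phi> \<rho> w\<bar> \<le> 1 / 5" (is ?P3)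
    "\<bar>rhs_p \<phi> \<rho> w\<bar> \<le> 1 / 10" (is ?P4)
proof -
  have s: "\<bar>sqrt 3\<bar> \<le> 7 / 4" using sqrt3_bounds by simp
  have c: "\<bar>cos \<phi>\<bar> \<le> 1" "\<bar>sin \<phi>\<bar> \<le> 1" "\<bar>- sin \<phi>\<bar> \<le> 1" by auto
  have w2: "\<bar>w^2\<bar> \<le> 1 / 400"
    using abs_mult_mono[OF assms assms] by (simp add: power2_eq_square)
  have sw: "\<bar>sqrt 3 * w\<bar> \<le> 7 / 80" using abs_mult_mono[OF s assms] by simp
  have A: "\<bar>2 + 2 * sqrt 3 * w + w^2\<bar> \<le> 22 / 10" using sw w2 by (simp add: abs_le_iff; linarith)
  have B: "\<bar>2 * (sqrt 3 + w)\<bar> \<le> 36 / 10" using abs_mult_mono[of 2 2 "sqrt 3 + w" "7/4 + 1/20"] abs_add_mono[OF s assms] by simp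
  have cA: "\<bar>cos \<phi> * (2 + 2 * sqrt 3 * w + w^2)\<bar> \<le> 22 / 10" "\<bar>- sin \<phi> * (2 + 2 * sqrt 3 * w + w^2)\<bar> \<le> 22 / 10"
    using abs_mult_mono[OF c(1) A] abs_mult_mono[OF c(3) A] by simp_all
  have cB: "\<bar>2 * (sqrt 3 + w) * sin \<phi>\<bar> \<le> 36 / 10" "\<bar>2 * (sqrt 3 + w) * cos \<phi>\<bar> \<le> 36 / 10"
    using abs_mult_mono[OF B c(2)] abs_mult_mono[OF B c(1)] by simp_all
  have C: "\<bar>cos \<phi> * (2 * sqrt 3 + 2 * w)\<bar> \<le> 36 / 10"
    using abs_mult_mono[OF c(1) B] by (simp add: algebra_simps)
  have r: "\<bar>\<rho>\<bar> \<le> 1 / 100" using rho by simp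
  show ?P1 unfolding rhs_r_def using sw w2 cA cB by linarith
  show ?P2 unfolding rhs_rw_def using s assms C c by linarith
  from abs_mult_mono[OF r this] have "\<bar>\<rho> * rhs_rw \<phi> w\<bar> \<le> 15 / 200" by simp
  then show ?P3
    unfolding rhs_w_def rhs_rw_def using assms by linarith
  have "\<bar>- sin \<phi> * (2 + 2 * sqrt 3 * w + w^2) + 2 * (sqrt 3 + w) * cos \<phi>\<bar> \<le> 58 / 10" using cA cB by linarith
  from abs_mult_mono[OF r this] show ?P4 unfolding rhs_p_def by simp
qed

lemma rhs_ww_bound: "\<bar>rhs_ww \<phi> \<rho>\<bar> \<le> 11 / 10"
proof -
  have "\<bar>\<rho> * (1 + 2 * cos \<phi>)\<bar> \<le> 1 / 100 * 3"
    using rho abs_cos_le_one[of \<phi>] by (intro abs_mult_mono) linarith+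
  then show ?thesis unfolding rhs_ww_def by linarith
qed

lemma rhs_bound:
  assumes "\<bar>w\<bar> \<le> 5 * \<rho>"
  shows "\<bar>rhs \<phi> \<rho> w\<bar> \<le> 17 / 2 * \<rho>"
proof -
  have w: "\<bar>w\<bar> \<le> 1 / 20" using assms rho by linarith
  have "\<bar>w * w\<bar> \<le> 5 * \<rho> * (1 / 20)" by (rule abs_mult_mono[OF assms w])
  then have w2: "\<bar>w^2 / 2\<bar> \<le> \<rho>" using rho by (simp add: power2_eq_square)
  have "\<bar>\<rho> * rhs_r \<phi> w\<bar> \<le> \<rho> * 6" using rho by (intro abs_mult_mono coeff_bounds w) simp
  then show ?thesis unfolding rhs_def rhs_r_def using w2 by linarith
qed

text \<open>The induction closes because (17/2) / (17/10) = 5, with 17/10 a lower bound for sqrt 3.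
  The range \<rho> <= 1/100 then keeps every iterate below 1/20, where the coefficient bounds
  hold.\<close>

lemma wseq_bound: "\<bar>wseq n \<phi> \<rho>\<bar> \<le> 5 * \<rho>"
proof (induction n arbitrary: \<phi>)
  case 0
  then show ?case using rho by simp
next
  case (Suc n)
  have "sqrt 3 * \<bar>wseq (Suc n) \<phi> \<rho>\<bar> \<le> 17 / 2 * \<rho>"
    by (rule TP_ode_bound[OF TP_wseq d1_wseq rhs_bound[OF Suc]])
  moreover have "17 / 10 * \<bar>wseq (Suc n) \<phi> \<rho>\<bar> \<le> sqrt 3 * \<bar>wseq (Suc n) \<phi> \<rho>\<bar>"
    by (intro mult_right_mono sqrt3_bounds) simp
  ultimately show ?case by linarith
qed

lemma wseq_small: "\<bar>wseq n \<phi> \<rho>\<bar> \<le> 1 / 20"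
  using wseq_bound[of n \<phi>] rho by linarith

lemma d1_wseq_bound: "\<bar>d1 (wseq n) \<phi> \<rho>\<bar> \<le> 1 / 5"
proof (cases n)
  case 0
  then show ?thesis by (simp add: d1_def)
next
  case (Suc m)
  have "\<bar>sqrt 3 * wseq n \<phi> \<rho>\<bar> \<le> 7 / 4 * (1 / 20)"
    using sqrt3_bounds by (intro abs_mult_mono wseq_small) simp
  then show ?thesis
    using rhs_bound[OF wseq_bound[of m \<phi>], of \<phi>] rho Suc by (simp only: d1_wseq; linarith)
qed

lemma rhs_lipschitz:
  assumes "\<bar>v\<bar> \<le> 1 / 20" "\<bar>w\<bar> \<le> 1 / 20"
  shows "\<bar>rhs \<phi> \<rho> v - rhs \<phi> \<rho> w\<bar> \<le> 1 / 5 * \<bar>v - w\<bar>"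
proof -
  \<comment> \<open>\<open>rhs\<close> is quadratic in w, so its difference quotient is exactly the
    derivative at the midpoint.\<close>
  have "rhs \<phi> \<rho> v - rhs \<phi> \<rho> w = rhs_w \<phi> \<rho> ((v + w) / 2) * (v - w)"
    unfolding rhs_def rhs_w_def by (simp add: power2_eq_square field_simps)
  also have "\<bar>\<dots>\<bar> \<le> 1 / 5 * \<bar>v - w\<bar>"
    by (intro abs_mult_mono coeff_bounds order_refl) (use abs_add_mono[OF assms] in simp)
  finally show ?thesis .
qed

text \<open>Differences of iterates solve the linear equation with a forcing contracted by 1/5; even
  without the gain 1 / sqrt 3 this beats the rate 1/2.\<close>

lemma wseq_cauchy: "\<bar>wseq (Suc n) \<phi> \<rho> - wseq n \<phi> \<rho>\<bar> \<le> (1/2) ^ n"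
proof (induction n arbitrary: \<phi>)
  case 0
  then show ?case using wseq_small[of "Suc 0" \<phi>] by simp
next
  case (Suc n)
  define g where "g = (\<lambda>\<phi> \<rho>. wseq (Suc (Suc n)) \<phi> \<rho> + - 1 * wseq (Suc n) \<phi> \<rho>)"
  have g: "TP g" unfolding g_def by (intro TP_add TP_mult TP_const TP_wseq)
  have "d1 g \<phi> \<rho> = sqrt 3 * g \<phi> \<rho> + (rhs \<phi> \<rho> (wseq (Suc n) \<phi> \<rho>) - rhs \<phi> \<rho> (wseq n \<phi> \<rho>))" for \<phi>
  proof -
    have "d1 g \<phi> \<rho> = d1 (wseq (Suc (Suc n))) \<phi> \<rho> + - 1 * d1 (wseq (Suc n)) \<phi> \<rho>"
      unfolding d1_def[of g] unfolding g_def
      by (intro DERIV_imp_deriv DERIV_add DERIV_cmult TP_D1 TP_wseq)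
    then show ?thesis unfolding d1_wseq g_def by (simp only: algebra_simps)
  qed
  moreover have "\<bar>rhs \<phi> \<rho> (wseq (Suc n) \<phi> \<rho>) - rhs \<phi> \<rho> (wseq n \<phi> \<rho>)\<bar> \<le> 1 / 5 * (1/2) ^ n" for \<phi>
    by (rule order_trans[OF rhs_lipschitz[OF wseq_small wseq_small] mult_left_mono[OF Suc]]) simp
  ultimately have "sqrt 3 * \<bar>g \<phi> \<rho>\<bar> \<le> 1 / 5 * (1/2) ^ n"
    by (rule TP_ode_bound[OF g])
  moreover have "1 * \<bar>g \<phi> \<rho>\<bar> \<le> sqrt 3 * \<bar>g \<phi> \<rho>\<bar>"
    using sqrt3_bounds by (intro mult_right_mono) auto
  ultimately have "\<bar>g \<phi> \<rho>\<bar> \<le> (1/2) ^ Suc n" by simp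
  then show ?case by (simp add: g_def)
qed

text \<open>The equation of an iterate contains \<open>rhs\<close> at its predecessor, so the defect
  is a difference of \<open>rhs\<close> at consecutive iterates and inherits their geometric
  decay.\<close>

lemma wseq_residual:
  "\<bar>d1 (wseq n) \<phi> \<rho> - sqrt 3 * wseq n \<phi> \<rho> - rhs \<phi> \<rho> (wseq n \<phi> \<rho>)\<bar> \<le> 2 * (1/2) ^ n"
proof (cases n)
  case 0
  have "d1 (wseq n) \<phi> \<rho> = 0" "wseq n \<phi> \<rho> = 0" using 0 by (simp_all add: d1_def)
  moreover have "\<bar>rhs \<phi> \<rho> 0\<bar> \<le> 1" using rhs_bound[of 0 \<phi>] rho by simp
  ultimately show ?thesis using 0 by simp
next
  case (Suc m)
  have "d1 (wseq n) \<phi> \<rho> - sqrt 3 * wseq n \<phi> \<rho> - rhs \<phi> \<rho> (wseq n \<phi> \<rho>)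
      = - (rhs \<phi> \<rho> (wseq (Suc m) \<phi> \<rho>) - rhs \<phi> \<rho> (wseq m \<phi> \<rho>))"
    unfolding Suc d1_wseq by simp
  moreover have "\<bar>rhs \<phi> \<rho> (wseq (Suc m) \<phi> \<rho>) - rhs \<phi> \<rho> (wseq m \<phi> \<rho>)\<bar> \<le> 1 / 5 * (1/2) ^ m"
    by (rule order_trans[OF rhs_lipschitz[OF wseq_small wseq_small] mult_left_mono[OF wseq_cauchy]]) simp
  moreover have "2 * (1/2) ^ n = (1/2::real) ^ m" using Suc by simp
  moreover have "(0::real) \<le> (1/2) ^ m" by simp
  ultimately show ?thesis by linarith
qed

section \<open>Derivatives of the iterates in phase and ratio\<close>

lemma rhs_DERIV_p:
  assumes "(w has_real_derivative D) (at \<phi>)"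
  shows "((\<lambda>s. rhs s \<rho> (w s)) has_real_derivative rhs_w \<phi> \<rho> (w \<phi>) * D + rhs_p \<phi> \<rho> (w \<phi>)) (at \<phi>)"
  unfolding rhs_def rhs_w_def rhs_p_def
  by (auto intro!: derivative_eq_intros assms simp: algebra_simps power2_eq_square)

lemma d11_wseq_bound: "\<bar>d1 (d1 (wseq n)) \<phi> \<rho>\<bar> \<le> 1"
proof (cases n)
  case 0
  then show ?thesis by (simp add: d1_def)
next
  case (Suc m)
  have "d1 (d1 (wseq n)) \<phi> \<rho> = sqrt 3 * d1 (wseq n) \<phi> \<rho>
      + (rhs_w \<phi> \<rho> (wseq m \<phi> \<rho>) * d1 (wseq m) \<phi> \<rho> + rhs_p \<phi> \<rho> (wseq m \<phi> \<rho>))"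
  proof -
    have "(\<lambda>s. d1 (wseq n) s \<rho>) = (\<lambda>s. sqrt 3 * wseq n s \<rho> + rhs s \<rho> (wseq m s \<rho>))"
      by (simp only: Suc d1_wseq)
    then show ?thesis
      unfolding d1_def[of "d1 (wseq n)"]
      by (simp only:) (intro DERIV_imp_deriv DERIV_add DERIV_cmult rhs_DERIV_p TP_D1 TP_wseq)
  qed
  moreover have "\<bar>sqrt 3 * d1 (wseq n) \<phi> \<rho>\<bar> \<le> 7 / 4 * (1 / 5)"
    using sqrt3_bounds by (intro abs_mult_mono d1_wseq_bound) simp
  moreover have "\<bar>rhs_w \<phi> \<rho> (wseq m \<phi> \<rho>) * d1 (wseq m) \<phi> \<rho>\<bar> \<le> 1 / 5 * (1 / 5)"
    by (intro abs_mult_mono d1_wseq_bound coeff_bounds wseq_small)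
  moreover have "\<bar>rhs_p \<phi> \<rho> (wseq m \<phi> \<rho>)\<bar> \<le> 1 / 10" by (intro coeff_bounds wseq_small)
  ultimately show ?thesis by linarith
qed

lemma rhs_DERIV_r:
  assumes "(w has_real_derivative D) (at r)"
  shows "((\<lambda>s. rhs \<phi> s (w s)) has_real_derivative rhs_w \<phi> r (w r) * D + rhs_r \<phi> (w r)) (at r)"
    and "(v has_real_derivative E) (at r) \<Longrightarrow>
      ((\<lambda>s. rhs_w \<phi> s (w s) * v s + rhs_r \<phi> (w s)) has_real_derivative
       (rhs_ww \<phi> r * D + rhs_rw \<phi> (w r)) * v r + rhs_w \<phi> r (w r) * E + rhs_rw \<phi> (w r) * D) (at r)"
  unfolding rhs_def rhs_w_def rhs_r_def rhs_ww_def rhs_rw_def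
  by (auto intro!: derivative_eq_intros assms simp: algebra_simps power2_eq_square)

lemma d1_d2_wseq: "d1 (d2 (wseq (Suc n))) \<phi> r = sqrt 3 * d2 (wseq (Suc n)) \<phi> r
    + (rhs_w \<phi> r (wseq n \<phi> r) * d2 (wseq n) \<phi> r + rhs_r \<phi> (wseq n \<phi> r))"
  unfolding TP_commute[OF TP_wseq] d2_def[of "d1 (wseq (Suc n))"] unfolding d1_wseq
  by (rule DERIV_imp_deriv, intro DERIV_add DERIV_cmult rhs_DERIV_r) (rule TP_D2[OF TP_wseq])+

text \<open>Differentiating the equation in \<rho> keeps the linear operator and changes only the
  forcing, so the same maximum principle bounds all iterates at once. A further differentiation
  controls the second derivative, which the action noise brings in.\<close>

lemma d2_wseq_bound: "\<bar>d2 (wseq n) \<phi> \<rho>\<bar> \<le> 5"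
proof (induction n arbitrary: \<phi>)
  case 0
  then show ?case by (simp add: d2_def)
next
  case (Suc n)
  have "\<bar>rhs_w \<phi> \<rho> (wseq n \<phi> \<rho>) * d2 (wseq n) \<phi> \<rho> + rhs_r \<phi> (wseq n \<phi> \<rho>)\<bar> \<le> 1 / 5 * 5 + 6" for \<phi>
    by (intro abs_add_mono abs_mult_mono coeff_bounds wseq_small Suc)
  then have "sqrt 3 * \<bar>d2 (wseq (Suc n)) \<phi> \<rho>\<bar> \<le> 1 / 5 * 5 + 6"
    by (rule TP_ode_bound[OF TP_d2[OF TP_wseq] d1_d2_wseq])
  moreover have "17 / 10 * \<bar>d2 (wseq (Suc n)) \<phi> \<rho>\<bar> \<le> sqrt 3 * \<bar>d2 (wseq (Suc n)) \<phi> \<rho>\<bar>"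
    by (intro mult_right_mono sqrt3_bounds) simp
  ultimately show ?case by linarith
qed

lemma d22_wseq_bound: "\<bar>d2 (d2 (wseq n)) \<phi> \<rho>\<bar> \<le> 100"
proof (induction n arbitrary: \<phi>)
  case 0
  then show ?case by (simp add: d2_def)
next
  case (Suc n)
  let ?w = "\<lambda>\<phi>. wseq n \<phi> \<rho>" and ?v = "\<lambda>\<phi>. d2 (wseq n) \<phi> \<rho>"
  have "d1 (d2 (d2 (wseq (Suc n)))) \<phi> \<rho> = sqrt 3 * d2 (d2 (wseq (Suc n))) \<phi> \<rho>
     + ((rhs_ww \<phi> \<rho> * ?v \<phi> + rhs_rw \<phi> (?w \<phi>)) * ?v \<phi> + rhs_w \<phi> \<rho> (?w \<phi>) * d2 (d2 (wseq n)) \<phi> \<rho>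
        + rhs_rw \<phi> (?w \<phi>) * ?v \<phi>)" for \<phi>
    unfolding TP_commute[OF TP_d2[OF TP_wseq]] d2_def[of "d1 (d2 (wseq (Suc n)))"] unfolding d1_d2_wseq
    by (rule DERIV_imp_deriv, intro DERIV_add[OF DERIV_cmult rhs_DERIV_r(2)]) (rule TP_D2 TP_d2 TP_wseq)+
  moreover have "\<bar>(rhs_ww \<phi> \<rho> * ?v \<phi> + rhs_rw \<phi> (?w \<phi>)) * ?v \<phi> + rhs_w \<phi> \<rho> (?w \<phi>) * d2 (d2 (wseq n)) \<phi> \<rho>
        + rhs_rw \<phi> (?w \<phi>) * ?v \<phi>\<bar> \<le> (11 / 10 * 5 + 15 / 2) * 5 + 1 / 5 * 100 + 15 / 2 * 5" for \<phi>
    by (intro abs_add_mono abs_mult_mono coeff_bounds rhs_ww_bound wseq_small d2_wseq_bound Suc)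
  moreover have "(11 / 10 * 5 + 15 / 2) * 5 + 1 / 5 * 100 + 15 / 2 * 5 = (245 / 2 :: real)" by simp
  ultimately have "sqrt 3 * \<bar>d2 (d2 (wseq (Suc n))) \<phi> \<rho>\<bar> \<le> 245 / 2"
    by (simp only:) (rule TP_ode_bound[OF TP_d2[OF TP_d2[OF TP_wseq]]])
  moreover have "17 / 10 * \<bar>d2 (d2 (wseq (Suc n))) \<phi> \<rho>\<bar> \<le> sqrt 3 * \<bar>d2 (d2 (wseq (Suc n))) \<phi> \<rho>\<bar>"
    by (intro mult_right_mono sqrt3_bounds) simp
  ultimately show ?case by linarith
qed

end

section \<open>Distance to the repelling orbit\<close>

text \<open>The factor 101 is what makes I1 / (I3 - I1) less than 1/100, the range of \<rho> in
  which the iterates are controlled.\<close>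

definition small_ratio :: "st set" where
  "small_ratio = {x. 0 < coord 1 x \<and> 101 * coord 1 x < coord 2 x}"

definition phase :: "st \<Rightarrow> real" where
  "phase x = coord 3 x - coord 4 x"

definition ratio :: "st \<Rightarrow> real" where
  "ratio x = coord 1 x / (coord 2 x - coord 1 x)"

lemma open_small_ratio [simp]: "open small_ratio"
  unfolding small_ratio_def by (intro open_Collect_conj open_Collect_less continuous_intros)

lemma small_ratioD:
  assumes "x \<in> small_ratio"
  shows "0 < coord 1 x" "101 * coord 1 x < coord 2 x" "0 < coord 2 x" "0 < coord 2 x - coord 1 x"
    "0 < ratio x" "ratio x < 1 / 100"
  using assms by (auto simp: small_ratio_def ratio_def field_simps)

lemma C2_on_cmult: "open S \<Longrightarrow> C2_on S f \<Longrightarrow> C2_on S (\<lambda>x. c * f x)"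
  by (intro C2_on_mult C2_on_const)

lemma C2_on_diff: "open S \<Longrightarrow> C2_on S f \<Longrightarrow> C2_on S g \<Longrightarrow> C2_on S (\<lambda>x. f x - g x)"
  using C2_on_add[of S f "\<lambda>x. (-1) * g x"] C2_on_cmult[of S g "-1"] by simp

lemma C2_on_phase: "open S \<Longrightarrow> C2_on S phase"
  unfolding phase_def[abs_def] by (intro C2_on_diff C2_on_coord)

lemma C2_on_inverse:
  assumes "open S" "C2_on S f" "\<And>x. x \<in> S \<Longrightarrow> 0 < f x"
  shows "C2_on S (\<lambda>x. inverse (f x))"
proof (rule C2_on_comp[OF assms(1,2), where J="{0<..}" and v'="\<lambda>s. - inverse (s^2)" and v''="\<lambda>s. 2 * inverse (s ^ 3)"])
  show "(inverse has_real_derivative - inverse (s^2)) (at s)" if "s \<in> {0<..}" for s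
    using that by (auto intro!: derivative_eq_intros simp: power2_eq_square)
  show "((\<lambda>s. - inverse (s^2)) has_real_derivative 2 * inverse (s ^ 3)) (at s)" if "s \<in> {0<..}" for s
    using that by (auto intro!: derivative_eq_intros simp: field_simps power2_eq_square power3_eq_cube)
  show "continuous_on {0<..} (\<lambda>s::real. 2 * inverse (s ^ 3))"
    by (auto intro!: continuous_intros)
qed (use assms in auto)

lemma C2_on_ratio: "C2_on small_ratio ratio"
  unfolding ratio_def[abs_def] divide_inverse
  by (intro C2_on_mult C2_on_inverse C2_on_diff C2_on_coord open_small_ratio) (rule small_ratioD(4))

lemma pd_phase: "pd 1 phase x = 0" "pd (Suc 0) phase x = 0" "pd 2 phase x = 0" "pd 3 phase x = 1" "pd 4 phase x = - 1"
  by (rule pd_eqI, simp add: phase_def coord_upd; auto intro!: derivative_eq_intros)+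

lemma pd_ratio:
  assumes "x \<in> small_ratio"
  shows "pd 1 ratio x = coord 2 x / (coord 2 x - coord 1 x)^2" (is ?P1)
    "pd 2 ratio x = - coord 1 x / (coord 2 x - coord 1 x)^2" (is ?P2)
    "pd 3 ratio x = 0" "pd 4 ratio x = 0"
proof -
  note p = small_ratioD(4)[OF assms]
  show ?P1
    by (rule pd_eqI, simp add: ratio_def coord_upd)
       (use p in \<open>auto intro!: derivative_eq_intros simp: field_simps power2_eq_square\<close>)
  show ?P2
    by (rule pd_eqI, simp add: ratio_def coord_upd)
       (use p in \<open>auto intro!: derivative_eq_intros simp: field_simps power2_eq_square\<close>)
  show "pd 3 ratio x = 0" "pd 4 ratio x = 0"
    by (rule pd_eqI, simp add: ratio_def coord_upd)+
qed

lemma inverse_square_DERIV: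
  fixes a b c :: real
  assumes "a < b"
  shows "((\<lambda>t. c / (b - t)^2) has_real_derivative 2 * c / (b - a) ^ 3) (at a)" (is ?P1)
    and "((\<lambda>t. c / (t - a)^2) has_real_derivative - 2 * c / (b - a) ^ 3) (at b)" (is ?P2)
proof -
  have 1: "((\<lambda>t. inverse (b - t)) has_real_derivative (inverse (b - a))^2) (at a)"
    and 2: "((\<lambda>t. inverse (t - a)) has_real_derivative - (inverse (b - a))\<^sup>2) (at b)"
    using assms by (auto intro!: derivative_eq_intros simp: power2_eq_square)
  show ?P1
    using DERIV_cmult[OF DERIV_power[OF 1, of 2], of c]
    by (simp add: divide_inverse power_inverse power2_eq_square power3_eq_cube mult_ac)
  show ?P2
    using DERIV_cmult[OF DERIV_power[OF 2, of 2], of c]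
    by (simp add: divide_inverse power_inverse power2_eq_square power3_eq_cube mult_ac)
qed

lemma pd_pd_ratio:
  assumes "x \<in> small_ratio"
  shows "pd 1 (pd 1 ratio) x = 2 * coord 2 x / (coord 2 x - coord 1 x) ^ 3" (is ?P1)
    "pd 2 (pd 2 ratio) x = 2 * coord 1 x / (coord 2 x - coord 1 x) ^ 3" (is ?P2)
proof -
  note p = small_ratioD(4)[OF assms]
  have "pd 1 (pd 1 ratio) x = pd 1 (\<lambda>x. coord 2 x / (coord 2 x - coord 1 x)^2) x"
    by (rule pd_cong[OF open_small_ratio assms pd_ratio(1)])
  also have "\<dots> = 2 * coord 2 x / (coord 2 x - coord 1 x) ^ 3"
    by (rule pd_eqI) (use p inverse_square_DERIV(1)[of "coord 1 x" "coord 2 x"] in \<open>simp add: coord_upd\<close>)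
  finally show ?P1 .
  have "pd 2 (pd 2 ratio) x = pd 2 (\<lambda>x. - coord 1 x / (coord 2 x - coord 1 x)^2) x"
    by (rule pd_cong[OF open_small_ratio assms pd_ratio(2)])
  also have "\<dots> = 2 * coord 1 x / (coord 2 x - coord 1 x) ^ 3"
    by (rule pd_eqI)
       (use p inverse_square_DERIV(2)[of "coord 1 x" "coord 2 x" "- coord 1 x"] in \<open>simp add: coord_upd\<close>)
  finally show ?P2 .
qed

section \<open>Functions of phase and ratio on the state space\<close>

lemma TP_comp_DERIV:
  assumes "TP H" "C1_on S f" "C1_on S g" "x \<in> S"
  shows "((\<lambda>t. H (f (upd i x t)) (g (upd i x t))) has_real_derivative
     d1 H (f x) (g x) * pd i f x + d2 H (f x) (g x) * pd i g x) (at (coord i x))"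
proof -
  have "((\<lambda>t. (f (upd i x t), g (upd i x t))) has_derivative (\<lambda>h. (pd i f x * h, pd i g x * h))) (at (coord i x))"
    by (intro has_derivative_Pair has_field_derivative_imp_has_derivative pd_DERIV[OF assms(2,4)] pd_DERIV[OF assms(3,4)])
  from has_derivative_compose[OF this, of "\<lambda>p. H (fst p) (snd p)" "\<lambda>h. d1 H (f x) (g x) * fst h + d2 H (f x) (g x) * snd h"]
  have "((\<lambda>t. H (f (upd i x t)) (g (upd i x t))) has_derivative
      (\<lambda>h. d1 H (f x) (g x) * (pd i f x * h) + d2 H (f x) (g x) * (pd i g x * h))) (at (coord i x))"
    using TP_has_derivative[OF assms(1), of "f x" "g x"] by simp
  then show ?thesis
    unfolding has_field_derivative_def by (rule has_derivative_eq_rhs) (simp add: fun_eq_iff algebra_simps)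
qed

lemma TP_comp_continuous:
  assumes "TP H" "continuous_on S f" "continuous_on S g"
  shows "continuous_on S (\<lambda>x. H (f x) (g x))"
proof -
  have "continuous_on UNIV (\<lambda>p. H (fst p) (snd p))"
    by (intro continuous_at_imp_continuous_on ballI)
       (auto intro: has_derivative_continuous[OF TP_has_derivative[OF assms(1)]])
  then show ?thesis
    using continuous_on_compose2[of UNIV "\<lambda>p. H (fst p) (snd p)" S "\<lambda>x. (f x, g x)"] assms
    by (auto intro: continuous_on_Pair)
qed

lemma pd_TP_comp:
  assumes "TP H" "C1_on S f" "C1_on S g" "x \<in> S"
  shows "pd i (\<lambda>x. H (f x) (g x)) x = d1 H (f x) (g x) * pd i f x + d2 H (f x) (g x) * pd i g x"
  by (rule pd_eqI, rule TP_comp_DERIV[OF assms])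

lemma C1_on_TP_comp:
  assumes "TP H" "C1_on S f" "C1_on S g"
  shows "C1_on S (\<lambda>x. H (f x) (g x))"
proof -
  note c = TP_comp_continuous[OF _ C1_on_continuous[OF assms(2)] C1_on_continuous[OF assms(3)]]
  note c = c[OF assms(1)] c[OF TP_d1[OF assms(1)]] c[OF TP_d2[OF assms(1)]]
  show ?thesis
  by (rule C1_onI[OF _ TP_comp_DERIV[OF assms]])
     (auto intro!: continuous_on_add continuous_on_mult c C1_on_continuous_pd[OF assms(2)] C1_on_continuous_pd[OF assms(3)])
qed

lemma C2_on_TP_comp:
  assumes "TP H" "open S" "C2_on S f" "C2_on S g"
  shows "C2_on S (\<lambda>x. H (f x) (g x))"
proof -
  note fg = C2_on_C1[OF assms(3)] C2_on_C1[OF assms(4)]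
  have "C1_on S (pd i (\<lambda>x. H (f x) (g x)))" for i
    by (rule C1_on_cong[OF assms(2) pd_TP_comp[OF assms(1) fg]])
       (auto intro!: C1_on_add C1_on_mult C1_on_TP_comp[OF TP_d1[OF assms(1)] fg] C1_on_TP_comp[OF TP_d2[OF assms(1)] fg]
          C2_on_pd[OF assms(3)] C2_on_pd[OF assms(4)])
  then show ?thesis
    unfolding C2_on_def using C1_on_TP_comp[OF assms(1) fg] by blast
qed

definition pull :: "(real \<Rightarrow> real \<Rightarrow> real) \<Rightarrow> st \<Rightarrow> real" where
  "pull H x = H (phase x) (ratio x)"

lemma C2_on_pull: "TP H \<Longrightarrow> C2_on small_ratio (pull H)"
  unfolding pull_def[abs_def]
  by (rule C2_on_TP_comp[OF _ open_small_ratio C2_on_phase[OF open_small_ratio] C2_on_ratio])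

lemma pd_pull:
  assumes "TP H" "x \<in> small_ratio"
  shows "pd 1 (pull H) x = pull (d2 H) x * pd 1 ratio x" (is ?P1)
    "pd 2 (pull H) x = pull (d2 H) x * pd 2 ratio x" (is ?P2)
    "pd 3 (pull H) x = pull (d1 H) x" (is ?P3)
    "pd 4 (pull H) x = - pull (d1 H) x" (is ?P4)
proof -
  have "pd i (pull H) x = pull (d1 H) x * pd i phase x + pull (d2 H) x * pd i ratio x" for i
    using pd_TP_comp[OF assms(1) C2_on_C1[OF C2_on_phase[OF open_small_ratio]] C2_on_C1[OF C2_on_ratio] assms(2)]
    by (simp only: pull_def[abs_def])
  then show ?P1
    ?P2
    ?P3
    ?P4
    using pd_phase[of x] pd_ratio(3,4)[OF assms(2)] by simp_all
qed

lemma pd_pd_pull: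
  assumes "TP H" "x \<in> small_ratio"
  shows "pd 1 (pd 1 (pull H)) x = pull (d2 (d2 H)) x * (pd 1 ratio x)^2 + pull (d2 H) x * pd 1 (pd 1 ratio) x" (is ?P1)
    "pd 2 (pd 2 (pull H)) x = pull (d2 (d2 H)) x * (pd 2 ratio x)^2 + pull (d2 H) x * pd 2 (pd 2 ratio) x" (is ?P2)
    "pd 3 (pd 3 (pull H)) x = pull (d1 (d1 H)) x" (is ?P3)
    "pd 4 (pd 4 (pull H)) x = pull (d1 (d1 H)) x" (is ?P4)
proof -
  note S = open_small_ratio assms(2)
  have m: "pd i (\<lambda>x. pull (d2 H) x * pd i ratio x) x = pd i (pull (d2 H)) x * pd i ratio x + pull (d2 H) x * pd i (pd i ratio) x" for i
    by (rule pd_mult[OF C2_on_C1[OF C2_on_pull] C2_on_pd[OF C2_on_ratio] assms(2)]) (intro TP_d2 assms(1))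
  show ?P1
  proof -
    have "pd 1 (pd 1 (pull H)) x = pd 1 (\<lambda>y. pull (d2 H) y * pd 1 ratio y) x"
      by (rule pd_cong[OF S]) (rule pd_pull[OF assms(1)])
    then show ?thesis
      unfolding m[of 1] pd_pull(1)[OF TP_d2[OF assms(1)] assms(2)] by (simp only: power2_eq_square mult.assoc)
  qed
  show ?P2
  proof -
    have "pd 2 (pd 2 (pull H)) x = pd 2 (\<lambda>y. pull (d2 H) y * pd 2 ratio y) x"
      by (rule pd_cong[OF S]) (rule pd_pull[OF assms(1)])
    then show ?thesis
      unfolding m[of 2] pd_pull(2)[OF TP_d2[OF assms(1)] assms(2)] by (simp only: power2_eq_square mult.assoc)
  qed
  show ?P3
  proof -
    have "pd 3 (pd 3 (pull H)) x = pd 3 (pull (d1 H)) x"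
      by (rule pd_cong[OF S]) (rule pd_pull[OF assms(1)])
    then show ?thesis
      unfolding pd_pull(3)[OF TP_d1[OF assms(1)] assms(2)] .
  qed
  have "pd 4 (pd 4 (pull H)) x = pd 4 (\<lambda>y. (- 1) * pull (d1 H) y) x"
    by (rule pd_cong[OF S]) (simp only: pd_pull(4)[OF assms(1)] mult_minus1)
  also have "\<dots> = 0 * pull (d1 H) x + (- 1) * pd 4 (pull (d1 H)) x"
    using pd_mult[OF C1_on_const[of _ "-1"] C2_on_C1[OF C2_on_pull[OF TP_d1[OF assms(1)]]] assms(2), where i=4]
    by (simp only: pd_const)
  finally show ?P4
    unfolding pd_pull(4)[OF TP_d1[OF assms(1)] assms(2)] by simp
qed

section \<open>Half-angle functions and the gap\<close>

lemma pd_coord4: "pd 1 (coord 4) x = 0" "pd 2 (coord 4) x = 0" "pd 3 (coord 4) x = 0" "pd 4 (coord 4) x = 1"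
  by (simp_all add: pd_coord)

lemma pd_pd_coord [simp]: "pd i (pd j (coord k)) x = 0"
  by (auto simp: pd_coord)

lemma coord4_comp:
  assumes v': "\<And>s. (v has_real_derivative v' s) (at s)"
    and v'': "\<And>s. (v' has_real_derivative v'' s) (at s)" and c: "continuous_on UNIV v''"
  shows "C2_on S (\<lambda>x. v (coord 4 x))" (is ?P1)
    and "gen_b \<gamma> T1 T3 (\<lambda>x. v (coord 4 x)) x =
      - (coord 2 x * (1 + 2 * cos (coord 4 x)) + 2 * coord 1 x * cos (coord 3 x)) * v' (coord 4 x)
      + \<gamma> / 2 * v'' (coord 4 x)" (is ?P2)
    and "pd 1 (\<lambda>x. v (coord 4 x)) x = 0" (is ?P3) "pd 2 (\<lambda>x. v (coord 4 x)) x = 0" (is ?P4)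
      "pd 3 (\<lambda>x. v (coord 4 x)) x = 0" (is ?P5) "pd 4 (\<lambda>x. v (coord 4 x)) x = v' (coord 4 x)" (is ?P6)
proof -
  have C: "C2_on UNIV (\<lambda>x. v (coord 4 x))"
    by (rule C2_on_comp[OF open_UNIV C2_on_coord _ v' v'' c]) auto
  then show ?P1 by (rule C2_on_subset) auto
  have "gen_b \<gamma> T1 T3 (\<lambda>x. v (coord 4 x)) x = v' (coord 4 x) * gen_b \<gamma> T1 T3 (coord 4) x
      + (1/2) * v'' (coord 4 x) * diff_b \<gamma> T1 T3 (coord 4) (coord 4) x"
    by (rule gen_b_comp[OF open_UNIV C2_on_coord _ v' v'' c]) auto
  then show ?P2
    by (simp add: gen_b_alt[of _ _ _ "coord 4"] diff_b_def pd_coord4 del: One_nat_def)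
  have "pd i (\<lambda>x. v (coord 4 x)) x = v' (coord 4 x) * pd i (coord 4) x" for i
    by (rule pd_comp[OF C2_on_C1[OF C2_on_coord[of UNIV]] _ v']) auto
  then show ?P3 ?P4
      ?P5 ?P6
    by (simp_all add: pd_coord4 del: One_nat_def)
qed

lemma sin_half_DERIV: "((\<lambda>s. sin (s / 2)) has_real_derivative cos (s / 2) / 2) (at s)"
  "((\<lambda>s. cos (s / 2) / 2) has_real_derivative - sin (s / 2) / 4) (at s)"
  "((\<lambda>s. cos (s / 2)) has_real_derivative - sin (s / 2) / 2) (at s)"
  "((\<lambda>s. - sin (s / 2) / 2) has_real_derivative - cos (s / 2) / 4) (at s)"
  for s :: real
  by (auto intro!: derivative_eq_intros)

lemma half_angle_continuous:
  "continuous_on UNIV (\<lambda>s::real. - sin (s / 2) / 4)" "continuous_on UNIV (\<lambda>s::real. - cos (s / 2) / 4)"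
  by (intro continuous_intros; simp)+

definition hsin :: "st \<Rightarrow> real" where "hsin x = sin (coord 4 x / 2)"
definition hcos :: "st \<Rightarrow> real" where "hcos x = cos (coord 4 x / 2)"

lemmas hsin_facts = coord4_comp[OF sin_half_DERIV(1,2) half_angle_continuous(1), folded hsin_def[abs_def], folded hsin_def hcos_def]
lemmas hcos_facts = coord4_comp[OF sin_half_DERIV(3,4) half_angle_continuous(2), folded hcos_def[abs_def], folded hsin_def hcos_def]

lemma hsin_hcos: "(hsin x)^2 + (hcos x)^2 = 1" "\<bar>hsin x\<bar> \<le> 1" "\<bar>hcos x\<bar> \<le> 1"
  "sin (coord 4 x) = 2 * hsin x * hcos x" "cos (coord 4 x) = (hcos x)^2 - (hsin x)^2"
  using sin_double[of "coord 4 x / 2"] cos_double[of "coord 4 x / 2"] by (auto simp: hsin_def hcos_def)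

definition slope :: "nat \<Rightarrow> st \<Rightarrow> real" where
  "slope n x = sqrt 3 + pull (wseq n) x"

text \<open>This is cos (\<theta>3/2) times the difference of tan (\<theta>3/2) and
  \<open>slope\<close>, written so that it stays smooth where the tangent is infinite. A full turn
  of \<theta>3 reverses its sign, so only its square is a function on the torus.\<close>

definition gap :: "nat \<Rightarrow> st \<Rightarrow> real" where
  "gap n x = hsin x + (- slope n x) * hcos x"

text \<open>Once \<theta>1 is replaced by phase plus \<theta>3, \<open>drift_p\<close> and
  \<open>drift_q\<close> are the coefficients of cos \<theta>3 and sin \<theta>3 in the negated
  drift of \<theta>3.\<close>

definition drift_p :: "st \<Rightarrow> real" where "drift_p x = 2 * coord 2 x + 2 * coord 1 x * cos (phase x)"
definition drift_q :: "st \<Rightarrow> real" where "drift_q x = - 2 * coord 1 x * sin (phase x)"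

text \<open>Twice the exponential rate at which the gap grows under the drift. The leading part is
  I3 (2 sin \<theta>3 + sqrt 3): positive at the repelling angle, zero at the attracting
  one.\<close>

definition growth :: "nat \<Rightarrow> st \<Rightarrow> real" where
  "growth n x = drift_p x * sin (coord 4 x) - drift_q x * cos (coord 4 x) - drift_q x + (drift_p x - coord 2 x) * slope n x"

lemma C2_on_slope: "C2_on small_ratio (\<lambda>x. - slope n x)"
proof -
  have "C2_on small_ratio (\<lambda>x. - sqrt 3 + (- 1) * pull (wseq n) x)"
    by (intro C2_on_add C2_on_cmult C2_on_pull TP_wseq C2_on_const open_small_ratio)
  then show ?thesis by (simp add: slope_def)
qed

lemma C2_on_gap: "C2_on small_ratio (gap n)"
  unfolding gap_def[abs_def]
  by (intro C2_on_add C2_on_mult C2_on_slope hsin_facts(1) hcos_facts(1) open_small_ratio)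

lemma drift_eq:
  "coord 2 x * (1 + 2 * cos (coord 4 x)) + 2 * coord 1 x * cos (coord 3 x)
     = coord 2 x + drift_p x * cos (coord 4 x) + drift_q x * sin (coord 4 x)"
proof -
  have "coord 3 x = phase x + coord 4 x" by (simp add: phase_def)
  then show ?thesis by (simp add: drift_p_def drift_q_def cos_add algebra_simps)
qed

lemma gen_b_slope:
  assumes "x \<in> small_ratio"
  shows "gen_b \<gamma> T1 T3 (\<lambda>x. - slope n x) x = - gen_b \<gamma> T1 T3 (pull (wseq n)) x" (is ?P1)
    and "pd i (\<lambda>x. - slope n x) x = - pd i (pull (wseq n)) x" (is ?P2)
proof -
  have e: "(\<lambda>x. - slope n x) = (\<lambda>x. - sqrt 3 + (- 1) * pull (wseq n) x)"
    by (simp add: slope_def fun_eq_iff)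
  note O = C2_on_pull[OF TP_wseq[of n]]
  have "gen_b \<gamma> T1 T3 (\<lambda>x. - slope n x) x = gen_b \<gamma> T1 T3 (\<lambda>x. - sqrt 3) x + gen_b \<gamma> T1 T3 (\<lambda>x. (- 1) * pull (wseq n) x) x"
    unfolding e by (intro gen_b_add[OF open_small_ratio _ _ assms] C2_on_const C2_on_cmult O open_small_ratio)
  then show ?P1
    using gen_b_cmult[OF open_small_ratio O assms, where c="-1"] by simp
  have m: "C1_on small_ratio (\<lambda>x. (- 1) * pull (wseq n) x)"
    by (intro C1_on_mult C1_on_const C2_on_C1 O)
  have "pd i (\<lambda>x. - slope n x) x = pd i (\<lambda>x. - sqrt 3) x + pd i (\<lambda>x. (- 1) * pull (wseq n) x) x"
    unfolding e by (rule pd_add[OF C1_on_const m assms])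
  then show ?P2
    using pd_mult[OF C1_on_const[of _ "-1"] C2_on_C1[OF O] assms, where i=i] by simp
qed

lemma pd_gap:
  assumes "x \<in> small_ratio"
  shows "pd 1 (gap n) x = - pull (d2 (wseq n)) x * pd 1 ratio x * hcos x" (is ?P1)
    "pd 2 (gap n) x = - pull (d2 (wseq n)) x * pd 2 ratio x * hcos x" (is ?P2)
    "pd 3 (gap n) x = - pull (d1 (wseq n)) x * hcos x" (is ?P3)
    "pd 4 (gap n) x = (hcos x + slope n x * hsin x) / 2 + pull (d1 (wseq n)) x * hcos x" (is ?P4)
proof -
  note C = C2_on_C1[OF C2_on_slope] C2_on_C1[OF hsin_facts(1)] C2_on_C1[OF hcos_facts(1)]
  have "pd i (gap n) x = pd i hsin x + (- pd i (pull (wseq n)) x * hcos x + (- slope n x) * pd i hcos x)" for i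
  proof -
    have "pd i (gap n) x = pd i hsin x + pd i (\<lambda>x. (- slope n x) * hcos x) x"
      unfolding gap_def[abs_def] by (intro pd_add[OF _ _ assms] C1_on_mult C)
    also have "pd i (\<lambda>x. (- slope n x) * hcos x) x = pd i (\<lambda>x. - slope n x) x * hcos x + (- slope n x) * pd i hcos x"
      by (intro pd_mult[OF _ _ assms] C)
    finally show ?thesis by (simp only: gen_b_slope(2)[OF assms])
  qed
  note this = this[of 1] this[of 2] this[of 3] this[of 4]
  then show ?P1
    ?P2
    ?P3
    ?P4
    unfolding hsin_facts(3-) hcos_facts(3-) pd_pull[OF TP_wseq assms] by (simp_all add: algebra_simps add_divide_distrib)
qed

text \<open>The part of the generator of the orbit function that carries the factor \<gamma>. The
  last summand has coefficient 1 because both angular noises contribute 1/2.\<close>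

definition slow :: "real \<Rightarrow> real \<Rightarrow> nat \<Rightarrow> st \<Rightarrow> real" where
  "slow T1 T3 n x =
     (T1 - coord 1 x ^ 3) * (pull (d2 (wseq n)) x * pd 1 ratio x)
   + (T3 - coord 2 x ^ 3) * (pull (d2 (wseq n)) x * pd 2 ratio x)
   + T1 * coord 1 x / 4 * (pull (d2 (d2 (wseq n))) x * (pd 1 ratio x)^2 + pull (d2 (wseq n)) x * pd 1 (pd 1 ratio) x)
   + T3 * coord 2 x / 4 * (pull (d2 (d2 (wseq n))) x * (pd 2 ratio x)^2 + pull (d2 (wseq n)) x * pd 2 (pd 2 ratio) x)
   + pull (d1 (d1 (wseq n))) x"

lemma gen_b_pull:
  assumes "x \<in> small_ratio"
  shows "gen_b \<gamma> T1 T3 (pull (wseq n)) x =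
    (coord 2 x - coord 1 x) * pull (d1 (wseq n)) x + \<gamma> * slow T1 T3 n x"
  unfolding gen_b_alt pd_pull[OF TP_wseq assms] pd_pd_pull[OF TP_wseq assms] slow_def
  by (simp add: algebra_simps)

text \<open>If S = T C, then C^2 (1 + T^2) = 1 and the left side vanishes; the identity displays the
  factor S - T C. It expresses that a curve on which T solves the Riccati equation is invariant,
  whence the drift of the gap is a multiple of the gap.\<close>

lemma riccati_identity:
  fixes S C T p q I3 :: real
  assumes "S^2 + C^2 = 1"
  shows "(I3 + p * (C^2 - S^2) + q * (2 * S * C)) * (C + T * S) - C * (I3 * (1 + T^2) + p * (1 - T^2) + 2 * q * T)
    = - ((p * (2 * S * C) - q * (C^2 - S^2) - q + (p - I3) * T) * (S - T * C))"
  using assms by algebra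

text \<open>With T = sqrt 3 + w the right side is the Riccati drift of tan (\<theta>3/2). Dividing
  by I3 - I1 and expressing both actions through \<rho> gives the linear term plus
  \<open>rhs\<close>; this is the origin of that formula.\<close>

lemma rhs_riccati:
  assumes "x \<in> small_ratio"
  shows "(coord 2 x - coord 1 x) * (sqrt 3 * pull (wseq n) x + rhs (phase x) (ratio x) (pull (wseq n) x))
    = - (coord 2 x * (1 + (slope n x)^2) + drift_p x * (1 - (slope n x)^2) + 2 * drift_q x * slope n x) / 2"
proof -
  define Om where "Om = coord 2 x - coord 1 x"
  define w where "w = pull (wseq n) x"
  have I1: "coord 1 x = Om * ratio x" and I3: "coord 2 x = Om * (1 + ratio x)"
    using small_ratioD(4)[OF assms] by (auto simp: Om_def ratio_def field_simps)
  have r3: "sqrt 3 * sqrt 3 = (3::real)" by simp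
  show ?thesis
    unfolding rhs_def slope_def drift_p_def drift_q_def w_def[symmetric]
    unfolding I1 I3 using r3 by (simp add: field_simps power2_eq_square)
qed

definition residual :: "nat \<Rightarrow> st \<Rightarrow> real" where
  "residual n x = pull (d1 (wseq n)) x - sqrt 3 * pull (wseq n) x - rhs (phase x) (ratio x) (pull (wseq n) x)"

text \<open>The drift part factors through the gap by the Riccati identity. The failure of the
  iterate to be an exact orbit appears only as \<open>residual\<close>, and everything else carries
  \<gamma>.\<close>

lemma gen_b_gap:
  assumes x: "x \<in> small_ratio"
  shows "gen_b \<gamma> T1 T3 (gap n) x = growth n x * gap n x / 2
    - hcos x * (coord 2 x - coord 1 x) * residual n x
    + \<gamma> * (- hsin x / 8 - hcos x * slow T1 T3 n x + slope n x * hcos x / 8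
          - pull (d1 (wseq n)) x * hsin x / 2)"
proof -
  let ?b = "coord 2 x + drift_p x * cos (coord 4 x) + drift_q x * sin (coord 4 x)"
  let ?W = "pull (d1 (wseq n)) x" and ?T = "slope n x" and ?Om = "coord 2 x - coord 1 x"
  have "gen_b \<gamma> T1 T3 (gap n) x = gen_b \<gamma> T1 T3 hsin x + gen_b \<gamma> T1 T3 (\<lambda>x. (- slope n x) * hcos x) x"
    unfolding gap_def[abs_def]
    by (intro gen_b_add[OF open_small_ratio _ _ x] C2_on_mult C2_on_slope hsin_facts(1) hcos_facts(1) open_small_ratio)
  also have "gen_b \<gamma> T1 T3 (\<lambda>x. (- slope n x) * hcos x) x
     = hcos x * gen_b \<gamma> T1 T3 (\<lambda>x. - slope n x) x + (- slope n x) * gen_b \<gamma> T1 T3 hcos x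
       + diff_b \<gamma> T1 T3 (\<lambda>x. - slope n x) hcos x"
    by (intro gen_b_mult[OF open_small_ratio _ _ x] C2_on_slope hcos_facts(1))
  also have "diff_b \<gamma> T1 T3 (\<lambda>x. - slope n x) hcos x = \<gamma> * ?W * (- hsin x / 2)"
    unfolding diff_b_def hcos_facts(3-) gen_b_slope(2)[OF x] pd_pull[OF TP_wseq x] by simp
  also have "gen_b \<gamma> T1 T3 hcos x = - ?b * (- hsin x / 2) + \<gamma> / 2 * (- hcos x / 4)"
    unfolding hcos_facts(2) drift_eq ..
  also have "gen_b \<gamma> T1 T3 hsin x = - ?b * (hcos x / 2) + \<gamma> / 2 * (- hsin x / 4)"
    unfolding hsin_facts(2) drift_eq ..
  also have "gen_b \<gamma> T1 T3 (\<lambda>x. - slope n x) x = - (?Om * ?W + \<gamma> * slow T1 T3 n x)"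
    unfolding gen_b_slope(1)[OF x] gen_b_pull[OF x] ..
  finally have 1: "gen_b \<gamma> T1 T3 (gap n) x =
      - (?b * (hcos x + ?T * hsin x) / 2) - hcos x * (?Om * ?W)
      + \<gamma> * (- hsin x / 8 - hcos x * slow T1 T3 n x + ?T * hcos x / 8 - ?W * hsin x / 2)"
    by (simp add: algebra_simps add_divide_distrib)
  have "?b * (hcos x + ?T * hsin x) - hcos x * (coord 2 x * (1 + ?T^2) + drift_p x * (1 - ?T^2) + 2 * drift_q x * ?T)
      = - (growth n x * gap n x)"
    unfolding hsin_hcos(4,5) growth_def gap_def
    using riccati_identity[OF hsin_hcos(1), of "coord 2 x" "drift_p x" x "drift_q x" ?T] by simp
  moreover have "?Om * ?W = ?Om * residual n x + - (coord 2 x * (1 + ?T^2) + drift_p x * (1 - ?T^2) + 2 * drift_q x * ?T) / 2"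
    unfolding rhs_riccati[OF x, symmetric] residual_def by (simp add: algebra_simps)
  moreover have "- (B / 2) - hc * OW + E = G / 2 - hc * Om * R + E"
    if "B - hc * Q = - G" "OW = Om * R + - Q / 2" for B hc OW E G Om R Q :: real
  proof -
    have B: "B = hc * Q - G" using that(1) by simp
    show ?thesis unfolding B that(2) by (simp add: algebra_simps diff_divide_distrib)
  qed
  ultimately show ?thesis unfolding 1 by blast
qed

section \<open>Quantitative bounds for the gap and its generator\<close>

lemma pull_bounds:
  assumes "x \<in> small_ratio"
  shows "\<bar>pull (wseq n) x\<bar> \<le> 5 * ratio x" (is ?P1) "\<bar>pull (wseq n) x\<bar> \<le> 1 / 20" (is ?P2)
    "\<bar>pull (d1 (wseq n)) x\<bar> \<le> 1 / 5" (is ?P3) "\<bar>pull (d1 (d1 (wseq n))) x\<bar> \<le> 1" (is ?P4)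
    "\<bar>pull (d2 (wseq n)) x\<bar> \<le> 5" (is ?P5) "\<bar>pull (d2 (d2 (wseq n))) x\<bar> \<le> 100" (is ?P6)
    "\<bar>residual n x\<bar> \<le> 2 * (1/2) ^ n" (is ?P7)
    "13 / 8 \<le> slope n x" "slope n x \<le> 9 / 5"
proof -
  have r: "0 \<le> ratio x" "ratio x \<le> 1 / 100" using small_ratioD[OF assms] by auto
  show ?P1
    ?P3 ?P4
    ?P5 ?P6
    ?P7
    unfolding residual_def pull_def
    using wseq_bound[OF r] d1_wseq_bound[OF r] d11_wseq_bound[OF r] d2_wseq_bound[OF r] d22_wseq_bound[OF r] wseq_residual[OF r]
    by auto
  show w: ?P2
    unfolding pull_def by (rule wseq_small[OF r])
  show "13 / 8 \<le> slope n x" "slope n x \<le> 9 / 5"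
    unfolding slope_def using w sqrt3_bounds by linarith+
qed

lemma ratio_bounds:
  assumes x: "x \<in> small_ratio" and M: "1 \<le> M" "1 / M \<le> coord 2 x" "coord 2 x \<le> M"
  shows "\<bar>pd 1 ratio x\<bar> \<le> 2 * M" (is ?P1) "\<bar>pd 2 ratio x\<bar> \<le> 2 * M" (is ?P2)
    "\<bar>pd 1 (pd 1 ratio) x\<bar> \<le> 4 * M^2" (is ?P3) "\<bar>pd 2 (pd 2 ratio) x\<bar> \<le> 4 * M^2" (is ?P4)
    "coord 1 x \<le> 1 / 100 * M" "coord 2 x * ratio x \<le> 101 / 100 * coord 1 x"
proof -
  note p = small_ratioD[OF x]
  let ?a = "coord 1 x" and ?b = "coord 2 x"
  have D: "100 / 101 * ?b \<le> ?b - ?a" using p by simp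
  have Mb: "1 \<le> M * ?b" using M by (simp add: pos_divide_le_eq mult.commute)
  have "(100 / 101 * ?b)^2 \<le> (?b - ?a)^2" using D p by (intro power_mono) auto
  moreover have "1 / 2 * ?b^2 \<le> (100 / 101)^2 * ?b^2"
    by (intro mult_right_mono) (simp_all add: power_divide)
  ultimately have D2: "?b^2 / 2 \<le> (?b - ?a)^2" unfolding power_mult_distrib by linarith
  have "(100 / 101 * ?b) ^ 3 \<le> (?b - ?a) ^ 3" using D p by (intro power_mono) auto
  moreover have "1 / 2 * ?b ^ 3 \<le> (100 / 101) ^ 3 * ?b ^ 3"
    using p by (intro mult_right_mono) (simp_all add: power_divide)
  ultimately have D3: "?b ^ 3 / 2 \<le> (?b - ?a) ^ 3" unfolding power_mult_distrib by linarith
  have pos: "0 < (?b - ?a)^2" "0 < (?b - ?a) ^ 3" using p by auto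
  have "?b \<le> M * ?b * ?b" using mult_right_mono[OF Mb, of ?b] p by simp
  also have "\<dots> = 2 * M * (?b^2 / 2)" by (simp add: power2_eq_square)
  also have "\<dots> \<le> 2 * M * (?b - ?a)^2" using D2 M by (intro mult_left_mono) auto
  finally have 1: "?b / (?b - ?a)^2 \<le> 2 * M" using pos by (simp add: pos_divide_le_eq)
  have "2 * ?b \<le> 2 * ((M * ?b) * (M * ?b)) * ?b"
    using mult_mono[OF Mb Mb] Mb p by (intro mult_right_mono) auto
  also have "\<dots> = 4 * M^2 * (?b ^ 3 / 2)" by (simp add: power2_eq_square power3_eq_cube)
  also have "\<dots> \<le> 4 * M^2 * (?b - ?a) ^ 3" using D3 by (intro mult_left_mono) auto
  finally have 2: "2 * ?b / (?b - ?a) ^ 3 \<le> 4 * M^2" using pos by (simp add: pos_divide_le_eq)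
  have ab: "?a / (?b - ?a)^2 \<le> ?b / (?b - ?a)^2" "2 * ?a / (?b - ?a) ^ 3 \<le> 2 * ?b / (?b - ?a) ^ 3"
    using p pos by (auto intro!: divide_right_mono)
  show ?P1 ?P2
    unfolding pd_ratio[OF x] using 1 ab(1) p pos by (simp_all add: abs_of_pos)
  show ?P3 ?P4
    unfolding pd_pd_ratio[OF x] using 2 ab(2) p pos by (simp_all add: abs_of_pos)
  show "?a \<le> 1 / 100 * M" using p M by simp
  have "?b * ?a \<le> 101 / 100 * ?a * (?b - ?a)"
    using mult_right_mono[OF D, of ?a] p by (simp add: algebra_simps)
  then show "?b * ratio x \<le> 101 / 100 * ?a"
    unfolding ratio_def using p by (simp add: pos_divide_le_eq)
qed

lemma power_M_mono: "M ^ a \<le> M ^ b" if "1 \<le> M" "a \<le> b" for M :: real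
  by (rule power_increasing[OF that(2,1)])

text \<open>Deliberately crude: what counts is uniformity in the iteration index and in T1 <=
  1.\<close>

lemma slow_bound:
  assumes x: "x \<in> small_ratio" and M: "1 \<le> M" "1 / M \<le> coord 2 x" "coord 2 x \<le> M"
    and T: "0 < T1" "T1 \<le> 1" "0 < T3"
  shows "\<bar>slow T1 T3 n x\<bar> \<le> 300 * M ^ 4 * (1 + T3)"
proof -
  note p = small_ratioD[OF x] and o = pull_bounds[OF x, of n] and r = ratio_bounds[OF x M]
  have a: "\<bar>coord 1 x\<bar> \<le> M" "\<bar>coord 2 x\<bar> \<le> M" using p M r by auto
  have a3: "\<bar>coord 1 x ^ 3\<bar> \<le> M ^ 3" "\<bar>coord 2 x ^ 3\<bar> \<le> M ^ 3"
    unfolding power_abs using a by (auto intro!: power_mono)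
  have M1: "1 \<le> M ^ 3" using M by simp
  have S: "\<bar>T1 - coord 1 x ^ 3\<bar> \<le> 2 * M ^ 3" "\<bar>T3 - coord 2 x ^ 3\<bar> \<le> T3 + M ^ 3"
    using a3 T M1 by linarith+
  have d: "\<bar>pull (d2 (wseq n)) x * pd 1 ratio x\<bar> \<le> 5 * (2 * M)" "\<bar>pull (d2 (wseq n)) x * pd 2 ratio x\<bar> \<le> 5 * (2 * M)"
    by (intro abs_mult_mono o r)+
  have sq: "\<bar>(pd 1 ratio x)^2\<bar> \<le> 2 * M * (2 * M)" "\<bar>(pd 2 ratio x)^2\<bar> \<le> 2 * M * (2 * M)"
    unfolding power2_eq_square by (intro abs_mult_mono r)+
  have dd: "\<bar>pull (d2 (d2 (wseq n))) x * (pd 1 ratio x)^2 + pull (d2 (wseq n)) x * pd 1 (pd 1 ratio) x\<bar> \<le> 100 * (2 * M * (2 * M)) + 5 * (4 * M^2)"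
    "\<bar>pull (d2 (d2 (wseq n))) x * (pd 2 ratio x)^2 + pull (d2 (wseq n)) x * pd 2 (pd 2 ratio) x\<bar> \<le> 100 * (2 * M * (2 * M)) + 5 * (4 * M^2)"
    by (intro abs_add_mono abs_mult_mono o r sq)+
  have c: "\<bar>T1 * coord 1 x / 4\<bar> \<le> 1 * M / 4" "\<bar>T3 * coord 2 x / 4\<bar> \<le> T3 * M / 4"
    using abs_mult_mono[of T1 1 "coord 1 x" M] abs_mult_mono[of T3 T3 "coord 2 x" M] T a by auto
  have "\<bar>slow T1 T3 n x\<bar> \<le> 2 * M ^ 3 * (5 * (2 * M)) + (T3 + M ^ 3) * (5 * (2 * M))
     + 1 * M / 4 * (100 * (2 * M * (2 * M)) + 5 * (4 * M^2)) + T3 * M / 4 * (100 * (2 * M * (2 * M)) + 5 * (4 * M^2)) + 1"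
    unfolding slow_def by (intro abs_add_mono abs_mult_mono S d c dd o)
  also have "\<dots> = 30 * M ^ 4 + 10 * (T3 * M) + 105 * M ^ 3 + 105 * (T3 * M ^ 3) + 1"
    by (simp add: algebra_simps power2_eq_square power3_eq_cube power4_eq_xxxx)
  also have "\<dots> \<le> 30 * M ^ 4 + 10 * (T3 * M ^ 4) + 105 * M ^ 4 + 105 * (T3 * M ^ 4) + M ^ 4"
    using power_M_mono[OF M(1), of 1 4] power_M_mono[OF M(1), of 3 4] power_M_mono[OF M(1), of 0 4] T
    by (intro add_mono mult_left_mono) auto
  also have "\<dots> = 136 * M ^ 4 + 115 * (T3 * M ^ 4)" by simp
  also have "\<dots> \<le> 300 * M ^ 4 + 300 * (T3 * M ^ 4)"
    using T M by (intro add_mono mult_right_mono) auto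
  also have "\<dots> = 300 * M ^ 4 * (1 + T3)" by (simp add: algebra_simps)
  finally show ?thesis .
qed

text \<open>The condition on n puts the residual on the scale \<gamma> of the remaining
  corrections.\<close>

lemma gen_b_gap_bound:
  assumes x: "x \<in> small_ratio" and M: "1 \<le> M" "1 / M \<le> coord 2 x" "coord 2 x \<le> M"
    and T: "0 < T1" "T1 \<le> 1" "0 < T3" and g: "0 < \<gamma>" and n: "(1/2) ^ n \<le> \<gamma>"
  shows "\<bar>gen_b \<gamma> T1 T3 (gap n) x - growth n x * gap n x / 2\<bar> \<le> 303 * M ^ 4 * (1 + T3) * \<gamma>"
proof -
  note p = small_ratioD[OF x] and o = pull_bounds[OF x, of n] and h = hsin_hcos[of x]
  let ?E = "- hsin x / 8 - hcos x * slow T1 T3 n x + slope n x * hcos x / 8 - pull (d1 (wseq n)) x * hsin x / 2"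
  have "\<bar>coord 2 x - coord 1 x\<bar> \<le> M" using p M by auto
  then have "\<bar>hcos x * (coord 2 x - coord 1 x) * residual n x\<bar> \<le> 1 * M * (2 * (1/2) ^ n)"
    by (intro abs_mult_mono h o)
  also have "\<dots> \<le> 2 * M * \<gamma>" using n M by simp
  also have "\<dots> \<le> 2 * M ^ 4 * \<gamma>" using power_M_mono[OF M(1), of 1 4] g by simp
  finally have 1: "\<bar>hcos x * (coord 2 x - coord 1 x) * residual n x\<bar> \<le> 2 * M ^ 4 * \<gamma>" .
  have "\<bar>hcos x * slow T1 T3 n x\<bar> \<le> 1 * (300 * M ^ 4 * (1 + T3))"
    by (intro abs_mult_mono h slow_bound x M T)
  moreover have "\<bar>slope n x * hcos x\<bar> \<le> 9 / 5 * 1" "\<bar>pull (d1 (wseq n)) x * hsin x\<bar> \<le> 1 / 5 * 1"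
    using o(8,9) by (intro abs_mult_mono h o; simp)+
  ultimately have "\<bar>?E\<bar> \<le> 300 * M ^ 4 * (1 + T3) + 1" using h(2) by linarith
  then have 2: "\<bar>\<gamma> * ?E\<bar> \<le> \<gamma> * (300 * M ^ 4 * (1 + T3) + 1)" using g by (intro abs_mult_mono) auto
  have "1 \<le> M ^ 4" using M by simp
  then have "2 * M ^ 4 + 1 \<le> 3 * M ^ 4 * (1 + T3)"
    using T by (simp add: algebra_simps) (smt (verit) mult_nonneg_nonneg)
  then have "2 * M ^ 4 * \<gamma> + \<gamma> * (300 * M ^ 4 * (1 + T3) + 1) \<le> 303 * M ^ 4 * (1 + T3) * \<gamma>"
    using mult_right_mono[of "2 * M ^ 4 + 1" "3 * M ^ 4 * (1 + T3)" \<gamma>] g by (simp add: algebra_simps)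
  then show ?thesis
    unfolding gen_b_gap[OF x] using 1 2 by linarith
qed

lemma diff_b_gap_bounds:
  assumes x: "x \<in> small_ratio" and M: "1 \<le> M" "1 / M \<le> coord 2 x" "coord 2 x \<le> M"
    and T: "0 < T1" "T1 \<le> 1" "0 < T3" and g: "0 < \<gamma>"
  shows "0 \<le> diff_b \<gamma> T1 T3 (gap n) (gap n) x"
    "diff_b \<gamma> T1 T3 (gap n) (gap n) x \<le> 303 * M ^ 4 * (1 + T3) * \<gamma>"
    "\<bar>gap n x\<bar> \<le> 1 / 10 \<Longrightarrow> \<gamma> / 4 \<le> diff_b \<gamma> T1 T3 (gap n) (gap n) x"
    "\<bar>pd 1 (gap n) x\<bar> \<le> 10 * M" "\<bar>pd 2 (gap n) x\<bar> \<le> 10 * M"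
proof -
  note p = small_ratioD[OF x] and o = pull_bounds[OF x, of n] and h = hsin_hcos[of x] and r = ratio_bounds[OF x M]
  let ?u = "gap n"
  have "\<bar>pd 1 ?u x\<bar> \<le> 5 * (2 * M) * 1" "\<bar>pd 2 ?u x\<bar> \<le> 5 * (2 * M) * 1" and u3: "\<bar>pd 3 ?u x\<bar> \<le> 1 / 5 * 1"
    unfolding pd_gap[OF x] by (intro abs_mult_mono h r; use o in simp)+
  then show u1: "\<bar>pd 1 ?u x\<bar> \<le> 10 * M" and u2: "\<bar>pd 2 ?u x\<bar> \<le> 10 * M" by auto
  have Wc: "\<bar>pull (d1 (wseq n)) x * hcos x\<bar> \<le> 1 / 5 * 1" by (intro abs_mult_mono h o)
  have "\<bar>slope n x * hsin x\<bar> \<le> 9 / 5 * 1" using o(8,9) by (intro abs_mult_mono h) simp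
  from abs_add_mono[OF h(3) this]
  have "\<bar>(hcos x + slope n x * hsin x) / 2\<bar> \<le> 7 / 5" by simp
  from abs_add_mono[OF this Wc]
  have u4: "\<bar>pd 4 ?u x\<bar> \<le> 2" unfolding pd_gap[OF x] by linarith
  have up: "x \<in> act_pos" using p by (simp add: act_pos_def)
  show "0 \<le> diff_b \<gamma> T1 T3 ?u ?u x" using diff_b_self_nonneg[OF _ _ _ up] g T by simp
  have a: "\<bar>coord 1 x\<bar> \<le> M" "\<bar>coord 2 x\<bar> \<le> M" using p M r by auto
  have "\<bar>T1 * coord 1 x / 2 * pd 1 ?u x * pd 1 ?u x + T3 * coord 2 x / 2 * pd 2 ?u x * pd 2 ?u x
     + pd 3 ?u x * pd 3 ?u x + pd 4 ?u x * pd 4 ?u x\<bar>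
    \<le> 1 * M / 2 * (10 * M) * (10 * M) + T3 * M / 2 * (10 * M) * (10 * M) + 1 / 5 * 1 * (1 / 5 * 1) + 2 * 2"
    using abs_mult_mono[of T1 1 "coord 1 x" M] abs_mult_mono[of T3 T3 "coord 2 x" M] T a
    by (intro abs_add_mono abs_mult_mono u1 u2 u3 u4) auto
  also have "\<dots> \<le> 50 * M ^ 4 + 50 * (T3 * M ^ 4) + 5 * M ^ 4"
  proof -
    have "1 * M / 2 * (10 * M) * (10 * M) = 50 * M ^ 3" "T3 * M / 2 * (10 * M) * (10 * M) = 50 * (T3 * M ^ 3)"
      by (simp_all add: power3_eq_cube)
    moreover have "T3 * M ^ 3 \<le> T3 * M ^ 4" using power_M_mono[OF M(1), of 3 4] T by simp
    moreover have "1 / 5 * 1 * (1 / 5 * 1) + 2 * 2 \<le> (5::real)" by simp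
    ultimately show ?thesis using power_M_mono[OF M(1), of 3 4] power_M_mono[OF M(1), of 0 4] by (simp only: power_0) linarith
  qed
  also have "\<dots> \<le> 303 * M ^ 4 + 303 * (T3 * M ^ 4)"
  proof -
    have "0 \<le> T3 * M ^ 4" "0 \<le> M ^ 4" using T M by auto
    then show ?thesis by linarith
  qed
  also have "\<dots> = 303 * M ^ 4 * (1 + T3)" by (simp add: algebra_simps)
  finally have B: "T1 * coord 1 x / 2 * pd 1 ?u x * pd 1 ?u x + T3 * coord 2 x / 2 * pd 2 ?u x * pd 2 ?u x
     + pd 3 ?u x * pd 3 ?u x + pd 4 ?u x * pd 4 ?u x \<le> 303 * M ^ 4 * (1 + T3)" by linarith
  have "diff_b \<gamma> T1 T3 ?u ?u x = (T1 * coord 1 x / 2 * pd 1 ?u x * pd 1 ?u x + T3 * coord 2 x / 2 * pd 2 ?u x * pd 2 ?u x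
     + pd 3 ?u x * pd 3 ?u x + pd 4 ?u x * pd 4 ?u x) * \<gamma>"
    unfolding diff_b_def by (simp add: algebra_simps)
  then show "diff_b \<gamma> T1 T3 ?u ?u x \<le> 303 * M ^ 4 * (1 + T3) * \<gamma>"
    using mult_right_mono[OF B, of \<gamma>] g by simp
  assume small: "\<bar>?u x\<bar> \<le> 1 / 10"
  let ?T = "slope n x"
  \<comment> \<open>The two linear forms in the half-angle sine and cosine are orthogonal and of
    equal norm. A small gap therefore forces a large \<theta>3-derivative: the transversal noise
    cannot degenerate near the repelling orbit.\<close>
  have id: "(hcos x + ?T * hsin x)^2 + (?u x)^2 = (1 + ?T^2)"
    unfolding gap_def using h(1) by algebra
  have "(?u x)^2 \<le> 1 / 100"
    using abs_mult_mono[OF small small] by (simp add: power2_eq_square)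
  moreover have "(13 / 8)^2 \<le> ?T^2" using o(8) by (intro power_mono) auto
  ultimately have "(9 / 5)^2 \<le> (hcos x + ?T * hsin x)^2" using id by (simp add: power2_eq_square)
  then have "9 / 5 \<le> \<bar>hcos x + ?T * hsin x\<bar>"
    by (metis abs_le_square_iff abs_numeral abs_divide)
  moreover have "1 / 2 \<le> \<bar>A / 2 + B\<bar>" if "9 / 5 \<le> \<bar>A\<bar>" "\<bar>B\<bar> \<le> 1 / 5 * 1" for A B :: real
    using that by linarith
  ultimately have "1 / 2 \<le> \<bar>pd 4 ?u x\<bar>"
    unfolding pd_gap[OF x] using Wc by blast
  then have "1 / 4 \<le> pd 4 ?u x * pd 4 ?u x"
    using mult_mono[of "1/2" "\<bar>pd 4 ?u x\<bar>" "1/2" "\<bar>pd 4 ?u x\<bar>"] by simp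
  from mult_left_mono[OF this, of \<gamma>] g have "\<gamma> / 4 \<le> \<gamma> * pd 4 ?u x * pd 4 ?u x" by simp
  moreover have "0 \<le> \<gamma> * T1 * coord 1 x / 2 * pd 1 ?u x * pd 1 ?u x" "0 \<le> \<gamma> * T3 * coord 2 x / 2 * pd 2 ?u x * pd 2 ?u x"
    "0 \<le> \<gamma> * pd 3 ?u x * pd 3 ?u x"
    using g T p by (simp_all add: mult.assoc)
  ultimately show "\<gamma> / 4 \<le> diff_b \<gamma> T1 T3 ?u ?u x"
    unfolding diff_b_def by linarith
qed

section \<open>Angular Lyapunov function\<close>

text \<open>The weight 2/3 of \<open>cos \<theta>\<^sub>3\<close> makes the right-hand side vanish to second order at the attracting angle.\<close>

lemma stable_potential:
  fixes s c :: real
  assumes sc: "s^2 + c^2 = 1" and X: "X = s + sqrt 3 / 2"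
  shows "X^2 / 2 \<le> 2 * X - 2 / 3 * s * (1 + 2 * c)"
proof -
  let ?r = "sqrt 3 :: real"
  \<comment> \<open>Cosine and sine of the distance to the attracting angle - 2 pi / 3. The
    difference of the two sides then contains the factor 1 - a, which vanishes there to second
    order.\<close>
  define a b where "a = - c / 2 - ?r / 2 * s" and "b = - s / 2 + ?r / 2 * c"
  have r2: "?r^2 = 3" by simp
  have "a^2 + b^2 = (s^2 + c^2) * (1 + ?r^2) / 4"
    unfolding a_def b_def by (simp add: power2_eq_square field_simps)
  then have ab: "a^2 + b^2 = 1" using sc by simp
  have "a^2 \<le> 1" "b^2 \<le> 1" using ab zero_le_power2[of a] zero_le_power2[of b] by linarith+
  then have bnd: "\<bar>a\<bar> \<le> 1" "\<bar>b\<bar> \<le> 1" by (simp_all add: abs_square_le_1)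
  have id: "2 * X - 2 / 3 * s * (1 + 2 * c) - X^2 / 2
      = (1 - a) * (2 / 3 * ?r * (2 + a) - 2 / 3 * b - 1 / 2 + a / 4 + ?r / 4 * b)"
  proof -
    have 1: "2 * s = - ?r * a - b" "2 * c = - a + ?r * b"
      unfolding a_def b_def using r2 by (simp_all add: field_simps power2_eq_square)
    have "24 * (2 * X) - 8 * (2 * s) * (1 + 2 * c) - 3 * (2 * X)^2
        = (1 - a) * (16 * ?r * (2 + a) - 16 * b - 12 + 6 * a + 6 * ?r * b)"
    proof -
      have "2 * X = - ?r * a - b + ?r" using 1 X by simp
      then show ?thesis
        unfolding 1 using ab r2 by (simp only:) algebra
    qed
    then show ?thesis by (simp add: field_simps power2_eq_square)
  qed
  have r: "17 / 10 \<le> ?r" "?r \<le> 7 / 4" by (rule sqrt3_bounds)+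
  define p q where "p = (2 / 3 * ?r + 1 / 4) * a" and "q = (?r / 4 - 2 / 3) * b"
  have "(2 / 3 * ?r + 1 / 4) * (- 1) \<le> p"
    unfolding p_def using bnd by (intro mult_left_mono) auto
  moreover have "\<bar>q\<bar> \<le> 1 / 4 * 1"
    unfolding q_def using r bnd by (intro abs_mult_mono) auto
  moreover have "2 / 3 * ?r * (2 + a) - 2 / 3 * b - 1 / 2 + a / 4 + ?r / 4 * b = 4 / 3 * ?r - 1 / 2 + p + q"
    by (simp add: p_def q_def field_simps)
  moreover have "0 \<le> 4 / 3 * R - 1 / 2 + p + q"
    if "(2 / 3 * R + 1 / 4) * (- 1) \<le> p" "\<bar>q\<bar> \<le> 1 / 4 * 1" "17 / 10 \<le> R" for R p q :: real
    using that unfolding abs_le_iff by argo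
  ultimately have "0 \<le> 2 / 3 * ?r * (2 + a) - 2 / 3 * b - 1 / 2 + a / 4 + ?r / 4 * b"
    using r(1) by presburger
  then have "0 \<le> (1 - a) * (2 / 3 * ?r * (2 + a) - 2 / 3 * b - 1 / 2 + a / 4 + ?r / 4 * b)"
    using bnd by (intro mult_nonneg_nonneg) auto
  then show ?thesis using id by linarith
qed

text \<open>The right side is minus the generator of the angular function: u is the gap,
  \<open>mu\<close> its growth, \<open>G\<close> its carre du champ, and y = u^2 / (u^2 + e) tells
  how far u is outside the smoothing layer. K = 2 D M + 1 makes the adverse Ito term y G / (u^2 + e)
  at most y / (2 M), half of the growth y / M available near the orbit.\<close>

lemma core_inequality:
  fixes I M I1 D K \<sigma> \<gamma> e s c X mu u gu G j :: real
  assumes M: "1 \<le> M" "1 / M \<le> I" "I \<le> M" and I1: "0 \<le> I1" and D: "1 \<le> D" and K: "K = 2 * D * M + 1"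
    and sg: "0 < \<sigma>" "\<sigma> \<le> 1 / 10" and g: "\<gamma> = \<sigma> ^ 4" and e: "e = K * \<gamma>"
    and sc: "s^2 + c^2 = 1" and X: "X = s + sqrt 3 / 2"
    and mu: "\<bar>mu - I * (2 * X)\<bar> \<le> 16 * I1" and gu: "\<bar>gu - mu * u / 2\<bar> \<le> D * \<gamma>"
    and G: "0 \<le> G" "G \<le> D * \<gamma>" and near: "\<bar>u\<bar> \<le> 1 / 10 \<Longrightarrow> \<gamma> / 4 \<le> G" "\<bar>u\<bar> \<le> 1 / 10 \<Longrightarrow> 1 \<le> 2 * X"
    and c1: "I * \<bar>1 + 2 * c\<bar> \<le> 3 * M * \<bar>u\<bar> + 15 * I1" and j: "\<bar>j\<bar> \<le> 2 * I1"
  shows "3 / (64 * K) * X^2 - 50 * I1 - (2 * D + 4 * M * K + 3 * M + 1) * \<sigma>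
    \<le> 2 * u * gu / (u^2 + e) + (e - u^2) * G / (u^2 + e)^2 - 2 / 3 * s * (I * (1 + 2 * c) + j) + \<gamma> / 3 * c"
proof -
  define den where "den = u^2 + e"
  define y where "y = u^2 / den"
  have DM: "1 \<le> D * M" using mult_mono[of 1 D 1 M] D M by simp
  have "M \<le> D * M" using mult_right_mono[OF D, of M] M by simp
  then have K1: "1 \<le> K" "2 * M \<le> K" using M unfolding K by linarith+
  have g0: "0 < \<gamma>" and s2: "\<sigma>^2 \<le> \<sigma>" and s4: "\<gamma> = \<sigma>^2 * \<sigma>^2"
    using sg by (auto simp: g power2_eq_square power4_eq_xxxx mult_left_le_one_le)
  have gs: "\<gamma> \<le> \<sigma>"
  proof -
    have "\<sigma>^2 * \<sigma>^2 \<le> \<sigma>^2 * 1" using s2 sg by (intro mult_left_mono) auto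
    then show ?thesis using s2 s4 by simp
  qed
  have e0: "0 < e" using e K1 g0 by simp
  have den0: "0 < den" unfolding den_def using e0 by (simp add: add_nonneg_pos)
  have y01: "0 \<le> y" "y \<le> 1" and y1: "1 - y = e / den"
    using den0 e0 by (auto simp: y_def den_def field_simps)
  have s1: "\<bar>s\<bar> \<le> 1" "\<bar>c\<bar> \<le> 1"
  proof -
    have "s^2 \<le> 1" "c^2 \<le> 1" using sc zero_le_power2[of s] zero_le_power2[of c] by linarith+
    then show "\<bar>s\<bar> \<le> 1" "\<bar>c\<bar> \<le> 1" by (simp_all add: abs_square_le_1)
  qed
  have Xb: "\<bar>X\<bar> \<le> 2" using s1 sqrt3_bounds unfolding X by (auto simp: abs_le_iff)
  have I0: "0 < I" using M by (smt (verit) divide_pos_pos)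
  have t1: "mu * y - D * \<sigma> \<le> 2 * u * gu / den"
  proof -
    \<comment> \<open>AM-GM: 2 |u| \<sigma>^2 is at most the denominator, so an error D \<gamma> in
      the generator of the gap costs only D \<sigma>^2.\<close>
    have "2 * \<bar>u\<bar> * \<sigma>^2 \<le> \<bar>u\<bar>^2 + (\<sigma>^2)^2" using sum_squares_bound[of "\<bar>u\<bar>" "\<sigma>^2"] by simp
    also have "\<dots> \<le> den"
      using mult_right_mono[OF K1(1), of \<gamma>] g0 s4 by (simp add: den_def e power2_eq_square)
    finally have "2 * \<bar>u\<bar> * \<sigma>^2 \<le> den" .
    from mult_right_mono[OF this, of "D * \<sigma>^2"] have A: "2 * \<bar>u\<bar> * (D * \<gamma>) \<le> den * (D * \<sigma>^2)"
      using D by (simp add: s4 mult_ac)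
    have "\<bar>2 * u * (gu - mu * u / 2)\<bar> \<le> 2 * \<bar>u\<bar> * (D * \<gamma>)"
      using gu by (intro abs_mult_mono) (auto simp: abs_mult)
    moreover have "2 * u * gu = mu * u^2 + 2 * u * (gu - mu * u / 2)" by (simp add: power2_eq_square algebra_simps)
    ultimately have "mu * u^2 - den * (D * \<sigma>^2) \<le> 2 * u * gu" using A by linarith
    then have "(mu * u^2 - den * (D * \<sigma>^2)) / den \<le> 2 * u * gu / den" using den0 by (simp add: divide_right_mono)
    moreover have "(mu * u^2 - den * (D * \<sigma>^2)) / den = mu * y - D * \<sigma>^2" using den0 by (simp add: y_def field_simps)
    moreover have "D * \<sigma>^2 \<le> D * \<sigma>" using s2 D by simp
    ultimately show ?thesis by linarith
  qed
  have t2: "I * (2 * X) * y - 16 * I1 \<le> mu * y"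
  proof -
    have "\<bar>(mu - I * (2 * X)) * y\<bar> \<le> 16 * I1 * 1" using mu y01 by (intro abs_mult_mono) auto
    then show ?thesis by (simp add: left_diff_distrib abs_le_iff)
  qed
  have t3: "2 / 3 * s * (I * (1 + 2 * c) + j) \<le> 2 / 3 * s * (I * (1 + 2 * c)) + 4 / 3 * I1"
  proof -
    have "\<bar>2 / 3 * s\<bar> \<le> 2 / 3" using s1 by (simp add: abs_mult)
    from abs_mult_mono[OF this j] show ?thesis unfolding distrib_left[of "2 / 3 * s"] by linarith
  qed
  have t4: "- \<sigma> \<le> \<gamma> / 3 * c"
  proof -
    have "\<bar>\<gamma> / 3 * c\<bar> \<le> \<gamma> / 3 * 1" using s1 g0 by (intro abs_mult_mono) auto
    then show ?thesis using gs g0 by linarith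
  qed
  have Dy: "(e - u^2) * G / den^2 = (1 - y) * (G / den) - y * (G / den)"
    unfolding y1 unfolding y_def using den0 by (simp add: field_simps power2_eq_square)
  have main: "3 / (64 * K) * X^2 - 20 * I1 - (D + 4 * M * K + 3 * M) * \<sigma>
      \<le> I * (2 * X) * y + (e - u^2) * G / den^2 - 2 / 3 * s * (I * (1 + 2 * c))"
  \<comment> \<open>For |u| >= \<sigma> the smoothing is negligible and
    \<open>stable_potential\<close> decides; for smaller |u| the expansion and the noise at the
    repelling orbit are used.\<close>
  proof (cases "\<sigma>^2 \<le> u^2")
    case True
    then have dl: "\<sigma>^2 \<le> den" using e0 by (simp add: den_def)
    have "e / den \<le> e / \<sigma>^2" using dl sg e0 den0 by (intro divide_left_mono) auto
    also have "\<dots> = K * \<sigma>^2" using sg by (simp add: e g power4_eq_xxxx power2_eq_square)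
    finally have y2: "1 - y \<le> K * \<sigma>" using mult_left_mono[OF s2, of K] K1 unfolding y1 by linarith
    have "\<bar>I * (2 * X) * (1 - y)\<bar> \<le> M * 4 * (K * \<sigma>)"
      using I0 M Xb y01 y2 by (intro abs_mult_mono) auto
    then have A: "I * (2 * X) - 4 * M * K * \<sigma> \<le> I * (2 * X) * y" by (simp add: algebra_simps abs_le_iff)
    have "G / den \<le> D * \<gamma> / \<sigma>^2" using dl sg G by (intro frac_le) auto
    also have "\<dots> = D * \<sigma>^2" using sg by (simp add: g power4_eq_xxxx power2_eq_square)
    finally have "G / den \<le> D * \<sigma>" using mult_left_mono[OF s2, of D] D by linarith
    moreover have Gd: "0 \<le> G / den" using G den0 by simp
    moreover have "0 \<le> (1 - y) * (G / den)" by (rule mult_nonneg_nonneg[OF _ Gd]) (use y01 in simp)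
    moreover have "y * (G / den) \<le> G / den" by (rule mult_left_le_one_le[OF Gd y01])
    ultimately have B: "- (D * \<sigma>) \<le> (e - u^2) * G / den^2" unfolding Dy by linarith
    have "3 / (64 * K) * X^2 \<le> 1 / (2 * M) * X^2"
    proof (rule mult_right_mono)
      have "3 * (2 * M) \<le> 1 * (64 * K)" using K1 M by linarith
      then show "3 / (64 * K) \<le> 1 / (2 * M)" using K1 M by (simp add: frac_le_eq divide_simps)
    qed simp
    also have "\<dots> = 1 / M * (X^2 / 2)" by simp
    also have "\<dots> \<le> I * (X^2 / 2)" using M by (intro mult_right_mono) auto
    also have "\<dots> \<le> I * (2 * X - 2 / 3 * s * (1 + 2 * c))"
      using I0 by (intro mult_left_mono stable_potential sc X) auto
    finally have "3 / (64 * K) * X^2 \<le> I * (2 * X) - 2 / 3 * s * (I * (1 + 2 * c))" by (simp add: algebra_simps)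
    moreover have "0 \<le> 3 * M * \<sigma>" using M sg by simp
    ultimately show ?thesis using A B I1 by (simp add: algebra_simps)
  next
    case False
    then have "\<bar>u\<bar> \<le> \<sigma>" using sg by (metis abs_le_square_iff abs_of_pos linear)
    then have u: "\<bar>u\<bar> \<le> 1 / 10" "\<bar>u\<bar> \<le> \<sigma>" using sg by auto
    have A: "1 / M * y \<le> I * (2 * X) * y"
      using mult_mono[of "1/M" I 1 "2 * X"] M near(2)[OF u(1)] y01 I0 by (intro mult_right_mono) auto
    have "y * (G / den) \<le> y * (D / K)"
    proof (intro mult_left_mono y01)
      have "G / den \<le> D * \<gamma> / e" using G e0 by (intro frac_le) (auto simp: den_def)
      then show "G / den \<le> D / K" using g0 by (simp add: e)
    qed
    also have "\<dots> \<le> y * (1 / (2 * M))"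
      using K1 M D by (intro mult_left_mono y01) (simp add: K divide_simps)
    finally have B: "y * (G / den) \<le> 1 / (2 * M) * y" by simp
    have "(1 - y) * (1 / (4 * K)) * (1 - y) \<le> (1 - y) * (G / den)"
    proof -
      have "1 / (4 * K) * (1 - y) = \<gamma> / 4 / den" using g0 K1 unfolding y1 e by (simp add: field_simps)
      also have "\<dots> \<le> G / den" using near(1)[OF u(1)] den0 by (intro divide_right_mono) auto
      finally show ?thesis unfolding mult.assoc by (rule mult_left_mono) (use y01 in simp)
    qed
    moreover have "1 / (4 * K) * y \<le> 1 / (2 * M) * y"
      using K1 M by (intro mult_right_mono y01) (simp add: frac_le)
    \<comment> \<open>Noise is effective at y = 0 and expansion at y = 1; since (1 - y)^2 + y >=
      3/4, their sum is effective throughout.\<close>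
    moreover have "3 / (16 * K) \<le> (1 - y) * (1 / (4 * K)) * (1 - y) + 1 / (4 * K) * y"
    proof -
      have "3 / 4 \<le> (1 - y) * (1 - y) + y"
        using zero_le_power2[of "y - 1 / 2"] by (simp add: power2_eq_square algebra_simps)
      from mult_left_mono[OF this, of "1 / (4 * K)"] K1
      have "1 / (4 * K) * (3 / 4) \<le> 1 / (4 * K) * ((1 - y) * (1 - y) + y)" by simp
      moreover have "(1 - y) * (1 / (4 * K)) * (1 - y) + 1 / (4 * K) * y = 1 / (4 * K) * ((1 - y) * (1 - y) + y)"
        by (simp only: distrib_left mult_ac)
      ultimately show ?thesis by simp
    qed
    moreover have "3 / (64 * K) * X^2 \<le> 3 / (16 * K)"
    proof -
      have "X^2 \<le> 4" using abs_mult_mono[OF Xb Xb] by (simp add: power2_eq_square)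
      from mult_left_mono[OF this, of "3 / (64 * K)"] K1 show ?thesis by simp
    qed
    moreover have "1 / M * y = 1 / (2 * M) * y + 1 / (2 * M) * y" by simp
    moreover have "z \<le> x + (a - b)" if "c \<le> a" "d \<le> h" "f \<le> c + d" "z \<le> f" "k = h + h" "k \<le> x" "b \<le> h"
      for a b c d f h k x z :: real
      using that by linarith
    ultimately have C: "3 / (64 * K) * X^2 \<le> I * (2 * X) * y + (e - u^2) * G / den^2"
      unfolding Dy using A B by blast
    \<comment> \<open>The cosine correction is only an error here, small because the unperturbed
      drift of \<theta>3 vanishes at the repelling angle as well.\<close>
    have "3 * M * \<bar>u\<bar> \<le> 3 * M * \<sigma>" using u(2) M by (intro mult_left_mono) auto
    then have "\<bar>I * (1 + 2 * c)\<bar> \<le> 3 * M * \<sigma> + 15 * I1"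
      unfolding abs_mult using c1 I0 by simp
    moreover have "\<bar>2 / 3 * s\<bar> \<le> 1" using s1 by (simp add: abs_mult)
    ultimately have "\<bar>2 / 3 * s * (I * (1 + 2 * c))\<bar> \<le> 3 * M * \<sigma> + 15 * I1"
      using abs_mult_mono[of "2 / 3 * s" 1 "I * (1 + 2 * c)" "3 * M * \<sigma> + 15 * I1"] by simp
    moreover have "0 \<le> (D + 4 * M * K) * \<sigma>" using D M K1 sg by simp
    moreover have "(D + 4 * M * K + 3 * M) * \<sigma> = (D + 4 * M * K) * \<sigma> + 3 * M * \<sigma>"
      by (simp only: distrib_right)
    moreover have "a - 20 * I1 - w \<le> b - Z" if "a \<le> b" "\<bar>Z\<bar> \<le> m + 15 * I1" "0 \<le> k" "w = k + m"
      for a b k m w Z :: real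
      using that I1 by linarith
    ultimately show ?thesis using C by blast
  qed
  have "(2 * D + 4 * M * K + 3 * M + 1) * \<sigma> = D * \<sigma> + (D + 4 * M * K + 3 * M) * \<sigma> + \<sigma>"
    by (simp add: algebra_simps)
  moreover have "z - 50 * I1 - S \<le> A + B - Z' + h"
    if "z - 20 * I1 - R \<le> p + B - Z" "p - 16 * I1 \<le> q" "q - E \<le> A" "Z' \<le> Z + 4 / 3 * I1" "- \<sigma> \<le> h"
      "S = E + R + \<sigma>"
    for z S A B Z Z' h R p q E :: real
    using that I1 by linarith
  ultimately show ?thesis
    using main t1 t2 t3 t4 unfolding den_def[symmetric] by blast
qed

text \<open>Sines are compared and not angles, because \<open>h_obs\<close> sees nothing else of
  \<theta>3; the second zero, at - pi / 3, therefore does no harm.\<close>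

definition dev :: "st \<Rightarrow> real" where
  "dev x = sin (coord 4 x) + sqrt 3 / 2"

lemma growth_approx:
  assumes x: "x \<in> small_ratio"
  shows "\<bar>growth n x - coord 2 x * (2 * dev x)\<bar> \<le> 16 * coord 1 x"
proof -
  note p = small_ratioD[OF x] and o = pull_bounds[OF x, of n]
  let ?I = "coord 2 x" and ?J = "coord 1 x" and ?s = "sin (coord 4 x)" and ?c = "cos (coord 4 x)"
    and ?w = "pull (wseq n) x" and ?cp = "cos (phase x)" and ?sp = "sin (phase x)"
  have w: "?I * \<bar>?w\<bar> \<le> ?I * (5 * ratio x)" using o(1) p by (intro mult_left_mono) auto
  have "?I * ?J \<le> 6 / 5 * ?J * (?I - ?J)"
    using mult_right_mono[of "?I" "6 / 5 * (?I - ?J)" ?J] p by (simp add: mult_ac)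
  then have "?I * ratio x \<le> 6 / 5 * ?J" unfolding ratio_def using p by (simp add: pos_divide_le_eq)
  then have "?I * (5 * ratio x) \<le> 6 * ?J" by simp
  with w have "?I * \<bar>?w\<bar> \<le> 6 * ?J" by (rule order_trans)
  then have Iw: "\<bar>?I * ?w\<bar> \<le> 6 * ?J" using p by (simp add: abs_mult)
  have "growth n x - ?I * (2 * dev x) = 2 * ?J * (?cp * ?s) + 2 * ?J * (?sp * ?c) + 2 * ?J * ?sp + ?I * ?w + 2 * ?J * (?cp * slope n x)"
    unfolding growth_def drift_p_def drift_q_def dev_def slope_def by (simp add: algebra_simps)
  also have "\<bar>\<dots>\<bar> \<le> 2 * ?J * (1 * 1) + 2 * ?J * (1 * 1) + 2 * ?J * 1 + 6 * ?J + 2 * ?J * (1 * (9 / 5))"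
    by (intro Iw abs_add_mono abs_mult_mono) (use p o in auto)
  also have "\<dots> \<le> 16 * ?J" using p by simp
  finally show ?thesis .
qed

text \<open>On the zero set of the gap, sin \<theta>3 equals twice the slope times the squared
  half-angle cosine, hence is nonnegative, and \<open>dev\<close> is at least sqrt 3 / 2. The
  tolerance 1/10 costs little of this.\<close>

lemma near_unstable:
  assumes x: "x \<in> small_ratio" and u: "\<bar>gap n x\<bar> \<le> 1 / 10"
  shows "1 \<le> 2 * dev x"
proof -
  note o = pull_bounds[OF x, of n] and h = hsin_hcos[of x]
  have S: "hsin x = slope n x * hcos x + gap n x" by (simp add: gap_def)
  have "2 * dev x = 4 * (slope n x * (hcos x)^2) + 4 * (gap n x * hcos x) + sqrt 3"
    unfolding dev_def h(4) S by (simp add: power2_eq_square algebra_simps)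
  moreover have "0 \<le> slope n x * (hcos x)^2" using o(8) by simp
  moreover have "\<bar>gap n x * hcos x\<bar> \<le> 1 / 10 * 1" by (intro abs_mult_mono u h)
  ultimately show ?thesis using sqrt3_bounds(1) by linarith
qed

text \<open>With S and C the half-angle sine and cosine, 1 + 2 cos \<theta>3 = (sqrt 3 C - S) (sqrt
  3 C + S), one factor for each equilibrium of the unperturbed drift. The first factor is minus the
  gap up to the orbit correction.\<close>

lemma drift_near_equilibria:
  assumes x: "x \<in> small_ratio" and M: "1 \<le> M" "1 / M \<le> coord 2 x" "coord 2 x \<le> M"
  shows "coord 2 x * \<bar>1 + 2 * cos (coord 4 x)\<bar> \<le> 3 * M * \<bar>gap n x\<bar> + 15 * coord 1 x"
proof -
  note p = small_ratioD[OF x] and o = pull_bounds[OF x, of n] and h = hsin_hcos[of x]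
  let ?w = "pull (wseq n) x" and ?I = "coord 2 x" and ?u = "gap n x"
  have "1 + 2 * cos (coord 4 x) = 3 * (hcos x)^2 - (hsin x)^2" unfolding h(5) using h(1) by simp
  also have "\<dots> = (sqrt 3 * hcos x)^2 - (hsin x)^2" by (simp add: power_mult_distrib)
  also have "\<dots> = (sqrt 3 * hcos x - hsin x) * (sqrt 3 * hcos x + hsin x)"
    by (simp add: power2_eq_square algebra_simps)
  also have "sqrt 3 * hcos x - hsin x = - ?u + - ?w * hcos x"
    by (simp add: gap_def slope_def algebra_simps)
  also have "\<bar>(- ?u + - ?w * hcos x) * (sqrt 3 * hcos x + hsin x)\<bar> \<le> (\<bar>?u\<bar> + 5 * ratio x * 1) * (7 / 4 * 1 + 1)"
    using sqrt3_bounds o(1) by (intro abs_mult_mono abs_add_mono h) auto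
  finally have "?I * \<bar>1 + 2 * cos (coord 4 x)\<bar> \<le> ?I * ((\<bar>?u\<bar> + 5 * ratio x * 1) * (7 / 4 * 1 + 1))"
    using p by (intro mult_left_mono) auto
  also have "\<dots> = 11 / 4 * (?I * \<bar>?u\<bar>) + 55 / 4 * (?I * ratio x)" by (simp add: algebra_simps)
  also have "?I * \<bar>?u\<bar> \<le> M * \<bar>?u\<bar>" using M by (intro mult_right_mono) auto
  also have "?I * ratio x \<le> 101 / 100 * coord 1 x" by (rule ratio_bounds[OF x M])
  finally have "?I * \<bar>1 + 2 * cos (coord 4 x)\<bar> \<le> 11 / 4 * (M * \<bar>?u\<bar>) + 55 / 4 * (101 / 100 * coord 1 x)" by simp
  moreover have "0 \<le> M * \<bar>?u\<bar>" using M by simp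
  ultimately show ?thesis using p by (simp add: mult.assoc)
qed

lemma gap_periodic:
  "x \<in> small_ratio \<Longrightarrow> gap n (upd 3 x (coord 3 x + 2 * pi)) = gap n x"
  "x \<in> small_ratio \<Longrightarrow> gap n (upd 4 x (coord 4 x + 2 * pi)) = - gap n x"
proof -
  have ph: "phase (upd 3 x (coord 3 x + 2 * pi)) = phase x + of_int 1 * (2 * pi)"
    "phase (upd 4 x (coord 4 x + 2 * pi)) = phase x + of_int (- 1) * (2 * pi)"
    by (simp_all add: phase_def coord_upd)
  have ra: "ratio (upd 3 x t) = ratio x" "ratio (upd 4 x t) = ratio x" for t
    by (simp_all add: ratio_def coord_upd)
  have sl: "slope n (upd 3 x (coord 3 x + 2 * pi)) = slope n x" "slope n (upd 4 x (coord 4 x + 2 * pi)) = slope n x"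
    unfolding slope_def pull_def ph ra TP_periodic[OF TP_wseq] by simp_all
  have h: "hsin (upd 3 x t) = hsin x" "hcos (upd 3 x t) = hcos x" for t
    by (simp_all add: hsin_def hcos_def coord_upd)
  have h4: "hsin (upd 4 x (coord 4 x + 2 * pi)) = - hsin x" "hcos (upd 4 x (coord 4 x + 2 * pi)) = - hcos x"
    by (simp_all add: hsin_def hcos_def coord_upd add_divide_distrib)
  show "gap n (upd 3 x (coord 3 x + 2 * pi)) = gap n x"
    "gap n (upd 4 x (coord 4 x + 2 * pi)) = - gap n x"
    unfolding gap_def sl h h4 by simp_all
qed

lemma gap_bound: "x \<in> small_ratio \<Longrightarrow> (gap n x)^2 \<le> 8"
proof -
  assume x: "x \<in> small_ratio"
  have "\<bar>hsin x + - slope n x * hcos x\<bar> \<le> 1 + 9 / 5 * 1"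
    using pull_bounds(8,9)[OF x, of n] by (intro abs_add_mono abs_mult_mono hsin_hcos) auto
  from abs_mult_mono[OF this this] show ?thesis
    unfolding gap_def power2_eq_square by (simp add: abs_mult_self_eq)
qed

lemma log_barrier_DERIV:
  fixes e s :: real
  assumes "0 < e"
  shows "((\<lambda>s. - ln (s^2 + e)) has_real_derivative - 2 * s / (s^2 + e)) (at s)" (is ?P1)
    and "((\<lambda>s. - 2 * s / (s^2 + e)) has_real_derivative - 2 * (e - s^2) / (s^2 + e)^2) (at s)" (is ?P2)
proof -
  have pos: "0 < s^2 + e" using assms by (simp add: add_nonneg_pos)
  show ?P1
    using pos by (auto intro!: derivative_eq_intros)
  have "((\<lambda>s. s^2 + e) has_real_derivative 2 * s) (at s)"
    by (auto intro!: derivative_eq_intros)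
  moreover have "((\<lambda>s. - 2 * s) has_real_derivative - 2) (at s)"
    by (auto intro!: derivative_eq_intros)
  ultimately have "((\<lambda>s. - 2 * s / (s^2 + e)) has_real_derivative
      (- 2 * (s^2 + e) - - 2 * s * (2 * s)) / ((s^2 + e) * (s^2 + e))) (at s)"
    using DERIV_divide[of "\<lambda>s. - 2 * s" "- 2" s UNIV "\<lambda>s. s^2 + e" "2 * s"] pos by simp
  then show ?P2
    by (rule DERIV_cong) (simp add: power2_eq_square algebra_simps)
qed

lemma log_barrier_continuous: "0 < e \<Longrightarrow> continuous_on UNIV (\<lambda>s::real. - 2 * (e - s^2) / (s^2 + e)^2)"
  by (intro continuous_intros) (auto simp: add_nonneg_pos[THEN less_imp_neq, THEN not_sym])

lemma cos_DERIVs: "(cos has_real_derivative - sin s) (at s)" "((\<lambda>s. - sin s) has_real_derivative - cos s) (at s)"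
  "continuous_on UNIV (\<lambda>s::real. - cos s)" for s :: real
  by (auto intro!: derivative_eq_intros continuous_on_minus continuous_on_cos continuous_on_id)

text \<open>The drift bound is the core inequality with its sign reversed. The size bounds by 1 /
  \<sigma>^2 are generous for a logarithm, but localisation multiplies them by \<gamma> =
  \<sigma>^4.\<close>

lemma angular_lyapunov_step:
  fixes T3 M :: real
  assumes T3: "0 < T3" and M: "1 \<le> M" and D: "D = 303 * M ^ 4 * (1 + T3)" and K: "K = 2 * D * M + 1"
    and sg: "0 < \<sigma>" "\<sigma> \<le> 1 / 10" and T1: "0 < T1" "T1 \<le> 1" and n: "(1/2) ^ n \<le> \<sigma> ^ 4"
    and F: "F = (\<lambda>x. - ln ((gap n x)^2 + K * \<sigma> ^ 4) + 2 / 3 * cos (coord 4 x))"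
  shows "C2_on small_ratio F"
    and "x \<in> small_ratio \<Longrightarrow> F (upd 3 x (coord 3 x + 2 * pi)) = F x \<and> F (upd 4 x (coord 4 x + 2 * pi)) = F x" (is "_ \<Longrightarrow> ?P1")
    and "x \<in> small_ratio \<Longrightarrow> 1 / M \<le> coord 2 x \<Longrightarrow> coord 2 x \<le> M \<Longrightarrow>
      gen_b (\<sigma> ^ 4) T1 T3 F x \<le> - (3 / (64 * K) * (dev x)^2) + 50 * coord 1 x + (2 * D + 4 * M * K + 3 * M + 1) * \<sigma>" (is "_ \<Longrightarrow> _ \<Longrightarrow> _ \<Longrightarrow> ?P2")
    and "x \<in> small_ratio \<Longrightarrow> \<bar>F x\<bar> \<le> (11 + K) / \<sigma>^2" (is "_ \<Longrightarrow> ?P3")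
    and "x \<in> small_ratio \<Longrightarrow> 1 / M \<le> coord 2 x \<Longrightarrow> coord 2 x \<le> M \<Longrightarrow>
      \<bar>pd 1 F x\<bar> \<le> 10 * M / \<sigma>^2 \<and> \<bar>pd 2 F x\<bar> \<le> 10 * M / \<sigma>^2" (is "_ \<Longrightarrow> _ \<Longrightarrow> _ \<Longrightarrow> ?P4")
proof -
  define \<gamma> e where "\<gamma> = \<sigma> ^ 4" and "e = K * \<gamma>"
  let ?u = "gap n"
  have D1: "1 \<le> D"
  proof -
    have "1 \<le> M ^ 4" using M by simp
    then have "1 * 1 \<le> (303 * M ^ 4) * (1 + T3)" using T3 by (intro mult_mono) linarith+
    then show ?thesis by (simp add: D)
  qed
  have K1: "1 \<le> K" using D1 M by (simp add: K)
  have g0: "0 < \<gamma>" and e0: "0 < e" using sg K1 by (auto simp: \<gamma>_def e_def)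
  define v where "v = (\<lambda>x. - ln ((?u x)^2 + e))"
  have Fv: "F = (\<lambda>x. v x + 2 / 3 * cos (coord 4 x))" by (simp add: F v_def e_def \<gamma>_def)
  note L = log_barrier_DERIV[OF e0] log_barrier_continuous[OF e0]
  have v2: "C2_on small_ratio v"
    unfolding v_def by (rule C2_on_comp[OF open_small_ratio C2_on_gap _ L]) auto
  have c2: "C2_on S (\<lambda>x. cos (coord 4 x))" for S by (rule coord4_comp(1)[OF cos_DERIVs])
  have c2': "C2_on small_ratio (\<lambda>x. 2 / 3 * cos (coord 4 x))"
    by (intro C2_on_cmult c2 open_small_ratio)
  show "C2_on small_ratio F"
    unfolding Fv by (intro C2_on_add open_small_ratio v2 c2')
  show ?P1 if x: "x \<in> small_ratio"
    unfolding F gap_periodic[OF x] by (simp add: coord_upd)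
  have den: "2 * \<bar>?u x\<bar> * \<sigma>^2 \<le> (?u x)^2 + e" for x
  proof -
    have "2 * \<bar>?u x\<bar> * \<sigma>^2 \<le> \<bar>?u x\<bar>^2 + (\<sigma>^2)^2" using sum_squares_bound[of "\<bar>?u x\<bar>" "\<sigma>^2"] by simp
    also have "\<dots> \<le> (?u x)^2 + e"
      using mult_right_mono[OF K1, of \<gamma>] g0 by (simp add: e_def \<gamma>_def power_mult[symmetric])
    finally show ?thesis .
  qed
  have den0: "0 < (?u x)^2 + e" for x using e0 by (simp add: add_nonneg_pos)
  show ?P2
    if x: "x \<in> small_ratio" and I: "1 / M \<le> coord 2 x" "coord 2 x \<le> M"
  proof -
    let ?G = "diff_b \<gamma> T1 T3 ?u ?u x" and ?gu = "gen_b \<gamma> T1 T3 ?u x"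
    have E1: "- 2 * u / d * r + (1/2) * (- 2 * w / d') * q = - (2 * u * r / d + w * q / d')" for u d r w d' q :: real
      by simp
    have E2: "2 / 3 * (- q * (- r) + \<gamma> / 2 * (- w)) = 2 / 3 * r * q - \<gamma> / 3 * w" for r w q :: real
      by (simp add: field_simps)
    have E3: "- (u + w) + (q - r) = - (u + w - q + r)" for u r w q :: real
      by simp
    have "gen_b \<gamma> T1 T3 v x = - 2 * ?u x / ((?u x)^2 + e) * ?gu + (1/2) * (- 2 * (e - (?u x)^2) / ((?u x)^2 + e)^2) * ?G"
      unfolding v_def by (rule gen_b_comp[OF open_small_ratio C2_on_gap _ L x]) auto
    note gv = this[unfolded E1]
    have gc: "gen_b \<gamma> T1 T3 (\<lambda>x. 2 / 3 * cos (coord 4 x)) x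
      = 2 / 3 * sin (coord 4 x) * (coord 2 x * (1 + 2 * cos (coord 4 x)) + 2 * coord 1 x * cos (coord 3 x)) - \<gamma> / 3 * cos (coord 4 x)"
      unfolding gen_b_cmult[OF open_small_ratio c2 x] coord4_comp(2)[OF cos_DERIVs] by (rule E2)
    have "gen_b \<gamma> T1 T3 F x = gen_b \<gamma> T1 T3 v x + gen_b \<gamma> T1 T3 (\<lambda>x. 2 / 3 * cos (coord 4 x)) x"
      unfolding Fv by (rule gen_b_add[OF open_small_ratio v2 c2' x])
    then have gF: "gen_b \<gamma> T1 T3 F x = - (2 * ?u x * ?gu / ((?u x)^2 + e) + (e - (?u x)^2) * ?G / ((?u x)^2 + e)^2
        - 2 / 3 * sin (coord 4 x) * (coord 2 x * (1 + 2 * cos (coord 4 x)) + 2 * coord 1 x * cos (coord 3 x)) + \<gamma> / 3 * cos (coord 4 x))"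
      unfolding gv gc E3 .
    have "3 / (64 * K) * (dev x)^2 - 50 * coord 1 x - (2 * D + 4 * M * K + 3 * M + 1) * \<sigma>
      \<le> 2 * ?u x * ?gu / ((?u x)^2 + e) + (e - (?u x)^2) * ?G / ((?u x)^2 + e)^2
        - 2 / 3 * sin (coord 4 x) * (coord 2 x * (1 + 2 * cos (coord 4 x)) + 2 * coord 1 x * cos (coord 3 x)) + \<gamma> / 3 * cos (coord 4 x)"
    proof (rule core_inequality[where mu="growth n x" and \<gamma>=\<gamma>, OF M I _ D1 K sg \<gamma>_def e_def _ dev_def growth_approx[OF x]])
      show "\<bar>?gu - growth n x * ?u x / 2\<bar> \<le> D * \<gamma>"
        unfolding D by (rule gen_b_gap_bound[OF x M I T1 T3 g0]) (use n in \<open>simp add: \<gamma>_def\<close>)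
      show "0 \<le> ?G" "?G \<le> D * \<gamma>" "\<bar>?u x\<bar> \<le> 1 / 10 \<Longrightarrow> \<gamma> / 4 \<le> ?G"
        unfolding D using diff_b_gap_bounds[OF x M I T1 T3 g0, of n] by auto
      show "\<bar>2 * coord 1 x * cos (coord 3 x)\<bar> \<le> 2 * coord 1 x"
        using small_ratioD[OF x] by (simp add: abs_mult mult_left_le)
      show "0 \<le> coord 1 x" using small_ratioD[OF x] by simp
    qed (use near_unstable[OF x] drift_near_equilibria[OF x M I] in auto)
    moreover have "- z \<le> - a + b + c" if "a - b - c \<le> z" for a b c z :: real using that by linarith
    ultimately show ?thesis unfolding gF[folded \<gamma>_def] \<gamma>_def[symmetric] by blast
  qed
  show ?P3 if x: "x \<in> small_ratio"
  proof -
    have "\<sigma>^2 \<le> 1" using sg by (simp add: power_le_one)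
    then have s2: "1 \<le> 1 / \<sigma>^2" using sg by simp
    have "\<gamma> \<le> 1" using sg by (simp add: \<gamma>_def power_le_one)
    then have eK: "e \<le> K" using K1 by (simp add: e_def mult_left_le)
    have "ln ((?u x)^2 + e) \<le> (?u x)^2 + e" using ln_le_minus_one[OF den0[of x]] by simp
    then have "ln ((?u x)^2 + e) \<le> (8 + K) * 1"
      using gap_bound[OF x, of n] eK by simp
    also have "\<dots> \<le> (8 + K) * (1 / \<sigma>^2)"
      using K1 by (intro mult_left_mono s2) simp
    finally have up: "ln ((?u x)^2 + e) \<le> (8 + K) * (1 / \<sigma>^2)" .
    have "\<gamma> \<le> (?u x)^2 + e" using mult_right_mono[OF K1, of \<gamma>] g0 by (simp add: e_def add_increasing)
    then have "ln \<gamma> \<le> ln ((?u x)^2 + e)" using g0 den0 by simp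
    moreover have "ln \<gamma> = - 2 * ln (1 / \<sigma>^2)" using sg by (simp add: \<gamma>_def ln_div ln_realpow)
    moreover have "ln (1 / \<sigma>^2) \<le> 1 / \<sigma>^2" using ln_le_minus_one[of "1 / \<sigma>^2"] sg by simp
    ultimately have lo: "- (2 * (1 / \<sigma>^2)) \<le> ln ((?u x)^2 + e)" by linarith
    have "\<bar>v x\<bar> \<le> (10 + K) * (1 / \<sigma>^2)"
    proof -
      have "\<bar>- l\<bar> \<le> (10 + K) * r" if "l \<le> (8 + K) * r" "- (2 * r) \<le> l" "1 \<le> r" for l r
      proof -
        have "0 \<le> K * r" using K1 that by simp
        then show ?thesis using that unfolding distrib_right by linarith
      qed
      from this[OF up lo s2] show ?thesis unfolding v_def .
    qed
    moreover have "\<bar>2 / 3 * cos (coord 4 x)\<bar> \<le> 1" using abs_mult_mono[of "2/3" "2/3" "cos (coord 4 x)" 1] by simp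
    ultimately have "\<bar>F x\<bar> \<le> (10 + K) * (1 / \<sigma>^2) + 1 / \<sigma>^2" unfolding Fv using s2 by linarith
    then show ?thesis by (simp add: add_divide_distrib)
  qed
  show ?P4
    if x: "x \<in> small_ratio" and I: "1 / M \<le> coord 2 x" "coord 2 x \<le> M"
  proof -
    have z: "pd 1 (\<lambda>x. 2 / 3 * cos (coord 4 x)) x = 0" "pd 2 (\<lambda>x. 2 / 3 * cos (coord 4 x)) x = 0"
      using pd_mult[OF C1_on_const[of _ "2/3"] C2_on_C1[OF c2] x, where i=1] pd_mult[OF C1_on_const[of _ "2/3"] C2_on_C1[OF c2] x, where i=2]
      by (simp_all only: coord4_comp(3,4)[OF cos_DERIVs] pd_const)
    have q: "\<bar>- 2 * ?u x / ((?u x)^2 + e)\<bar> \<le> 1 / \<sigma>^2"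
      using den[of x] den0[of x] sg by (simp add: abs_mult field_simps)
    have "pd i F x = - 2 * ?u x / ((?u x)^2 + e) * pd i ?u x + pd i (\<lambda>x. 2 / 3 * cos (coord 4 x)) x" for i
    proof -
      have "pd i F x = pd i v x + pd i (\<lambda>x. 2 / 3 * cos (coord 4 x)) x"
        unfolding Fv by (rule pd_add[OF C2_on_C1[OF v2] C2_on_C1[OF c2'] x])
      moreover have "pd i v x = - 2 * ?u x / ((?u x)^2 + e) * pd i ?u x"
        unfolding v_def by (rule pd_comp[OF C2_on_C1[OF C2_on_gap] x L(1)])
      ultimately show ?thesis by simp
    qed
    then have "\<bar>pd i F x\<bar> \<le> 1 / \<sigma>^2 * (10 * M)" if "i = 1 \<or> i = 2" for i
      using that z abs_mult_mono[OF q, of "pd i ?u x" "10 * M"] diff_b_gap_bounds(4,5)[OF x M I T1 T3 g0, of n] by auto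
    from this[of 1] this[of 2] show ?thesis by simp
  qed
qed

section \<open>Localisation\<close>

lemma coord12_comp:
  fixes v v' v'' :: "real \<Rightarrow> real"
  assumes i: "i = 1 \<or> i = 2"
    and v': "\<And>s. 0 < s \<Longrightarrow> (v has_real_derivative v' s) (at s)"
    and v'': "\<And>s. 0 < s \<Longrightarrow> (v' has_real_derivative v'' s) (at s)" and c: "continuous_on {0<..} v''"
  shows "C2_on act_pos (\<lambda>x. v (coord i x))" (is ?P1)
    and "x \<in> act_pos \<Longrightarrow> gen_b \<gamma> T1 T3 (\<lambda>x. v (coord i x)) x =
      \<gamma> * ((if i = 1 then T1 else T3) - coord i x ^ 3) * v' (coord i x)
      + \<gamma> * (if i = 1 then T1 else T3) * coord i x / 4 * v'' (coord i x)" (is "_ \<Longrightarrow> ?P2")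
    and "x \<in> act_pos \<Longrightarrow> pd j (\<lambda>x. v (coord i x)) x = (if j = i then v' (coord i x) else 0)" (is "_ \<Longrightarrow> ?P3")
proof -
  have J: "coord i x \<in> {0<..}" if "x \<in> act_pos" for x using that i by (auto simp: act_pos_def)
  show ?P1
    by (rule C2_on_comp[OF open_act_pos C2_on_coord J]) (use v' v'' c in auto)
  assume x: "x \<in> act_pos"
  have "gen_b \<gamma> T1 T3 (\<lambda>x. v (coord i x)) x = v' (coord i x) * gen_b \<gamma> T1 T3 (coord i) x
      + (1/2) * v'' (coord i x) * diff_b \<gamma> T1 T3 (coord i) (coord i) x"
    by (rule gen_b_comp[OF open_act_pos C2_on_coord J _ _ c x]) (use v' v'' in auto)
  then show ?P2
    using i by (auto simp: gen_b_alt[of _ _ _ "coord i"] diff_b_def pd_coord)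
  have "pd j (\<lambda>x. v (coord i x)) x = v' (coord i x) * pd j (coord i) x"
    by (rule pd_comp[OF C2_on_C1[OF C2_on_coord] x]) (use J[OF x] v' in auto)
  then show ?P3
    using i by (auto simp: pd_coord)
qed

lemma inverse_DERIVs:
  fixes s :: real assumes "0 < s"
  shows "((\<lambda>s. s + inverse s) has_real_derivative 1 - inverse (s^2)) (at s)"
    "((\<lambda>s. 1 - inverse (s^2)) has_real_derivative 2 * inverse (s ^ 3)) (at s)"
  using assms by (auto intro!: derivative_eq_intros simp: field_simps power2_eq_square power3_eq_cube)

lemma log_DERIVs:
  fixes s a b :: real assumes "0 < s"
  shows "((\<lambda>s. a * s - b * ln s) has_real_derivative a - b * inverse s) (at s)"
    "((\<lambda>s. a - b * inverse s) has_real_derivative b * inverse (s^2)) (at s)"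
  using assms by (auto intro!: derivative_eq_intros simp: field_simps power2_eq_square)

lemma inverse_power_continuous: "continuous_on {0<..} (\<lambda>s::real. b * inverse (s ^ n))"
  by (intro continuous_intros) auto

text \<open>Nonnegativity confines I3 to [1/R, R] and forces 102 I1 <= 1/R <= I3, strictly inside
  \<open>small_ratio\<close>. Only the actions enter, and their drift and noise are both
  O(\<gamma>), so the cutoff varies slowly.\<close>

definition cut_arg :: "real \<Rightarrow> st \<Rightarrow> real" where
  "cut_arg R x = R - (coord 2 x + inverse (coord 2 x)) - 102 * R^2 * coord 1 x"

text \<open>The cube is the lowest integer power of a positive part that is twice continuously
  differentiable.\<close>

definition cutoff :: "real \<Rightarrow> st \<Rightarrow> real" where
  "cutoff R x = (max 0 (cut_arg R x)) ^ 3"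

lemma cut_arg_facts:
  shows "C2_on act_pos (cut_arg R)"
    and "x \<in> act_pos \<Longrightarrow> gen_b \<gamma> T1 T3 (cut_arg R) x =
      - (\<gamma> * ((T3 - coord 2 x ^ 3) * (1 - inverse ((coord 2 x)^2)) + T3 * coord 2 x / 4 * (2 * inverse (coord 2 x ^ 3))))
      - 102 * R^2 * (\<gamma> * (T1 - coord 1 x ^ 3))" (is "_ \<Longrightarrow> ?P1")
    and "x \<in> act_pos \<Longrightarrow> pd 1 (cut_arg R) x = - 102 * R^2"
    and "x \<in> act_pos \<Longrightarrow> pd 2 (cut_arg R) x = - (1 - inverse ((coord 2 x)^2))" (is "_ \<Longrightarrow> ?P2")
    and "x \<in> act_pos \<Longrightarrow> pd 3 (cut_arg R) x = 0" and "x \<in> act_pos \<Longrightarrow> pd 4 (cut_arg R) x = 0"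
proof -
  define f where "f = (\<lambda>x. coord 2 x + inverse (coord 2 x))"
  define k where "k = 102 * R^2"
  have e: "cut_arg R = (\<lambda>x. (R + (- 1) * f x) + (- k) * coord 1 x)"
    by (simp add: cut_arg_def f_def k_def fun_eq_iff)
  have f2: "C2_on act_pos f" and fg: "\<And>x \<gamma> T1 T3. x \<in> act_pos \<Longrightarrow> gen_b \<gamma> T1 T3 f x =
      \<gamma> * (T3 - coord 2 x ^ 3) * (1 - inverse ((coord 2 x)^2)) + \<gamma> * T3 * coord 2 x / 4 * (2 * inverse (coord 2 x ^ 3))"
    and fp: "\<And>x j. x \<in> act_pos \<Longrightarrow> pd j f x = (if j = 2 then 1 - inverse ((coord 2 x)^2) else 0)"
  proof -
    note q = coord12_comp[where i=2 and v="\<lambda>s. s + inverse s" and v'="\<lambda>s. 1 - inverse (s^2)"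
        and v''="\<lambda>s. 2 * inverse (s ^ 3)", OF _ _ _ inverse_power_continuous]
    show "C2_on act_pos f" unfolding f_def by (rule q(1)) (simp_all only: inverse_DERIVs simp_thms)
    show "gen_b \<gamma> T1 T3 f x =
      \<gamma> * (T3 - coord 2 x ^ 3) * (1 - inverse ((coord 2 x)^2)) + \<gamma> * T3 * coord 2 x / 4 * (2 * inverse (coord 2 x ^ 3))"
      if "x \<in> act_pos" for x \<gamma> T1 T3
      unfolding f_def by (rule trans[OF q(2)[where ?T1.0=T1]]) (use that in \<open>simp_all add: inverse_DERIVs\<close>)
    show "pd j f x = (if j = 2 then 1 - inverse ((coord 2 x)^2) else 0)" if "x \<in> act_pos" for x j
      unfolding f_def by (rule q(3)) (use that in \<open>simp_all only: inverse_DERIVs simp_thms\<close>)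
  qed
  have c: "C2_on act_pos (coord 1)" and cg: "\<And>x \<gamma> T1 T3. gen_b \<gamma> T1 T3 (coord 1) x = \<gamma> * (T1 - coord 1 x ^ 3)"
    by (auto simp: gen_b_alt pd_coord)
  have m1: "C2_on act_pos (\<lambda>x. (- 1) * f x)" and m2: "C2_on act_pos (\<lambda>x. (- k) * coord 1 x)"
    by (intro C2_on_cmult open_act_pos f2 c)+
  have m3: "C2_on act_pos (\<lambda>x. R + (- 1) * f x)" by (intro C2_on_add C2_on_const open_act_pos m1)
  show "C2_on act_pos (cut_arg R)" unfolding e by (intro C2_on_add open_act_pos m2 m3)
  assume x: "x \<in> act_pos"
  have "gen_b \<gamma> T1 T3 (cut_arg R) x = (- 1) * gen_b \<gamma> T1 T3 f x + (- k) * gen_b \<gamma> T1 T3 (coord 1) x"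
    unfolding e gen_b_add[OF open_act_pos m3 m2 x] gen_b_add[OF open_act_pos C2_on_const m1 x]
      gen_b_cmult[OF open_act_pos f2 x] gen_b_cmult[OF open_act_pos c x] by simp
  then show ?P1
    unfolding fg[OF x] cg k_def by (simp add: algebra_simps)
  have "pd j (cut_arg R) x = - pd j f x + (- k) * pd j (coord 1) x" for j
  proof -
    have "pd j (cut_arg R) x = pd j (\<lambda>x. R + (- 1) * f x) x + pd j (\<lambda>x. (- k) * coord 1 x) x"
      unfolding e by (rule pd_add[OF C2_on_C1[OF m3] C2_on_C1[OF m2] x])
    moreover have "pd j (\<lambda>x. R + (- 1) * f x) x = pd j (\<lambda>x. R) x + pd j (\<lambda>x. (- 1) * f x) x"
      by (rule pd_add[OF C1_on_const C2_on_C1[OF m1] x])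
    moreover have "pd j (\<lambda>x. (- 1) * f x) x = pd j (\<lambda>x. - 1) x * f x + (- 1) * pd j f x"
      by (rule pd_mult[OF C1_on_const C2_on_C1[OF f2] x])
    moreover have "pd j (\<lambda>x. (- k) * coord 1 x) x = pd j (\<lambda>x. - k) x * coord 1 x + (- k) * pd j (coord 1) x"
      by (rule pd_mult[OF C1_on_const C2_on_C1[OF c] x])
    ultimately show ?thesis by (simp only: pd_const)
  qed
  then show "pd 1 (cut_arg R) x = - 102 * R^2" ?P2
    "pd 3 (cut_arg R) x = 0" "pd 4 (cut_arg R) x = 0"
    unfolding fp[OF x] k_def by (simp_all add: pd_coord)
qed

lemma cut_region:
  assumes R: "1 \<le> R" and x: "x \<in> act_pos" and g: "0 \<le> cut_arg R x"
  shows "x \<in> small_ratio" "1 / R \<le> coord 2 x" "coord 2 x \<le> R" "inverse (coord 2 x) \<le> R"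
    "coord 1 x \<le> 1" "cut_arg R x \<le> R"
proof -
  have p: "0 < coord 1 x" "0 < coord 2 x" using x by (auto simp: act_pos_def)
  then have i: "0 < inverse (coord 2 x)" "0 < 102 * R^2 * coord 1 x" using R by auto
  show 1: "coord 2 x \<le> R" "inverse (coord 2 x) \<le> R" "cut_arg R x \<le> R"
    using g p i unfolding cut_arg_def by linarith+
  have k: "102 * R^2 * coord 1 x \<le> R"
    using g p i unfolding cut_arg_def by linarith
  show I: "1 / R \<le> coord 2 x"
    using 1(2) p R by (simp add: field_simps)
  have "R * (102 * (R * coord 1 x)) \<le> R * 1" using k by (simp add: power2_eq_square mult_ac)
  then have k': "102 * (R * coord 1 x) \<le> 1" using R by (simp add: mult_le_cancel_left)
  then have "102 * coord 1 x \<le> 1 / R" using R by (simp add: field_simps)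
  then show "x \<in> small_ratio" using I p unfolding small_ratio_def by simp
  have "coord 1 x \<le> R * coord 1 x" using mult_right_mono[OF R, of "coord 1 x"] p by simp
  then show "coord 1 x \<le> 1" using k' p by linarith
qed

lemma cutoff_facts:
  shows "C2_on act_pos (cutoff R)"
  and "x \<in> act_pos \<Longrightarrow> gen_b \<gamma> T1 T3 (cutoff R) x =
    3 * (max 0 (cut_arg R x))^2 * gen_b \<gamma> T1 T3 (cut_arg R) x
    + (1/2) * (6 * max 0 (cut_arg R x)) * diff_b \<gamma> T1 T3 (cut_arg R) (cut_arg R) x" (is "_ \<Longrightarrow> ?P1")
  and "x \<in> act_pos \<Longrightarrow> pd j (cutoff R) x = 3 * (max 0 (cut_arg R x))^2 * pd j (cut_arg R) x" (is "_ \<Longrightarrow> ?P2")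
proof -
  have d: "((\<lambda>s. 3 * (max 0 s)^2) has_real_derivative 6 * max 0 s) (at s)" for s :: real
    using DERIV_cmult[OF square_pos_DERIV, of 3] by simp
  have c: "continuous_on UNIV (\<lambda>s::real. 6 * max 0 s)" by (intro continuous_intros)
  show "C2_on act_pos (cutoff R)"
    unfolding cutoff_def[abs_def] by (rule C2_on_comp[OF open_act_pos cut_arg_facts(1) _ cube_pos_DERIV d c]) auto
  assume x: "x \<in> act_pos"
  show ?P1
    unfolding cutoff_def[abs_def] by (rule gen_b_comp[OF open_act_pos cut_arg_facts(1) _ cube_pos_DERIV d c x]) auto
  show ?P2
    unfolding cutoff_def[abs_def] by (rule pd_comp[OF C2_on_C1[OF cut_arg_facts(1)] x cube_pos_DERIV])
qed

lemma cutoff_bounds: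
  assumes R: "1 \<le> R" and T3: "0 < T3"
  shows "\<exists>C>0. \<forall>\<gamma> T1 x. 0 < \<gamma> \<and> 0 < T1 \<and> T1 \<le> 1 \<and> x \<in> act_pos \<and> 0 \<le> cut_arg R x \<longrightarrow>
    \<bar>gen_b \<gamma> T1 T3 (cutoff R) x\<bar> \<le> C * \<gamma> \<and> \<bar>pd 1 (cutoff R) x\<bar> \<le> C \<and> \<bar>pd 2 (cutoff R) x\<bar> \<le> C
    \<and> pd 3 (cutoff R) x = 0 \<and> pd 4 (cutoff R) x = 0 \<and> \<bar>cutoff R x\<bar> \<le> C" (is "\<exists>C>0. \<forall>\<gamma> T1 x. _ \<longrightarrow> ?B C \<gamma> T1 x")
proof -
  define Cg where "Cg = (T3 + R ^ 3) * (1 + R^2) + T3 * R / 4 * (2 * R ^ 3) + 102 * R^2 * (1 + 1)"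
  define Cd where "Cd = 1 * 1 / 2 * (102 * R^2) * (102 * R^2) + T3 * R / 2 * (1 + R^2) * (1 + R^2)"
  define C where "C = (3 * (R * R) * Cg + 1 / 2 * (6 * R) * Cd) + 3 * (R * R) * (102 * R^2) + 3 * (R * R) * (1 + R^2) + R ^ 3"
  have pos: "0 \<le> Cg" "0 \<le> Cd" "0 < R ^ 3" using R T3 by (simp_all add: Cg_def Cd_def)
  have "0 \<le> 3 * (R * R) * Cg + 1 / 2 * (6 * R) * Cd" "0 \<le> 3 * (R * R) * (102 * R^2)" "0 \<le> 3 * (R * R) * (1 + R^2)"
    using R pos by simp_all
  then have C: "0 < C" "3 * (R * R) * Cg + 1 / 2 * (6 * R) * Cd \<le> C" "3 * (R * R) * (102 * R^2) \<le> C"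
    "3 * (R * R) * (1 + R^2) \<le> C" "R ^ 3 \<le> C"
    unfolding C_def using pos(3) by linarith+
  have "?B C \<gamma> T1 x"
    if g0: "0 < \<gamma>" and T1: "0 < T1" "T1 \<le> 1" and x: "x \<in> act_pos" and cut: "0 \<le> cut_arg R x" for \<gamma> T1 x
  proof -
    note r = cut_region[OF R x cut]
    have p: "0 < coord 1 x" "0 < coord 2 x" using x by (auto simp: act_pos_def)
    let ?I = "coord 2 x"
    have b3: "\<bar>?I ^ 3\<bar> \<le> R ^ 3" unfolding power_abs using r p by (intro power_mono) auto
    have inv: "\<bar>inverse (?I^2)\<bar> \<le> R^2" "\<bar>inverse (?I ^ 3)\<bar> \<le> R ^ 3"
      unfolding power_inverse[symmetric] power_abs using r p by (auto intro!: power_mono)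
    have b1: "\<bar>coord 1 x ^ 3\<bar> \<le> 1" unfolding power_abs using r p by (intro power_le_one) auto
    have A: "\<bar>T3 - ?I ^ 3\<bar> \<le> T3 + R ^ 3" "\<bar>1 - inverse (?I^2)\<bar> \<le> 1 + R^2" "\<bar>T1 - coord 1 x ^ 3\<bar> \<le> 1 + 1"
      using b3 inv b1 T3 T1 by linarith+
    have TI: "\<bar>T3 * ?I\<bar> \<le> T3 * R" using T3 r p by (intro abs_mult_mono) auto
    have T1I: "\<bar>T1 * coord 1 x\<bar> \<le> 1 * 1" using T1 r p by (intro abs_mult_mono) auto
    have R2: "\<bar>102 * R^2\<bar> \<le> 102 * R^2" by simp
    have "\<bar>(T3 - ?I ^ 3) * (1 - inverse (?I^2)) + T3 * ?I / 4 * (2 * inverse (?I ^ 3)) + 102 * R^2 * (T1 - coord 1 x ^ 3)\<bar> \<le> Cg"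
      unfolding Cg_def using TI inv by (intro abs_add_mono abs_mult_mono A R2) auto
    moreover have "gen_b \<gamma> T1 T3 (cut_arg R) x = - ((T3 - ?I ^ 3) * (1 - inverse (?I^2)) + T3 * ?I / 4 * (2 * inverse (?I ^ 3)) + 102 * R^2 * (T1 - coord 1 x ^ 3)) * \<gamma>"
      unfolding cut_arg_facts(2)[OF x] by (simp add: algebra_simps)
    ultimately have gg: "\<bar>gen_b \<gamma> T1 T3 (cut_arg R) x\<bar> \<le> Cg * \<gamma>"
      using g0 by (simp only:) (rule abs_mult_mono; simp)
    have "\<bar>T1 * coord 1 x / 2 * (102 * R^2) * (102 * R^2) + T3 * ?I / 2 * (1 - inverse (?I^2)) * (1 - inverse (?I^2))\<bar> \<le> Cd"
      unfolding Cd_def using TI T1I by (intro abs_add_mono abs_mult_mono A R2) auto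
    moreover have "diff_b \<gamma> T1 T3 (cut_arg R) (cut_arg R) x = (T1 * coord 1 x / 2 * (102 * R^2) * (102 * R^2) + T3 * ?I / 2 * (1 - inverse (?I^2)) * (1 - inverse (?I^2))) * \<gamma>"
    proof -
      define y where "y = 1 - inverse (?I^2)"
      show ?thesis
        unfolding diff_b_def cut_arg_facts(3-6)[OF x] y_def[symmetric] by (simp add: algebra_simps)
    qed
    ultimately have dd: "\<bar>diff_b \<gamma> T1 T3 (cut_arg R) (cut_arg R) x\<bar> \<le> Cd * \<gamma>"
      using g0 by (simp only:) (rule abs_mult_mono; simp)
    have m: "\<bar>max 0 (cut_arg R x)\<bar> \<le> R" using cut r(6) by simp
    have m2: "\<bar>(max 0 (cut_arg R x))^2\<bar> \<le> R * R" unfolding power2_eq_square by (intro abs_mult_mono m)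
    have "\<bar>gen_b \<gamma> T1 T3 (cutoff R) x\<bar> \<le> 3 * (R * R) * (Cg * \<gamma>) + 1 / 2 * (6 * R) * (Cd * \<gamma>)"
      unfolding cutoff_facts(2)[OF x] by (intro abs_add_mono abs_mult_mono m2 m gg dd) auto
    also have "\<dots> = (3 * (R * R) * Cg + 1 / 2 * (6 * R) * Cd) * \<gamma>" by (simp add: algebra_simps)
    also have "\<dots> \<le> C * \<gamma>" using C g0 by (intro mult_right_mono) auto
    finally have 1: "\<bar>gen_b \<gamma> T1 T3 (cutoff R) x\<bar> \<le> C * \<gamma>" .
    have "\<bar>pd 1 (cutoff R) x\<bar> \<le> 3 * (R * R) * (102 * R^2)"
      unfolding cutoff_facts(3)[OF x] cut_arg_facts(3-6)[OF x] by (intro abs_mult_mono m2) auto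
    moreover have "\<bar>pd 2 (cutoff R) x\<bar> \<le> 3 * (R * R) * (1 + R^2)"
    proof -
      have "\<bar>- (1 - inverse (?I^2))\<bar> \<le> 1 + R^2" unfolding abs_minus_cancel by (rule A(2))
      then show ?thesis
        unfolding cutoff_facts(3)[OF x] cut_arg_facts(3-6)[OF x] by (intro abs_mult_mono m2) auto
    qed
    moreover have "pd 3 (cutoff R) x = 0" "pd 4 (cutoff R) x = 0"
      unfolding cutoff_facts(3)[OF x] cut_arg_facts(3-6)[OF x] by simp_all
    moreover have "\<bar>cutoff R x\<bar> \<le> R ^ 3"
      unfolding cutoff_def power_abs using m by (intro power_mono) auto
    ultimately show ?thesis using 1 C by linarith
  qed
  then show ?thesis using C(1) by blast
qed

text \<open>The gain \<open>c\<close> is available where the cutoff is at least 1; elsewhere the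
  barrier costs at most C (I1 + \<sigma>). The bound on |H| may depend on \<sigma>, since it only
  serves coercivity.\<close>

definition local_barrier :: "real \<Rightarrow> real \<Rightarrow> real \<Rightarrow> real \<Rightarrow> real \<Rightarrow> real \<Rightarrow> (st \<Rightarrow> real) \<Rightarrow> bool" where
  "local_barrier R \<sigma> T1 T3 c C H \<longleftrightarrow> C2_on act_pos H \<and> (\<exists>B. \<forall>x\<in>act_pos. \<bar>H x\<bar> \<le> B) \<and>
      (\<forall>x\<in>act_pos. H (upd 3 x (coord 3 x + 2 * pi)) = H x \<and> H (upd 4 x (coord 4 x + 2 * pi)) = H x) \<and>
      (\<forall>x\<in>act_pos. gen_b (\<sigma> ^ 4) T1 T3 H x \<le> C * (coord 1 x + \<sigma>)) \<and>
      (\<forall>x\<in>act_pos. 1 \<le> cut_arg R x \<longrightarrow> gen_b (\<sigma> ^ 4) T1 T3 H x \<le> - c * (dev x)^2 + C * (coord 1 x + \<sigma>))"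

text \<open>\<open>c\<close> and \<open>C\<close> are fixed before \<sigma> and T1, as the final
  choice of thresholds requires. In the product rule for cutoff times F, the terms with derivatives
  of the cutoff have size \<gamma> / \<sigma>^2 = \<sigma>^2, and the main term keeps its sign
  because the cutoff is nonnegative.\<close>

lemma localized_lyapunov:
  assumes R: "1 \<le> R" and T3: "0 < T3"
  shows "\<exists>c>0. \<exists>C>0. \<forall>\<sigma> T1. 0 < \<sigma> \<and> \<sigma> \<le> 1 / 10 \<and> 0 < T1 \<and> T1 \<le> 1 \<longrightarrow>
    (\<exists>H. local_barrier R \<sigma> T1 T3 c C H)"
proof -
  define D K where "D = 303 * R ^ 4 * (1 + T3)" and "K = 2 * D * R + 1"
  obtain C0 where C0: "0 < C0" and cb: "\<And>\<gamma> T1 x. 0 < \<gamma> \<Longrightarrow> 0 < T1 \<Longrightarrow> T1 \<le> 1 \<Longrightarrow> x \<in> act_pos \<Longrightarrow> 0 \<le> cut_arg R x \<Longrightarrow>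
    \<bar>gen_b \<gamma> T1 T3 (cutoff R) x\<bar> \<le> C0 * \<gamma> \<and> \<bar>pd 1 (cutoff R) x\<bar> \<le> C0 \<and> \<bar>pd 2 (cutoff R) x\<bar> \<le> C0
    \<and> pd 3 (cutoff R) x = 0 \<and> pd 4 (cutoff R) x = 0 \<and> \<bar>cutoff R x\<bar> \<le> C0"
    using cutoff_bounds[OF R T3] by blast
  have K0: "0 < K" using R T3 by (simp add: K_def D_def add_pos_pos)
  have D0: "0 < D" using R T3 by (simp add: D_def)
  define c where "c = 3 / (64 * K)"
  define E where "E = 2 * D + 4 * R * K + 3 * R + 1"
  define C where "C = C0 * (50 + E) + C0 * (11 + K) + 1 * 1 / 2 * C0 * (10 * R) + T3 * R / 2 * C0 * (10 * R)"
  have c0: "0 < c" using K0 by (simp add: c_def)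
  have E0: "0 < E" using D0 K0 R by (simp add: E_def add_pos_pos)
  have parts: "0 < C0 * (50 + E)" "0 < C0 * (11 + K)" "0 \<le> 1 * 1 / 2 * C0 * (10 * R)" "0 \<le> T3 * R / 2 * C0 * (10 * R)"
    using C0 E0 K0 R T3 by simp_all
  then have Cpos: "0 < C" unfolding C_def by linarith
  have "\<exists>H. local_barrier R \<sigma> T1 T3 c C H"
    if sg: "0 < \<sigma>" "\<sigma> \<le> 1 / 10" and T1: "0 < T1" "T1 \<le> 1" for \<sigma> T1
  proof -
    obtain n where "(1/2) ^ n < \<sigma> ^ 4"
      using real_arch_pow_inv[of "\<sigma> ^ 4" "1/2"] sg by auto
    then have n: "(1/2) ^ n \<le> \<sigma> ^ 4" by simp
    define F where "F = (\<lambda>x. - ln ((gap n x)^2 + K * \<sigma> ^ 4) + 2 / 3 * cos (coord 4 x))"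
    note F = angular_lyapunov_step[OF T3 R D_def K_def sg T1 n F_def]
    define H where "H = (\<lambda>x. cutoff R x * F x)"
    \<comment> \<open>An open set on which the product vanishes. Together with
      \<open>small_ratio\<close> it covers \<open>act_pos\<close>, so the product is smooth although
      F is controlled only on \<open>small_ratio\<close>.\<close>
    define V where "V = {x \<in> act_pos. cut_arg R x < 0}"
    have oV: "open V"
    proof -
      have "open (act_pos \<inter> cut_arg R -` {..<0})"
        using continuous_on_open_vimage[OF open_act_pos, of "cut_arg R"] C1_on_continuous[OF C2_on_C1[OF cut_arg_facts(1)]]
        by (metis inf_commute open_lessThan)
      moreover have "V = act_pos \<inter> cut_arg R -` {..<0}" by (auto simp: V_def)
      ultimately show ?thesis by simp
    qed
    have HV: "H x = 0" if "x \<in> V" for x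
      using that by (simp add: V_def H_def cutoff_def)
    have sub: "small_ratio \<subseteq> act_pos" by (auto simp: act_pos_def dest: small_ratioD)
    have in_sr: "x \<in> small_ratio" if "x \<in> act_pos" "x \<notin> V" for x
      using that cut_region(1)[OF R, of x] by (simp add: V_def not_less)
    then have UV: "act_pos = small_ratio \<union> V" using sub by (auto simp: V_def)
    have cut2: "C2_on small_ratio (cutoff R)" by (rule C2_on_subset[OF cutoff_facts(1) sub])
    have H1: "C2_on small_ratio H" unfolding H_def by (intro C2_on_mult open_small_ratio cut2 F(1))
    have H2: "C2_on V H" by (rule C2_on_cong[OF oV _ C2_on_const[of _ 0]]) (simp add: HV)
    have HC: "C2_on act_pos H" unfolding UV by (intro C2_on_Un open_small_ratio oV H1 H2)
    have s2: "0 < \<sigma>^2" "\<sigma> ^ 4 / \<sigma>^2 = \<sigma>^2" "\<sigma>^2 \<le> \<sigma>"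
      using sg by (auto simp: power4_eq_xxxx power2_eq_square mult_left_le_one_le)
    have bnd: "\<bar>H x\<bar> \<le> C0 * ((11 + K) / \<sigma>^2)" if x: "x \<in> act_pos" for x
    proof (cases "x \<in> V")
      case True
      then show ?thesis using HV C0 K0 s2 by simp
    next
      case False
      then have g: "0 \<le> cut_arg R x" using x by (simp add: V_def not_less)
      show ?thesis
        unfolding H_def using cb[of 1 1 x] x g F(4)[OF in_sr[OF x False]] by (intro abs_mult_mono) auto
    qed
    have per: "H (upd 3 x (coord 3 x + 2 * pi)) = H x \<and> H (upd 4 x (coord 4 x + 2 * pi)) = H x" if x: "x \<in> act_pos" for x
    proof -
      have cc: "cut_arg R (upd 3 x t) = cut_arg R x" "cut_arg R (upd 4 x t) = cut_arg R x" for t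
        by (simp_all add: cut_arg_def coord_upd)
      show ?thesis
      proof (cases "x \<in> V")
        case True
        then show ?thesis by (simp add: V_def H_def cutoff_def cc)
      next
        case False
        then show ?thesis using F(2)[OF in_sr[OF x False]] by (simp add: H_def cutoff_def cc)
      qed
    qed
    have g_in: "gen_b (\<sigma> ^ 4) T1 T3 H x \<le> cutoff R x * (- c * (dev x)^2) + C * (coord 1 x + \<sigma>)"
      if x: "x \<in> act_pos" and g: "0 \<le> cut_arg R x" for x
    proof -
      let ?\<gamma> = "\<sigma> ^ 4"
      note r = cut_region[OF R x g]
      have g0: "0 < ?\<gamma>" using sg by simp
      note b = cb[OF g0 T1 x g]
      have p: "0 < coord 1 x" "0 < coord 2 x" using x by (auto simp: act_pos_def)
      note f4 = F(4)[OF r(1)] and f5 = F(5)[OF r(1-3)] and f3 = F(3)[OF r(1-3)]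
      have "gen_b ?\<gamma> T1 T3 H x = F x * gen_b ?\<gamma> T1 T3 (cutoff R) x + cutoff R x * gen_b ?\<gamma> T1 T3 F x + diff_b ?\<gamma> T1 T3 (cutoff R) F x"
        unfolding H_def by (rule gen_b_mult[OF open_small_ratio cut2 F(1) r(1)])
      moreover have "F x * gen_b ?\<gamma> T1 T3 (cutoff R) x \<le> C0 * (11 + K) * \<sigma>"
      proof -
        have "\<bar>F x * gen_b ?\<gamma> T1 T3 (cutoff R) x\<bar> \<le> (11 + K) / \<sigma>^2 * (C0 * ?\<gamma>)"
          using b f4 by (intro abs_mult_mono) auto
        also have "\<dots> = C0 * (11 + K) * (?\<gamma> / \<sigma>^2)" by simp
        also have "\<dots> = C0 * (11 + K) * \<sigma>^2" unfolding s2(2) ..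
        also have "\<dots> \<le> C0 * (11 + K) * \<sigma>" using s2 parts by (intro mult_left_mono) auto
        finally show ?thesis by linarith
      qed
      moreover have "diff_b ?\<gamma> T1 T3 (cutoff R) F x \<le> (1 * 1 / 2 * C0 * (10 * R) + T3 * R / 2 * C0 * (10 * R)) * \<sigma>"
      proof -
        let ?Z = "1 * 1 / 2 * C0 * (10 * R / \<sigma>^2) + T3 * R / 2 * C0 * (10 * R / \<sigma>^2)"
        have TT: "\<bar>T1 * coord 1 x\<bar> \<le> 1 * 1" "\<bar>T3 * coord 2 x\<bar> \<le> T3 * R" using T1 T3 r p by (intro abs_mult_mono; auto)+
        have "\<bar>T1 * coord 1 x / 2 * pd 1 (cutoff R) x * pd 1 F x + T3 * coord 2 x / 2 * pd 2 (cutoff R) x * pd 2 F x\<bar> \<le> ?Z"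
          using TT b f5 by (intro abs_add_mono abs_mult_mono) auto
        then have "\<bar>(T1 * coord 1 x / 2 * pd 1 (cutoff R) x * pd 1 F x + T3 * coord 2 x / 2 * pd 2 (cutoff R) x * pd 2 F x) * ?\<gamma>\<bar> \<le> ?Z * ?\<gamma>"
          using g0 by (intro abs_mult_mono) auto
        moreover have "diff_b ?\<gamma> T1 T3 (cutoff R) F x = (T1 * coord 1 x / 2 * pd 1 (cutoff R) x * pd 1 F x + T3 * coord 2 x / 2 * pd 2 (cutoff R) x * pd 2 F x) * ?\<gamma>"
          unfolding diff_b_def using b by (simp add: algebra_simps)
        moreover have "?Z * ?\<gamma> = (1 * 1 / 2 * C0 * (10 * R) + T3 * R / 2 * C0 * (10 * R)) * \<sigma>^2"
          using sg by (simp add: field_simps power4_eq_xxxx power2_eq_square)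
        moreover have "\<dots> \<le> (1 * 1 / 2 * C0 * (10 * R) + T3 * R / 2 * C0 * (10 * R)) * \<sigma>"
          using s2 parts by (intro mult_left_mono) auto
        ultimately show ?thesis by linarith
      qed
      moreover have "cutoff R x * gen_b ?\<gamma> T1 T3 F x \<le> cutoff R x * (- c * (dev x)^2) + C0 * (50 + E) * (coord 1 x + \<sigma>)"
      proof -
        have chi: "0 \<le> cutoff R x" "cutoff R x \<le> C0" using b by (auto simp: cutoff_def)
        have "gen_b ?\<gamma> T1 T3 F x \<le> - c * (dev x)^2 + (50 * coord 1 x + E * \<sigma>)"
          using f3 by (simp add: c_def E_def)
        also have "50 * coord 1 x + E * \<sigma> \<le> (50 + E) * (coord 1 x + \<sigma>)"
          using p sg E0 by (simp add: algebra_simps)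
        finally have "gen_b ?\<gamma> T1 T3 F x \<le> - c * (dev x)^2 + (50 + E) * (coord 1 x + \<sigma>)" by simp
        from mult_left_mono[OF this chi(1)]
        have "cutoff R x * gen_b ?\<gamma> T1 T3 F x \<le> cutoff R x * (- c * (dev x)^2) + cutoff R x * ((50 + E) * (coord 1 x + \<sigma>))"
          by (simp only: distrib_left)
        also have "cutoff R x * ((50 + E) * (coord 1 x + \<sigma>)) \<le> C0 * ((50 + E) * (coord 1 x + \<sigma>))"
          using chi p sg E0 by (intro mult_right_mono) auto
        finally show ?thesis by (simp add: mult.assoc)
      qed
      moreover have "C * (coord 1 x + \<sigma>) = C0 * (50 + E) * (coord 1 x + \<sigma>) + C0 * (11 + K) * \<sigma>
          + (1 * 1 / 2 * C0 * (10 * R) + T3 * R / 2 * C0 * (10 * R)) * \<sigma> + (C0 * (11 + K) + (1 * 1 / 2 * C0 * (10 * R) + T3 * R / 2 * C0 * (10 * R))) * coord 1 x"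
        unfolding C_def by (simp add: algebra_simps)
      moreover have "0 \<le> (C0 * (11 + K) + (1 * 1 / 2 * C0 * (10 * R) + T3 * R / 2 * C0 * (10 * R))) * coord 1 x"
        using C0 K0 R T3 p by (intro mult_nonneg_nonneg add_nonneg_nonneg) auto
      ultimately show ?thesis by linarith
    qed
    have g_out: "gen_b (\<sigma> ^ 4) T1 T3 H x = 0" if "x \<in> V" for x
    proof -
      have "gen_b (\<sigma> ^ 4) T1 T3 H x = gen_b (\<sigma> ^ 4) T1 T3 (\<lambda>x. 0) x"
        by (rule gen_b_cong[OF oV that]) (simp add: HV)
      then show ?thesis by simp
    qed
    show ?thesis
      unfolding local_barrier_def
    proof (intro exI[of _ H] conjI ballI impI HC)
      show "\<exists>B. \<forall>x\<in>act_pos. \<bar>H x\<bar> \<le> B" using bnd by blast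
      fix x assume x: "x \<in> act_pos"
      show "H (upd 3 x (coord 3 x + 2 * pi)) = H x" "H (upd 4 x (coord 4 x + 2 * pi)) = H x" using per[OF x] by auto
      have p: "0 < coord 1 x" using x by (simp add: act_pos_def)
      have cd: "0 \<le> cutoff R x * (c * (dev x)^2)" using c0 by (simp add: cutoff_def)
      show "gen_b (\<sigma> ^ 4) T1 T3 H x \<le> C * (coord 1 x + \<sigma>)"
      proof (cases "x \<in> V")
        case True
        then show ?thesis using g_out Cpos p sg by simp
      next
        case False
        then show ?thesis using g_in[OF x] x cd by (simp add: V_def not_less)
      qed
      assume g1: "1 \<le> cut_arg R x"
      have "1 * (c * (dev x)^2) \<le> cutoff R x * (c * (dev x)^2)"
        using g1 c0 by (intro mult_right_mono) (auto simp: cutoff_def)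
      then show "gen_b (\<sigma> ^ 4) T1 T3 H x \<le> - c * (dev x)^2 + C * (coord 1 x + \<sigma>)"
        using g_in[OF x] g1 by simp
    qed
  qed
  then show ?thesis using c0 Cpos by blast
qed

section \<open>The actions and the variance\<close>

text \<open>Multiplied by u this is nonnegativity of a quartic. The weights 27/100 and 24/100 belong
  to I3 and - ln I3; the slack 1/200 of u^3 + 1/u is reserved for the region where the angle is not
  controlled.\<close>

lemma action_quartic:
  fixes u :: real
  assumes "0 < u"
  shows "4 / 5 * (u - 9 / 10)^2 + 24 / 100 * (u^2 - 3 / 4 / u) + 27 / 100 * (1 - u ^ 3) + 1 / 200 * (u ^ 3 + 1 / u) \<le> 95 / 1000"
proof -
  \<comment> \<open>A sum-of-squares certificate: the first square matches degrees four and three,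
    the second completes the square in the remaining quadratic.\<close>
  have "0 \<le> 53 / 200 * (u^2 - 104 / 53 * u + 3 / 4)^2 + 469 / 21200 * (u - 2279 / 2345)^2 + 189199 / 37520000" by simp
  also have "\<dots> = u * (95 / 1000) - u * (4 / 5 * (u - 9 / 10)^2 + 24 / 100 * (u^2 - 3 / 4 / u) + 27 / 100 * (1 - u ^ 3) + 1 / 200 * (u ^ 3 + 1 / u))"
    using assms by (simp add: field_simps power2_eq_square power3_eq_cube)
  finally have "u * (4 / 5 * (u - 9 / 10)^2 + 24 / 100 * (u^2 - 3 / 4 / u) + 27 / 100 * (1 - u ^ 3) + 1 / 200 * (u ^ 3 + 1 / u)) \<le> u * (95 / 1000)" by simp
  then show ?thesis using assms by (simp only: mult_le_cancel_left_pos)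
qed

text \<open>Below I = 1/k with k = (a + b) / s + 1 the left side is at most s; above it the cubic
  dominates. The I1 dynamics supplies - A I1^3 for any A at the price A T1, so a small T1 absorbs
  the lower-order terms in I1.\<close>

lemma cubic_absorbs:
  fixes a b s :: real
  assumes "0 < s" "0 \<le> a" "0 \<le> b"
  shows "\<exists>A>0. \<forall>I\<ge>0. a * I^2 + b * I \<le> s + A * I ^ 3"
proof -
  define A where "A = (a + b) * ((a + b) / s + 1)^2 + 1"
  have "a * I^2 + b * I \<le> s + A * I ^ 3" if I: "0 \<le> I" for I
  proof (cases "((a + b) / s + 1) * I \<le> 1")
    case True
    have q: "0 \<le> (a + b) / s" using assms by simp
    have I1: "I \<le> 1" using mult_right_mono[of 1 "(a + b) / s + 1" I] True I q by simp
    have "I^2 \<le> I" using I I1 by (simp add: power2_eq_square mult_left_le_one_le)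
    then have "a * I^2 + b * I \<le> (a + b) * I" using assms mult_left_mono[of "I^2" I a] by (simp add: distrib_right)
    also have "\<dots> = s * ((a + b) / s * I)" using assms by simp
    also have "\<dots> \<le> s * 1"
    proof (rule mult_left_mono)
      show "(a + b) / s * I \<le> 1" using True I unfolding distrib_right by linarith
    qed (use assms in simp)
    finally show ?thesis using I assms by (simp add: A_def add_increasing2)
  next
    case False
    define k where "k = (a + b) / s + 1"
    have k: "1 \<le> k" using assms by (simp add: k_def)
    have kI: "1 \<le> k * I" using False by (simp add: k_def)
    have "I \<le> k * I * I" using mult_right_mono[OF kI I] by simp
    have "1 \<le> k * I * (k * I)" using mult_mono[OF kI kI] kI by simp
    from mult_right_mono[OF this I] have 1: "I \<le> k^2 * I ^ 3" by (simp add: power2_eq_square power3_eq_cube mult_ac)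
    have "1 * (k * I) \<le> k * (k * I)" using k kI by (intro mult_right_mono) auto
    then have "1 \<le> k * (k * I)" using kI by linarith
    from mult_right_mono[OF this, of "I^2"] have 2: "I^2 \<le> k^2 * I ^ 3" by (simp add: power2_eq_square power3_eq_cube mult_ac)
    have "a * I^2 + b * I \<le> a * (k^2 * I ^ 3) + b * (k^2 * I ^ 3)"
      using 1 2 assms by (intro add_mono mult_left_mono) auto
    also have "\<dots> \<le> A * I ^ 3" using I by (simp add: A_def k_def algebra_simps)
    finally show ?thesis using assms by linarith
  qed
  moreover have "0 < A" using assms by (simp add: A_def add_nonneg_pos)
  ultimately show ?thesis by blast
qed

lemma linear_minus_log:
  fixes a b :: real
  assumes "0 < a" "0 < b"
  shows "\<exists>m. \<forall>s>0. m + a / 2 * s \<le> a * s - b * ln s"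
proof (intro exI allI impI)
  fix s :: real assume s: "0 < s"
  have "ln (a / (2 * b) * s) \<le> a / (2 * b) * s - 1" using assms s by (intro ln_le_minus_one) simp
  moreover have "ln (a / (2 * b) * s) = ln (a / (2 * b)) + ln s" by (rule ln_mult_pos) (use assms s in auto)
  ultimately have "ln s \<le> a / (2 * b) * s - 1 - ln (a / (2 * b))" by linarith
  from mult_left_mono[OF this, of b] have "b * ln s \<le> b * (a / (2 * b) * s - 1 - ln (a / (2 * b)))"
    using assms by simp
  moreover have "b * (a / (2 * b) * s - 1 - l) = a / 2 * s - b - b * l" for l
    using assms by (simp add: field_simps)
  ultimately have "b * ln s \<le> a / 2 * s - b - b * ln (a / (2 * b))" by simp
  then show "(b + b * ln (a / (2 * b))) + a / 2 * s \<le> a * s - b * ln s" by simp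
qed

lemma log_coercive:
  fixes a b L :: real
  assumes "0 < a" "0 < b"
  shows "\<exists>l r. 0 < l \<and> (\<forall>s>0. a * s - b * ln s < L \<longrightarrow> l \<le> s \<and> s \<le> r)"
proof -
  obtain m where m: "\<And>s. 0 < s \<Longrightarrow> m + a / 2 * s \<le> a * s - b * ln s" using linear_minus_log[OF assms] by blast
  have "exp (- L / b) \<le> s \<and> s \<le> 2 * (L - m) / a" if s: "0 < s" and L: "a * s - b * ln s < L" for s
  proof
    have "- L < b * ln s" using L mult_pos_pos[OF assms(1) s] by linarith
    then have "- L / b \<le> b * ln s / b" using assms by (intro divide_right_mono) auto
    then have "- L / b \<le> ln s" using assms by simp
    then show "exp (- L / b) \<le> s" using s by (metis exp_le_cancel_iff exp_ln)
    show "s \<le> 2 * (L - m) / a" using m[OF s] L assms by (simp add: field_simps)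
  qed
  then show ?thesis by (intro exI[of _ "exp (- L / b)"] exI[of _ "2 * (L - m) / a"]) auto
qed

text \<open>The mean is the best centre, so a centre fixed by hand still bounds the
  variance.\<close>

lemma (in prob_space) variance_le_second_moment:
  fixes X :: "'a \<Rightarrow> real"
  assumes m: "X \<in> borel_measurable M" and i: "integrable M (\<lambda>x. (X x - c)^2)"
  shows "integrable M (\<lambda>x. (X x)^2)" (is ?P1) "variance X \<le> expectation (\<lambda>x. (X x - c)^2)" (is ?P2)
proof -
  have [measurable]: "X \<in> borel_measurable M" by (rule m)
  have iY: "integrable M (\<lambda>x. X x - c)"
    by (rule square_integrable_imp_integrable[OF _ i]) simp
  have "integrable M (\<lambda>x. (X x - c)^2 + 2 * c * (X x - c) + c^2)"
    using i iY by (intro Bochner_Integration.integrable_add integrable_mult_right) auto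
  then show sq: ?P1
    by (rule Bochner_Integration.integrable_cong[THEN iffD1, rotated 2]) (simp_all add: power2_eq_square algebra_simps)
  have iX: "integrable M X" by (rule square_integrable_imp_integrable[OF m sq])
  have v: "variance X = expectation (\<lambda>x. (X x)^2) - (expectation X)^2"
    by (rule variance_eq[OF iX sq])
  have "expectation (\<lambda>x. (X x - c)^2) = expectation (\<lambda>x. (X x)^2 - 2 * c * X x + c^2)"
    by (simp add: power2_eq_square algebra_simps)
  also have "\<dots> = expectation (\<lambda>x. (X x)^2) - 2 * c * expectation X + c^2"
    using iX sq by (simp add: prob_space)
  finally have "expectation (\<lambda>x. (X x - c)^2) - variance X = (expectation X - c)^2"
    unfolding v by (simp add: power2_eq_square algebra_simps)
  then show ?P2
    using zero_le_power2[of "expectation X - c"] by linarith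
qed

lemma h_obs_alt: "h_obs x = coord 1 x * sin (coord 3 x) + coord 2 x * sin (coord 4 x)"
  by (cases x) (simp add: h_obs_def coord_simps)

text \<open>Young's inequality with weights 16/15 and 16: the main part - (sqrt 3 / 2) (I3 - m)
  contributes 16/15 * 3/4 = 4/5, while the I1 part and the angular error may carry large constants,
  being compensated elsewhere.\<close>

lemma h_obs_deviation:
  fixes m :: real
  assumes "0 \<le> coord 1 x"
  shows "(h_obs x + sqrt 3 / 2 * m)^2 \<le> 4 / 5 * (coord 2 x - m)^2 + 32 * (coord 1 x)^2 + 32 * ((coord 2 x)^2 * (dev x)^2)"
proof -
  define a b p q where "a = - sqrt 3 / 2 * (coord 2 x - m)" and "b = p + q"
    and "p = coord 1 x * sin (coord 3 x)" and "q = coord 2 x * dev x"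
  have ab: "h_obs x + sqrt 3 / 2 * m = a + b"
    by (simp add: h_obs_alt a_def b_def p_def q_def dev_def field_simps)
  have "(a + b)^2 \<le> 16 / 15 * a^2 + 16 * b^2"
    using zero_le_power2[of "a - 15 * b"] by (simp add: power2_eq_square algebra_simps)
  moreover have "b^2 \<le> 2 * p^2 + 2 * q^2"
    using zero_le_power2[of "p - q"] unfolding b_def by (simp add: power2_eq_square algebra_simps)
  moreover have "16 / 15 * a^2 = 4 / 5 * (coord 2 x - m)^2"
    by (simp add: a_def power_mult_distrib power_divide)
  moreover have "p^2 \<le> (coord 1 x)^2"
    unfolding p_def power_mult_distrib by (rule mult_left_le) (simp_all add: abs_square_le_1)
  moreover have "q^2 = (coord 2 x)^2 * (dev x)^2" by (simp add: q_def power_mult_distrib)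
  ultimately show ?thesis unfolding ab by linarith
qed

text \<open>Here I3 is large, I3 is small, or I1 is not small; these cases are paid for by I3^3,
  1/I3 and I1^3. The factor 128 is 32 from the deviation of h times the bound 4 for the square of
  \<open>dev\<close>.\<close>

lemma cut_region_complement:
  assumes x: "x \<in> act_pos" and E: "0 < E" and R: "3 + 128 / E < R"
    and out: "\<not> 1 \<le> cut_arg R x"
  shows "128 * (coord 2 x)^2 \<le> E * (coord 2 x ^ 3 + inverse (coord 2 x)) + 128 * R^2 * (102 * R^2) ^ 3 * coord 1 x ^ 3"
proof -
  let ?I = "coord 2 x" and ?k = "102 * R^2"
  have p: "0 < coord 1 x" "0 < ?I" using x by (auto simp: act_pos_def)
  have E': "0 < 128 / E" using E by simp
  have R3: "128 / E < R - 3" "3 < R" using R E' by linarith+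
  then have ER: "128 \<le> E * (R - 3)" using E by (simp add: pos_divide_less_eq mult.commute)
  have n1: "0 \<le> E * (?I ^ 3 + inverse ?I)" "0 \<le> 128 * R^2 * ?k ^ 3 * coord 1 x ^ 3" using p E R3 by simp_all
  \<comment> \<open>R - 2 and 1 add up to R - 1, which I3 + 1/I3 + 102 R^2 I1 exceeds when
    \<open>cut_arg\<close> is below 1.\<close>
  consider "R - 2 < ?I + inverse ?I" | "?I + inverse ?I \<le> R - 2" "1 < ?k * coord 1 x"
    using out unfolding cut_arg_def by linarith
  then show ?thesis
  proof cases
    case 1
    have "(R - 3) * ?I^2 \<le> ?I ^ 3 + inverse ?I"
    proof (cases "1 \<le> ?I")
      case True
      then have "inverse ?I \<le> 1" by (simp add: inverse_le_1_iff)
      then have "R - 3 \<le> ?I" using 1 by linarith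
      from mult_right_mono[OF this, of "?I^2"] p show ?thesis by (simp add: power2_eq_square power3_eq_cube add_increasing2)
    next
      case False
      then have "R - 3 \<le> inverse ?I" using 1 by linarith
      moreover have "?I^2 \<le> 1" using False p by (simp add: power_le_one)
      ultimately have "(R - 3) * ?I^2 \<le> inverse ?I * 1" using R3 p by (intro mult_mono) auto
      then show ?thesis using p by (simp add: add_increasing)
    qed
    from mult_left_mono[OF this, of E] have "E * (R - 3) * ?I^2 \<le> E * (?I ^ 3 + inverse ?I)" using E by (simp add: mult.assoc)
    moreover have "128 * ?I^2 \<le> E * (R - 3) * ?I^2" using ER by (intro mult_right_mono) auto
    ultimately show ?thesis using n1(2) by linarith
  next
    case 2
    have "?I \<le> R" using 2(1) p(2) positive_imp_inverse_positive[OF p(2)] by linarith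
    then have "?I^2 \<le> R^2" using p by (intro power_mono) auto
    moreover have "1 \<le> (?k * coord 1 x) ^ 3" using 2(2) by (intro one_le_power) auto
    ultimately have "128 * ?I^2 * 1 \<le> 128 * R^2 * (?k * coord 1 x) ^ 3" by (intro mult_mono) auto
    then show ?thesis using n1(1) by (simp add: power_mult_distrib mult.assoc)
  qed
qed

text \<open>For - ln I the drift contributes - T/I and the Ito correction T/(4 I). The total - 3/4
  T/I is still negative, so the logarithm can serve as a barrier at I = 0 without spoiling an upper
  bound on the generator.\<close>

lemma log_coord:
  assumes i: "i = 1 \<or> i = 2" and b: "0 < b"
  shows "C2_on act_pos (\<lambda>x. a * coord i x - b * ln (coord i x))" (is ?P1)
    and "x \<in> act_pos \<Longrightarrow> gen_b \<gamma> T1 T3 (\<lambda>x. a * coord i x - b * ln (coord i x)) x =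
      \<gamma> * (a * ((if i = 1 then T1 else T3) - coord i x ^ 3)
        + b * ((coord i x)^2 - 3 / 4 * (if i = 1 then T1 else T3) / coord i x))"
proof -
  note q = coord12_comp[where i=i and v="\<lambda>s. a * s - b * ln s" and v'="\<lambda>s. a - b * inverse s"
      and v''="\<lambda>s. b * inverse (s ^ 2)", OF i _ _ inverse_power_continuous]
  show ?P1
    by (rule q(1)) (simp_all only: log_DERIVs)
  assume x: "x \<in> act_pos"
  then have p: "0 < coord i x" using i by (auto simp: act_pos_def)
  let ?T = "if i = 1 then T1 else T3"
  have "gen_b \<gamma> T1 T3 (\<lambda>x. a * coord i x - b * ln (coord i x)) x =
      \<gamma> * (?T - coord i x ^ 3) * (a - b * inverse (coord i x)) + \<gamma> * ?T * coord i x / 4 * (b * inverse ((coord i x)^2))"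
    by (rule q(2)) (simp_all only: log_DERIVs x)
  also have "\<dots> = \<gamma> * (a * (?T - coord i x ^ 3) + b * ((coord i x)^2 - 3 / 4 * ?T / coord i x))"
  proof -
    have "\<gamma> * (T - s ^ 3) * (a - b * inverse s) + \<gamma> * T * s / 4 * (b * inverse (s^2)) = \<gamma> * (a * (T - s ^ 3) + b * (s^2 - 3 / 4 * T / s))"
      if "0 < s" for s T :: real
      using that by (simp add: field_simps power2_eq_square power3_eq_cube)
    from this[OF p] show ?thesis .
  qed
  finally show "gen_b \<gamma> T1 T3 (\<lambda>x. a * coord i x - b * ln (coord i x)) x =
      \<gamma> * (a * (?T - coord i x ^ 3) + b * ((coord i x)^2 - 3 / 4 * ?T / coord i x))" .
qed

text \<open>Both sides are homogeneous of degree 2 under I = \<tau> u, where \<tau>^3 plays the role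
  of T3; this reduces the claim to u.\<close>

lemma action_drift_bound:
  fixes I \<tau> :: real
  assumes "0 < \<tau>" "0 < I"
  shows "4 / 5 * (I - 9 / 10 * \<tau>)^2 + 27 / (100 * \<tau>) * (\<tau> ^ 3 - I ^ 3) + 24 / 100 * (I^2 - 3 / 4 * \<tau> ^ 3 / I)
    + (I ^ 3 / \<tau> + \<tau> ^ 3 / I) / 200 \<le> 95 / 1000 * \<tau>^2"
proof -
  define u where "u = I / \<tau>"
  have u: "0 < u" and I: "I = \<tau> * u" using assms by (auto simp: u_def)
  have "4 / 5 * (I - 9 / 10 * \<tau>)^2 + 27 / (100 * \<tau>) * (\<tau> ^ 3 - I ^ 3) + 24 / 100 * (I^2 - 3 / 4 * \<tau> ^ 3 / I)
    + (I ^ 3 / \<tau> + \<tau> ^ 3 / I) / 200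
    = \<tau>^2 * (4 / 5 * (u - 9 / 10)^2 + 24 / 100 * (u^2 - 3 / 4 / u) + 27 / 100 * (1 - u ^ 3) + 1 / 200 * (u ^ 3 + 1 / u))"
    unfolding I using assms(1) u by (simp add: field_simps power2_eq_square power3_eq_cube)
  also have "\<dots> \<le> \<tau>^2 * (95 / 1000)"
    by (intro mult_left_mono action_quartic u) simp
  finally show ?thesis by simp
qed

theorem theorem5p11:
  fixes T3 :: real
  assumes "T3 > 0"
  shows "\<exists>\<delta>>0. \<forall>\<gamma> T1 (\<pi> :: st measure). 0 < \<gamma> \<and> \<gamma> < \<delta> \<and> 0 < T1 \<and> T1 < \<delta> \<and>
           invariant_b \<gamma> T1 T3 \<pi> \<longrightarrow>
           integrable \<pi> (\<lambda>x. (h_obs x)\<^sup>2) \<and>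
           prob_space.variance \<pi> h_obs < (1/10) * T3 powr (2/3)"
proof -
  define \<tau> where "\<tau> = T3 powr (1/3)"
  have t0: "0 < \<tau>" using assms by (simp add: \<tau>_def)
  have t3: "\<tau> ^ 3 = T3" "\<tau>^2 = T3 powr (2/3)"
    using assms by (simp_all add: \<tau>_def powr_realpow[symmetric] powr_powr)
  \<comment> \<open>Chosen so that E (I3^3 + 1/I3) stays below the slack (I3^3 / \<tau> + \<tau>^3 /
    I3) / 200.\<close>
  define E where "E = min (1 / \<tau>) (\<tau> ^ 3) / 200"
  have E0: "0 < E" using t0 by (simp add: E_def)
  define R where "R = 4 + 128 / E"
  have R: "1 \<le> R" "3 + 128 / E < R" using E0 by (simp_all add: R_def)
  obtain c C where c: "0 < c" and C: "0 < C" and loc: "\<And>\<sigma> T1. 0 < \<sigma> \<Longrightarrow> \<sigma> \<le> 1 / 10 \<Longrightarrow> 0 < T1 \<Longrightarrow> T1 \<le> 1 \<Longrightarrow>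
    \<exists>H. local_barrier R \<sigma> T1 T3 c C H"
    using localized_lyapunov[OF R(1) assms] by metis
  \<comment> \<open>With B c = 32 R^2 the gain of the barrier outweighs 32 I3^2 times the square of
    \<open>dev\<close>, as I3 <= R there.\<close>
  define B where "B = 32 * R^2 / c"
  have B0: "0 < B" "B * c = 32 * R^2" using c R by (simp_all add: B_def)
  \<comment> \<open>Three errors of size s, from A T1, from B C \<sigma> and from
    \<open>cubic_absorbs\<close>, raise 0.095 to 0.098, still below 0.1.\<close>
  define s where "s = \<tau>^2 / 1000"
  have s0: "0 < s" using t0 by (simp add: s_def)
  \<comment> \<open>33 = 32 + 1: the first from the deviation of h, the second from the generator of
    - ln I1.\<close>
  obtain A2 where A2: "0 < A2" "\<And>I. 0 \<le> I \<Longrightarrow> 33 * I^2 + B * C * I \<le> s + A2 * I ^ 3"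
    using cubic_absorbs[OF s0, of 33 "B * C"] B0 C by auto
  define A1 where "A1 = 128 * R^2 * (102 * R^2) ^ 3"
  have A1: "0 < A1" using R by (simp add: A1_def)
  define A where "A = A1 + A2"
  have A0: "0 < A" using A1 A2 by (simp add: A_def)
  define \<sigma>0 where "\<sigma>0 = min (1 / 10) (s / (B * C))"
  have sg0: "0 < \<sigma>0" using s0 B0 C by (simp add: \<sigma>0_def)
  \<comment> \<open>T1 < s / A gives A T1 <= s, and \<gamma> < \<sigma>0^4 gives B C \<sigma> <=
    s.\<close>
  define \<delta> where "\<delta> = min (min 1 (s / A)) (\<sigma>0 ^ 4)"
  have d0: "0 < \<delta>" using s0 A0 sg0 by (simp add: \<delta>_def)
  show ?thesis
  proof (intro exI[of _ \<delta>] conjI d0 allI impI)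
    fix \<gamma> T1 :: real and \<pi> :: "st measure"
    assume asm: "0 < \<gamma> \<and> \<gamma> < \<delta> \<and> 0 < T1 \<and> T1 < \<delta> \<and> invariant_b \<gamma> T1 T3 \<pi>"
    then have g: "0 < \<gamma>" "\<gamma> < \<sigma>0 ^ 4" and T1: "0 < T1" "T1 \<le> 1" "T1 < s / A" and inv: "invariant_b \<gamma> T1 T3 \<pi>"
      by (auto simp: \<delta>_def)
    interpret prob_space \<pi> using inv by (simp add: invariant_b_def)
    have sets: "sets \<pi> = sets borel" using inv by (simp add: invariant_b_def)
    define \<sigma> where "\<sigma> = root 4 \<gamma>"
    have sg: "0 < \<sigma>" "\<sigma> ^ 4 = \<gamma>" using g by (simp_all add: \<sigma>_def)
    have "\<sigma> < \<sigma>0" using g(2) sg sg0 by (metis less_imp_le power_less_imp_less_base)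
    then have sgs: "\<sigma> \<le> 1 / 10" "B * C * \<sigma> \<le> s"
      using B0 C by (auto simp: \<sigma>0_def field_simps)
    have AT: "A * T1 \<le> s" using T1(3) A0 by (simp add: field_simps)
    obtain H Bd where H: "C2_on act_pos H" "\<And>x. x \<in> act_pos \<Longrightarrow> \<bar>H x\<bar> \<le> Bd"
      and Hper: "\<And>x. x \<in> act_pos \<Longrightarrow> H (upd 3 x (coord 3 x + 2 * pi)) = H x"
        "\<And>x. x \<in> act_pos \<Longrightarrow> H (upd 4 x (coord 4 x + 2 * pi)) = H x"
      and Hg: "\<And>x. x \<in> act_pos \<Longrightarrow> gen_b \<gamma> T1 T3 H x \<le> C * (coord 1 x + \<sigma>)"
        "\<And>x. x \<in> act_pos \<Longrightarrow> 1 \<le> cut_arg R x \<Longrightarrow> gen_b \<gamma> T1 T3 H x \<le> - c * (dev x)^2 + C * (coord 1 x + \<sigma>)"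
      using loc[OF sg(1) sgs(1) T1(1,2)] unfolding local_barrier_def sg(2) by metis
    define f1 f2 where "f1 = (\<lambda>x. A * coord 1 x - 1 * ln (coord 1 x))"
      and "f2 = (\<lambda>x. 27 / (100 * \<tau>) * coord 2 x - 24 / 100 * ln (coord 2 x))"
    have f1: "C2_on act_pos f1" "\<And>x. x \<in> act_pos \<Longrightarrow> gen_b \<gamma> T1 T3 f1 x =
        \<gamma> * (A * (T1 - coord 1 x ^ 3) + 1 * ((coord 1 x)^2 - 3 / 4 * T1 / coord 1 x))"
      unfolding f1_def using log_coord[where i=1 and b=1 and a=A] by auto
    have f2: "C2_on act_pos f2" "\<And>x. x \<in> act_pos \<Longrightarrow> gen_b \<gamma> T1 T3 f2 x =
        \<gamma> * (27 / (100 * \<tau>) * (T3 - coord 2 x ^ 3) + 24 / 100 * ((coord 2 x)^2 - 3 / 4 * T3 / coord 2 x))"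
      unfolding f2_def using log_coord[where i=2 and b="24/100" and a="27 / (100 * \<tau>)"] by auto
    \<comment> \<open>Division by \<gamma> balances the actions, which move at rate \<gamma>,
      against a barrier acting at rate 1. The action part is coercive and H is bounded, so f is
      coercive for each fixed \<gamma>.\<close>
    define f where "f = (\<lambda>x. (1 / \<gamma>) * (f1 x + f2 x) + B * H x)"
    have f12: "C2_on act_pos (\<lambda>x. f1 x + f2 x)" by (intro C2_on_add open_act_pos f1(1) f2(1))
    have fp: "C2_on act_pos (\<lambda>x. (1 / \<gamma>) * (f1 x + f2 x))" "C2_on act_pos (\<lambda>x. B * H x)"
      by (intro C2_on_cmult open_act_pos f12 H(1))+
    have fC: "C2_on act_pos f" unfolding f_def by (intro C2_on_add open_act_pos fp)
    have fgen: "gen_b \<gamma> T1 T3 f x = (A * (T1 - coord 1 x ^ 3) + ((coord 1 x)^2 - 3 / 4 * T1 / coord 1 x))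
        + (27 / (100 * \<tau>) * (T3 - coord 2 x ^ 3) + 24 / 100 * ((coord 2 x)^2 - 3 / 4 * T3 / coord 2 x))
        + B * gen_b \<gamma> T1 T3 H x" if x: "x \<in> act_pos" for x
    proof -
      have "gen_b \<gamma> T1 T3 f x = (1 / \<gamma>) * (gen_b \<gamma> T1 T3 f1 x + gen_b \<gamma> T1 T3 f2 x) + B * gen_b \<gamma> T1 T3 H x"
        unfolding f_def gen_b_add[OF open_act_pos fp x] gen_b_cmult[OF open_act_pos f12 x]
          gen_b_cmult[OF open_act_pos H(1) x] gen_b_add[OF open_act_pos f1(1) f2(1) x] ..
      moreover have "(1 / \<gamma>) * (\<gamma> * a + \<gamma> * b) = a + b" for a b using g by (simp add: field_simps)
      ultimately show ?thesis unfolding f1(2)[OF x] f2(2)[OF x] by simp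
    qed
    \<comment> \<open>A rounded centre: the I3 equation has stationary mean about 0.92
      \<tau>.\<close>
    define m0 where "m0 = 9 / 10 * \<tau>"
    define G where "G = (\<lambda>x. (h_obs x - (- (sqrt 3 / 2 * m0)))^2)"
    have ch: "continuous_on UNIV h_obs"
      unfolding h_obs_alt[abs_def] by (intro continuous_intros)
    have "integrable \<pi> G \<and> (\<integral>x. G x \<partial>\<pi>) \<le> 98 / 1000 * \<tau>^2"
    proof (rule lyapunov_integral_bound[OF inv g(1) T1(1) assms fC])
      show "f (upd 3 x (coord 3 x + 2 * pi)) = f x" "f (upd 4 x (coord 4 x + 2 * pi)) = f x" if "x \<in> act_pos" for x
        using Hper[OF that] by (simp_all add: f_def f1_def f2_def coord_upd)
      show "continuous_on UNIV G" unfolding G_def by (intro continuous_intros ch)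
      show "0 \<le> G x" for x by (simp add: G_def)
      show "0 \<le> 98 / 1000 * \<tau>^2" by simp
      show "\<exists>K. compact K \<and> K \<subseteq> {(a, b). 0 < a \<and> 0 < b} \<and> (\<forall>x\<in>act_pos. (coord 1 x, coord 2 x) \<notin> K \<longrightarrow> N \<le> f x)" for N
      proof -
        have pos: "0 < A" "(0::real) < 1" "0 < 27 / (100 * \<tau>)" "(0::real) < 24 / 100" using A0 t0 by simp_all
        obtain m1 where m1: "\<And>s. 0 < s \<Longrightarrow> m1 \<le> A * s - 1 * ln s"
          using linear_minus_log[OF pos(1,2)] pos by (smt (verit) mult_pos_pos half_gt_zero)
        obtain m2 where m2: "\<And>s. 0 < s \<Longrightarrow> m2 \<le> 27 / (100 * \<tau>) * s - 24 / 100 * ln s"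
          using linear_minus_log[OF pos(3,4)] pos by (smt (verit) mult_pos_pos half_gt_zero)
        \<comment> \<open>Each of f1 and f2 is bounded below, so their sum can lie under L only if
          both are bounded above, which confines both actions.\<close>
        define L where "L = \<gamma> * (N + B * Bd)"
        obtain l1 r1 where 1: "0 < l1" "\<And>s. 0 < s \<Longrightarrow> A * s - 1 * ln s < L - m2 \<Longrightarrow> l1 \<le> s \<and> s \<le> r1"
          using log_coercive[OF pos(1,2)] by blast
        obtain l2 r2 where 2: "0 < l2" "\<And>s. 0 < s \<Longrightarrow> 27 / (100 * \<tau>) * s - 24 / 100 * ln s < L - m1 \<Longrightarrow> l2 \<le> s \<and> s \<le> r2"
          using log_coercive[OF pos(3,4)] by blast
        show ?thesis
        proof (intro exI[of _ "{l1..r1} \<times> {l2..r2}"] conjI ballI impI)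
          show "compact ({l1..r1} \<times> {l2..r2})" by (intro compact_Times compact_Icc)
          show "{l1..r1} \<times> {l2..r2} \<subseteq> {(a, b). 0 < a \<and> 0 < b}" using 1(1) 2(1) by auto
          fix x assume x: "x \<in> act_pos" and nK: "(coord 1 x, coord 2 x) \<notin> {l1..r1} \<times> {l2..r2}"
          have p: "0 < coord 1 x" "0 < coord 2 x" using x by (auto simp: act_pos_def)
          have "L \<le> f1 x + f2 x"
          proof (rule ccontr)
            assume "\<not> L \<le> f1 x + f2 x"
            then have "f1 x < L - m2" "f2 x < L - m1"
              using m1[OF p(1)] m2[OF p(2)] by (auto simp: f1_def f2_def)
            then show False using 1(2)[OF p(1)] 2(2)[OF p(2)] nK by (auto simp: f1_def f2_def)
          qed
          then have "N + B * Bd \<le> (1 / \<gamma>) * (f1 x + f2 x)" using g by (simp add: L_def field_simps)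
          moreover have "B * - Bd \<le> B * H x" using H(2)[OF x] B0 by (intro mult_left_mono) auto
          ultimately show "N \<le> f x" by (simp add: f_def)
        qed
      qed
      show "G x + gen_b \<gamma> T1 T3 f x \<le> 98 / 1000 * \<tau>^2" if x: "x \<in> act_pos" for x
      proof -
        let ?J = "coord 1 x" and ?I = "coord 2 x"
        have p: "0 < ?J" "0 < ?I" using x by (auto simp: act_pos_def)
        have e1: "G x \<le> 4 / 5 * (?I - m0)^2 + 32 * ?J^2 + 32 * (?I^2 * (dev x)^2)"
          using h_obs_deviation[of x m0] p by (simp add: G_def)
        have e2: "32 * (?I^2 * (dev x)^2) + B * gen_b \<gamma> T1 T3 H x \<le> (?I ^ 3 / \<tau> + \<tau> ^ 3 / ?I) / 200 + A1 * ?J ^ 3 + B * (C * (?J + \<sigma>))"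
        \<comment> \<open>In the first case the barrier cancels the angular error; in the second the
          error is dominated by the actions alone.\<close>
        proof (cases "1 \<le> cut_arg R x")
          case True
          have "?I \<le> R" using cut_region(3)[OF R(1) x] True by simp
          then have "?I^2 \<le> R^2" using p by (intro power_mono) auto
          then have "32 * (?I^2 * (dev x)^2) \<le> 32 * (R^2 * (dev x)^2)" by (simp add: mult_right_mono)
          also have "\<dots> = B * (c * (dev x)^2)" using B0(2) by (simp add: mult.assoc[symmetric])
          finally have "32 * (?I^2 * (dev x)^2) \<le> B * (c * (dev x)^2)" .
          moreover have "B * gen_b \<gamma> T1 T3 H x \<le> B * (- c * (dev x)^2 + C * (?J + \<sigma>))"
            using B0 by (intro mult_left_mono Hg x True) auto
          moreover have "B * (- c * (dev x)^2 + C * (?J + \<sigma>)) = - (B * (c * (dev x)^2)) + B * (C * (?J + \<sigma>))"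
            by (simp add: algebra_simps)
          moreover have "0 \<le> (?I ^ 3 / \<tau> + \<tau> ^ 3 / ?I) / 200" "0 \<le> A1 * ?J ^ 3" using p t0 A1 by simp_all
          ultimately show ?thesis by linarith
        next
          case False
          have "\<bar>dev x\<bar> \<le> 1 + 1"
            unfolding dev_def using sqrt3_bounds by (intro abs_add_mono) auto
          then have "(dev x)^2 \<le> 4" using abs_mult_mono[of "dev x" 2 "dev x" 2] by (simp add: power2_eq_square)
          then have "32 * (?I^2 * (dev x)^2) \<le> 32 * (?I^2 * 4)" by (intro mult_left_mono) auto
          also have "\<dots> = 128 * ?I^2" by simp
          also have "\<dots> \<le> E * (?I ^ 3 + inverse ?I) + A1 * ?J ^ 3"
            unfolding A1_def by (rule cut_region_complement[OF x E0 R(2) False])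
          also have "E * (?I ^ 3 + inverse ?I) \<le> (?I ^ 3 / \<tau> + \<tau> ^ 3 / ?I) / 200"
          proof -
            have "E * ?I ^ 3 \<le> 1 / \<tau> / 200 * ?I ^ 3" "E * inverse ?I \<le> \<tau> ^ 3 / 200 * inverse ?I"
              unfolding E_def using p by (intro mult_right_mono; simp)+
            moreover have "(?I ^ 3 / \<tau> + \<tau> ^ 3 / ?I) / 200 = 1 / \<tau> / 200 * ?I ^ 3 + \<tau> ^ 3 / 200 * inverse ?I"
              by (simp add: inverse_eq_divide add_divide_distrib mult_ac)
            ultimately show ?thesis unfolding distrib_left by linarith
          qed
          finally have "32 * (?I^2 * (dev x)^2) \<le> (?I ^ 3 / \<tau> + \<tau> ^ 3 / ?I) / 200 + A1 * ?J ^ 3" by simp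
          moreover have "B * gen_b \<gamma> T1 T3 H x \<le> B * (C * (?J + \<sigma>))"
            using B0 by (intro mult_left_mono Hg x) auto
          ultimately show ?thesis by linarith
        qed
        have e3: "4 / 5 * (?I - m0)^2 + 27 / (100 * \<tau>) * (T3 - ?I ^ 3) + 24 / 100 * (?I^2 - 3 / 4 * T3 / ?I)
            + (?I ^ 3 / \<tau> + \<tau> ^ 3 / ?I) / 200 \<le> 95 / 1000 * \<tau>^2"
          using action_drift_bound[OF t0 p(2)] unfolding m0_def t3(1) .
        have e4: "33 * ?J^2 + B * C * ?J \<le> s + A2 * ?J ^ 3" using A2(2)[of ?J] p by simp
        have e5: "A * (T1 - ?J ^ 3) = A * T1 - A1 * ?J ^ 3 - A2 * ?J ^ 3" by (simp add: A_def algebra_simps)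
        have e6: "0 \<le> 3 / 4 * T1 / ?J" using T1 p by simp
        have e7: "B * (C * (?J + \<sigma>)) = B * C * ?J + B * C * \<sigma>" by (simp add: algebra_simps)
        have e8: "95 / 1000 * \<tau>^2 + s + s + s = 98 / 1000 * \<tau>^2" by (simp add: s_def)
        have "g + ((w + (j2 - z)) + (d + d') + Bh) \<le> t"
          if "g \<le> q + 32 * j2 + y" "y + Bh \<le> e + a1 + k" "q + d + d' + e \<le> t95" "33 * j2 + bj \<le> s + a2"
            "w = aT - a1 - a2" "0 \<le> z" "k = bj + bs" "t95 + s + s + s = t" "aT \<le> s" "bs \<le> s"
          for g w j2 z d d' Bh t q y e a1 k t95 bj a2 aT bs :: real
          using that by linarith
        from this[OF e1 e2 e3 e4 e5 e6 e7 e8 AT sgs(2)] show ?thesis unfolding fgen[OF x] .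
      qed
    qed
    then have iG: "integrable \<pi> G" and eG: "(\<integral>x. G x \<partial>\<pi>) \<le> 98 / 1000 * \<tau>^2" by auto
    have mh: "h_obs \<in> borel_measurable \<pi>"
      using borel_measurable_continuous_onI[OF ch] by (simp add: measurable_cong_sets[OF sets refl])
    note v = variance_le_second_moment[OF mh iG[unfolded G_def]]
    show "integrable \<pi> (\<lambda>x. (h_obs x)^2)" by (rule v(1))
    have "variance h_obs \<le> 98 / 1000 * \<tau>^2" using v(2) eG unfolding G_def by linarith
    also have "\<dots> < (1/10) * T3 powr (2/3)" using t0 unfolding t3(2)[symmetric] by simp
    finally show "variance h_obs < (1/10) * T3 powr (2/3)" .
  qed
qed

end
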